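(* Let $T$ be a complete (multi-sorted) totally transcendental theory with quantifier elimination and elimination of imaginaries, $\overline{\mathcal M}\models T$ sufficiently saturated, $B$ a small set of parameters and $\mathcal C$ a $B$-definable set. Suppose $p\in S(B)$ is fundamental $\mathcal C$-internal and weakly $\mathcal C$-orthogonal. Then there exists a $B$-definable bitorsor $(\mathcal G,p(\overline{\mathcal M}),\widehat{\mathcal G})$ such that (a) $\mathcal G$ is the binding group for $p$ relative to $\mathcal C$ over $B$, and (b) $\widehat{\mathcal G}\subseteq\operatorname{dcl}(B\mathcal C)$.
   Context: $p\in S(B)$ is fundamental $\mathcal C$-internal if $p(\overline{\mathcal M})\subseteq\operatorname{dcl}(Ba\mathcal C)$ for some (equivalently any) $a\models p$. It is weakly $\mathcal C$-orthogonal if it isolates a complete type over $B\cup\mathcal C$. $\operatorname{Aut}_B(p/\mathcal C)$ denotes the group of restrictions to $p(\overline{\mathcal M})$ of automorphisms of $\overline{\mathcal M}$ fixing $B\cup\mathcal C$ pointwise. A (definable) binding group for $p$ relative to $\mathcal C$ over $B$ is a $B$-definable group $\mathcal G$ with a (relatively) $B$-definable faithful left action on $p(\overline{\mathcal M})$ such that there is a group isomorphism between $\mathcal G$ and $\operatorname{Aut}_B(p/\mathcal C)$ respecting the action on $p(\overline{\mathcal M})$. (For $p$ fundamental $\mathcal C$-internal and weakly $\mathcal C$-orthogonal it is unique up to $B$-definable isomorphism, so one says "the" binding group.) A bitorsor is a triple $(G,S,H)$ where $G$ is a group with a uniquely transitive left action on the set $S$, $H$ is a group with a uniquely transitive right action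 on $S$, and $(ga)h=g(ah)$ for all $g\in G$, $a\in S$, $h\in H$. It is $B$-definable if the groups, the set and the actions are all $B$-definable. *)

theory Defs
  imports Main "HOL-Library.Disjoint_Sets" "HOL-Algebra.Group_Action"
begin

unbundle cardinal_syntax

section \<open>Many-sorted first-order logic\<close>

text \<open>The sorts are the elements of the type \<open>'s\<close>. The variable \<open>(s, i)\<close> is the \<open>i\<close>-th variable
  of sort \<open>s\<close>.\<close>

record ('f, 'r, 's) lang =
  funs :: "'f set"
  fargs :: "'f \<Rightarrow> 's list"
  fres :: "'f \<Rightarrow> 's"
  rels :: "'r set"
  rargs :: "'r \<Rightarrow> 's list"

datatype ('f, 's) trm = Var "'s \<times> nat" | Fn 'f "('f, 's) trm list"

datatype ('f, 'r, 's) fm =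
    Bot
  | Eq "('f, 's) trm" "('f, 's) trm"
  | Rel 'r "('f, 's) trm list"
  | Imp "('f, 'r, 's) fm" "('f, 'r, 's) fm"
  | All "'s \<times> nat" "('f, 'r, 's) fm"

abbreviation Neg :: "('f, 'r, 's) fm \<Rightarrow> ('f, 'r, 's) fm" where
  "Neg \<phi> \<equiv> Imp \<phi> Bot"

inductive has_sort :: "('f, 'r, 's) lang \<Rightarrow> ('f, 's) trm \<Rightarrow> 's \<Rightarrow> bool" for L where
  "has_sort L (Var (s, i)) s"
| "f \<in> funs L \<Longrightarrow> list_all2 (has_sort L) ts (fargs L f) \<Longrightarrow> has_sort L (Fn f ts) (fres L f)"

primrec wf_fm :: "('f, 'r, 's) lang \<Rightarrow> ('f, 'r, 's) fm \<Rightarrow> bool" where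
  "wf_fm L Bot = True"
| "wf_fm L (Eq t u) = (\<exists>s. has_sort L t s \<and> has_sort L u s)"
| "wf_fm L (Rel R ts) = (R \<in> rels L \<and> list_all2 (has_sort L) ts (rargs L R))"
| "wf_fm L (Imp \<phi> \<psi>) = (wf_fm L \<phi> \<and> wf_fm L \<psi>)"
| "wf_fm L (All v \<phi>) = wf_fm L \<phi>"

primrec tvars :: "('f, 's) trm \<Rightarrow> ('s \<times> nat) set" where
  "tvars (Var v) = {v}"
| "tvars (Fn f ts) = \<Union> (set (map tvars ts))"

primrec fv :: "('f, 'r, 's) fm \<Rightarrow> ('s \<times> nat) set" where
  "fv Bot = {}"
| "fv (Eq t u) = tvars t \<union> tvars u"
| "fv (Rel R ts) = \<Union> (set (map tvars ts))"
| "fv (Imp \<phi> \<psi>) = fv \<phi> \<union> fv \<psi>"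
| "fv (All v \<phi>) = fv \<phi> - {v}"

primrec qfree :: "('f, 'r, 's) fm \<Rightarrow> bool" where
  "qfree Bot = True"
| "qfree (Eq t u) = True"
| "qfree (Rel R ts) = True"
| "qfree (Imp \<phi> \<psi>) = (qfree \<phi> \<and> qfree \<psi>)"
| "qfree (All v \<phi>) = False"

record ('f, 'r, 's, 'm) struct =
  univ :: "'s \<Rightarrow> 'm set"
  fint :: "'f \<Rightarrow> 'm list \<Rightarrow> 'm"
  rint :: "'r \<Rightarrow> 'm list \<Rightarrow> bool"

text \<open>Tuples are lists; \<open>tuples M [s\<^sub>1, \<dots>, s\<^sub>n]\<close> is the product of the sorts \<open>s\<^sub>1, \<dots>, s\<^sub>n\<close> of \<open>M\<close>.\<close>

definition tuples :: "('f, 'r, 's, 'm) struct \<Rightarrow> 's list \<Rightarrow> 'm list set" where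
  "tuples M \<sigma> = {as. list_all2 (\<lambda>a s. a \<in> univ M s) as \<sigma>}"

definition elements :: "('f, 'r, 's, 'm) struct \<Rightarrow> 'm set" where
  "elements M = (\<Union>s. univ M s)"

definition lang_structure :: "('f, 'r, 's) lang \<Rightarrow> ('f, 'r, 's, 'm) struct \<Rightarrow> bool" where
  "lang_structure L M \<longleftrightarrow>
     (\<forall>s. univ M s \<noteq> {}) \<and> disjoint_family (univ M) \<and>
     (\<forall>f\<in>funs L. \<forall>as\<in>tuples M (fargs L f). fint M f as \<in> univ M (fres L f))"

primrec eval :: "('f, 'r, 's, 'm) struct \<Rightarrow> ('s \<times> nat \<Rightarrow> 'm) \<Rightarrow> ('f, 's) trm \<Rightarrow> 'm" where
  "eval M e (Var v) = e v"
| "eval M e (Fn f ts) = fint M f (map (eval M e) ts)"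

primrec sat :: "('f, 'r, 's, 'm) struct \<Rightarrow> ('s \<times> nat \<Rightarrow> 'm) \<Rightarrow> ('f, 'r, 's) fm \<Rightarrow> bool" where
  "sat M e Bot = False"
| "sat M e (Eq t u) = (eval M e t = eval M e u)"
| "sat M e (Rel R ts) = rint M R (map (eval M e) ts)"
| "sat M e (Imp \<phi> \<psi>) = (sat M e \<phi> \<longrightarrow> sat M e \<psi>)"
| "sat M e (All v \<phi>) = (\<forall>a\<in>univ M (fst v). sat M (e(v := a)) \<phi>)"

text \<open>\<open>formula_in L [s\<^sub>0, \<dots>, s\<^sub>n\<^sub>-\<^sub>1] \<phi>\<close>: \<open>\<phi>\<close> is an \<open>L\<close>-formula \<open>\<phi>(x\<^sub>0, \<dots>, x\<^sub>n\<^sub>-\<^sub>1)\<close>, where \<open>x\<^sub>i\<close> is the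
  variable \<open>(s\<^sub>i, i)\<close>; \<open>holds M \<phi> [a\<^sub>0, \<dots>, a\<^sub>n\<^sub>-\<^sub>1]\<close> is then \<open>M \<Turnstile> \<phi>(a\<^sub>0, \<dots>, a\<^sub>n\<^sub>-\<^sub>1)\<close>.\<close>

definition formula_in :: "('f, 'r, 's) lang \<Rightarrow> 's list \<Rightarrow> ('f, 'r, 's) fm \<Rightarrow> bool" where
  "formula_in L \<sigma> \<phi> \<longleftrightarrow> wf_fm L \<phi> \<and> fv \<phi> \<subseteq> {(\<sigma> ! i, i) | i. i < length \<sigma>}"

definition holds :: "('f, 'r, 's, 'm) struct \<Rightarrow> ('f, 'r, 's) fm \<Rightarrow> 'm list \<Rightarrow> bool" where
  "holds M \<phi> as \<longleftrightarrow> sat M (\<lambda>(s, i). as ! i) \<phi>"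

text \<open>Theories are identified with their deductive closures, so that a complete (consistent) theory
  contains every sentence or its negation. Consistency is not required here: it follows from the
  existence of a model.\<close>

definition complete_theory :: "('f, 'r, 's) lang \<Rightarrow> ('f, 'r, 's) fm set \<Rightarrow> bool" where
  "complete_theory L T \<longleftrightarrow>
     (\<forall>\<phi>\<in>T. formula_in L [] \<phi>) \<and> (\<forall>\<phi>. formula_in L [] \<phi> \<longrightarrow> \<phi> \<in> T \<or> Neg \<phi> \<in> T)"

definition model_of ::
  "('f, 'r, 's) lang \<Rightarrow> ('f, 'r, 's) fm set \<Rightarrow> ('f, 'r, 's, 'm) struct \<Rightarrow> bool" where
  "model_of L T M \<longleftrightarrow> lang_structure L M \<and> (\<forall>\<phi>\<in>T. holds M \<phi> [])"

section \<open>Definable sets and types\<close>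

text \<open>A formula over a parameter set \<open>A\<close> in variables of sorts \<open>\<sigma>\<close> is a pair \<open>(\<phi>, bs)\<close> standing for
  \<open>\<phi>(x, bs)\<close>.\<close>

type_synonym ('f, 'r, 's, 'm) pfm = "('f, 'r, 's) fm \<times> 'm list"

definition pfms ::
  "('f, 'r, 's) lang \<Rightarrow> ('f, 'r, 's, 'm) struct \<Rightarrow> 'm set \<Rightarrow> 's list \<Rightarrow> ('f, 'r, 's, 'm) pfm set" where
  "pfms L M A \<sigma> =
     {(\<phi>, bs). set bs \<subseteq> A \<and> (\<exists>\<tau>. bs \<in> tuples M \<tau> \<and> formula_in L (\<sigma> @ \<tau>) \<phi>)}"

definition sols ::
  "('f, 'r, 's, 'm) struct \<Rightarrow> 's list \<Rightarrow> ('f, 'r, 's, 'm) pfm \<Rightarrow> 'm list set" where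
  "sols M \<sigma> \<psi> = {as \<in> tuples M \<sigma>. holds M (fst \<psi>) (as @ snd \<psi>)}"

definition definable ::
  "('f, 'r, 's) lang \<Rightarrow> ('f, 'r, 's, 'm) struct \<Rightarrow> 'm set \<Rightarrow> 's list \<Rightarrow> 'm list set \<Rightarrow> bool" where
  "definable L M A \<sigma> X \<longleftrightarrow> (\<exists>\<psi>\<in>pfms L M A \<sigma>. X = sols M \<sigma> \<psi>)"

definition dcl ::
  "('f, 'r, 's) lang \<Rightarrow> ('f, 'r, 's, 'm) struct \<Rightarrow> 'm set \<Rightarrow> 'm set" where
  "dcl L M A = {a. \<exists>s. a \<in> univ M s \<and> definable L M A [s] {[a]}}"

text \<open>A set of tuples used as a parameter set stands for the set of coordinates of its members.\<close>

definition coords :: "'m list set \<Rightarrow> 'm set" where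
  "coords X = (\<Union>a\<in>X. set a)"

definition realizations ::
  "('f, 'r, 's, 'm) struct \<Rightarrow> 's list \<Rightarrow> ('f, 'r, 's, 'm) pfm set \<Rightarrow> 'm list set" where
  "realizations M \<sigma> p = {as \<in> tuples M \<sigma>. \<forall>\<psi>\<in>p. as \<in> sols M \<sigma> \<psi>}"

text \<open>\<open>S\<^sub>\<sigma>(A)\<close>. Consistency with the elementary diagram is finite satisfiability in \<open>M\<close>.\<close>

definition types ::
  "('f, 'r, 's) lang \<Rightarrow> ('f, 'r, 's, 'm) struct \<Rightarrow> 'm set \<Rightarrow> 's list
     \<Rightarrow> ('f, 'r, 's, 'm) pfm set set" where
  "types L M A \<sigma> = {p. p \<subseteq> pfms L M A \<sigma> \<and>
     (\<forall>p0\<subseteq>p. finite p0 \<longrightarrow> realizations M \<sigma> p0 \<noteq> {}) \<and>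
     (\<forall>\<phi> bs. (\<phi>, bs) \<in> pfms L M A \<sigma> \<longrightarrow> (\<phi>, bs) \<in> p \<or> (Neg \<phi>, bs) \<in> p)}"

section \<open>Hypotheses on the theory and on the ambient model\<close>

text \<open>Quantifier elimination, elimination of imaginaries and total transcendence are properties of
  the complete theory of \<open>M\<close>. The first two hold in one model of a complete theory iff they hold in
  all of them; Morley rank is computed, as usual, in a sufficiently saturated model.\<close>

definition quantifier_elimination ::
  "('f, 'r, 's) lang \<Rightarrow> ('f, 'r, 's, 'm) struct \<Rightarrow> bool" where
  "quantifier_elimination L M \<longleftrightarrow>
     (\<forall>\<sigma> \<phi>. formula_in L \<sigma> \<phi> \<longrightarrow>
        (\<exists>\<psi>. qfree \<psi> \<and> formula_in L \<sigma> \<psi> \<and> (\<forall>as\<in>tuples M \<sigma>. holds M \<phi> as \<longleftrightarrow> holds M \<psi> as)))"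

text \<open>Elimination of imaginaries in the uniform sense: every \<open>\<emptyset>\<close>-definable equivalence relation is the
  kernel of a \<open>\<emptyset>\<close>-definable function into some product of sorts.\<close>

definition elimination_of_imaginaries ::
  "('f, 'r, 's) lang \<Rightarrow> ('f, 'r, 's, 'm) struct \<Rightarrow> bool" where
  "elimination_of_imaginaries L M \<longleftrightarrow>
     (\<forall>\<sigma> E. equiv (tuples M \<sigma>) E \<and> definable L M {} (\<sigma> @ \<sigma>) {a @ b | a b. (a, b) \<in> E} \<longrightarrow>
        (\<exists>\<rho> f. f \<in> tuples M \<sigma> \<rightarrow> tuples M \<rho> \<and>
           definable L M {} (\<sigma> @ \<rho>) {a @ f a | a. a \<in> tuples M \<sigma>} \<and>
           (\<forall>a\<in>tuples M \<sigma>. \<forall>b\<in>tuples M \<sigma>. (a, b) \<in> E \<longleftrightarrow> f a = f b)))"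

text \<open>\<open>morley_ge L M \<sigma> r X \<alpha>\<close> is \<open>RM(X) \<ge> \<alpha>\<close>, where ordinals are elements \<open>\<alpha>\<close> of a well-order \<open>r\<close>. The
  usual clauses for \<open>0\<close>, successors and limits are merged: \<open>RM(X) \<ge> \<alpha>\<close> iff \<open>X\<close> is nonempty and for
  every \<open>\<beta> < \<alpha>\<close> there are infinitely many disjoint definable subsets of \<open>X\<close> of rank \<open>\<ge> \<beta>\<close>.\<close>

inductive morley_ge ::
  "('f, 'r, 's) lang \<Rightarrow> ('f, 'r, 's, 'm) struct \<Rightarrow> 's list \<Rightarrow> 'o rel \<Rightarrow> 'm list set \<Rightarrow> 'o \<Rightarrow> bool"
  for L M \<sigma> r where
  "X \<noteq> {} \<Longrightarrow>
   (\<forall>\<beta>. (\<beta>, \<alpha>) \<in> r \<and> \<beta> \<noteq> \<alpha> \<longrightarrow>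
      (\<exists>F :: nat \<Rightarrow> 'm list set. disjoint_family F \<and>
         (\<forall>i. F i \<subseteq> X \<and> definable L M (elements M) \<sigma> (F i) \<and> morley_ge L M \<sigma> r (F i) \<beta>))) \<Longrightarrow>
   morley_ge L M \<sigma> r X \<alpha>"

text \<open>Every definable set has Morley rank \<open>< \<infinity>\<close>. The Morley ranks of definable sets that are
  ordinals form an initial segment, so they have cardinality at most that of the family of definable
  sets; hence well-orders of the type \<open>'m list set\<close> provide enough ordinals.\<close>

definition totally_transcendental ::
  "('f, 'r, 's) lang \<Rightarrow> ('f, 'r, 's, 'm) struct \<Rightarrow> bool" where
  "totally_transcendental L M \<longleftrightarrow>
     (\<forall>\<sigma> X. definable L M (elements M) \<sigma> X \<longrightarrow>
        (\<exists>r :: 'm list set rel. Well_order r \<and> (\<exists>\<alpha>\<in>Field r. \<not> morley_ge L M \<sigma> r X \<alpha>)))"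

definition saturated ::
  "('f, 'r, 's) lang \<Rightarrow> ('f, 'r, 's, 'm) struct \<Rightarrow> 'k rel \<Rightarrow> bool" where
  "saturated L M \<kappa> \<longleftrightarrow>
     (\<forall>A \<sigma> p. A \<subseteq> elements M \<and> |A| <o \<kappa> \<and> p \<in> types L M A \<sigma> \<longrightarrow> realizations M \<sigma> p \<noteq> {})"

text \<open>\<open>M\<close> is saturated, in a cardinal \<open>\<kappa>\<close> greater than the (infinite) number of \<open>L\<close>-formulas; sets of
  cardinality \<open>< \<kappa>\<close> are small. The cardinality of \<open>M\<close> is \<open>\<kappa>\<close> unless all sorts of \<open>M\<close> are finite.\<close>

definition sufficiently_saturated ::
  "('f, 'r, 's) lang \<Rightarrow> ('f, 'r, 's, 'm) struct \<Rightarrow> 'k rel \<Rightarrow> bool" where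
  "sufficiently_saturated L M \<kappa> \<longleftrightarrow>
     Card_order \<kappa> \<and> |{\<phi>. wf_fm L \<phi>}| <o \<kappa> \<and> |elements M| \<le>o \<kappa> \<and> saturated L M \<kappa>"

section \<open>Internality and orthogonality\<close>

definition fundamental_internal ::
  "('f, 'r, 's) lang \<Rightarrow> ('f, 'r, 's, 'm) struct \<Rightarrow> 'm set \<Rightarrow> 'm list set \<Rightarrow> 's list
     \<Rightarrow> ('f, 'r, 's, 'm) pfm set \<Rightarrow> bool" where
  "fundamental_internal L M B C \<sigma> p \<longleftrightarrow>
     (\<exists>a\<in>realizations M \<sigma> p. coords (realizations M \<sigma> p) \<subseteq> dcl L M (B \<union> set a \<union> coords C))"

definition weakly_orthogonal ::
  "('f, 'r, 's) lang \<Rightarrow> ('f, 'r, 's, 'm) struct \<Rightarrow> 'm set \<Rightarrow> 'm list set \<Rightarrow> 's list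
     \<Rightarrow> ('f, 'r, 's, 'm) pfm set \<Rightarrow> bool" where
  "weakly_orthogonal L M B C \<sigma> p \<longleftrightarrow>
     (\<exists>q\<in>types L M (B \<union> coords C) \<sigma>. \<forall>\<psi>\<in>q. \<exists>p0\<subseteq>p. finite p0 \<and> realizations M \<sigma> p0 \<subseteq> sols M \<sigma> \<psi>)"

section \<open>Automorphisms, binding groups and bitorsors\<close>

definition automorphisms ::
  "('f, 'r, 's) lang \<Rightarrow> ('f, 'r, 's, 'm) struct \<Rightarrow> 'm set \<Rightarrow> ('m \<Rightarrow> 'm) set" where
  "automorphisms L M A = {h.
     (\<forall>s. bij_betw h (univ M s) (univ M s)) \<and>
     (\<forall>f\<in>funs L. \<forall>as\<in>tuples M (fargs L f). h (fint M f as) = fint M f (map h as)) \<and>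
     (\<forall>R\<in>rels L. \<forall>as\<in>tuples M (rargs L R). rint M R (map h as) \<longleftrightarrow> rint M R as) \<and>
     (\<forall>a\<in>A. h a = a)}"

definition Aut_over ::
  "('f, 'r, 's) lang \<Rightarrow> ('f, 'r, 's, 'm) struct \<Rightarrow> 'm set \<Rightarrow> 'm list set \<Rightarrow> 's list
     \<Rightarrow> ('f, 'r, 's, 'm) pfm set \<Rightarrow> ('m list \<Rightarrow> 'm list) monoid" where
  "Aut_over L M B C \<sigma> p = BijGroup (realizations M \<sigma> p)
     \<lparr>carrier := (\<lambda>h. restrict (map h) (realizations M \<sigma> p)) ` automorphisms L M (B \<union> coords C)\<rparr>"

text \<open>The graph of a binary operation, as a set of concatenated tuples.\<close>

definition graph2 ::
  "'m list set \<Rightarrow> 'm list set \<Rightarrow> ('m list \<Rightarrow> 'm list \<Rightarrow> 'm list) \<Rightarrow> 'm list set" where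
  "graph2 X Y f = {x @ y @ f x y | x y. x \<in> X \<and> y \<in> Y}"

definition definable_group ::
  "('f, 'r, 's) lang \<Rightarrow> ('f, 'r, 's, 'm) struct \<Rightarrow> 'm set \<Rightarrow> 's list \<Rightarrow> 'm list monoid \<Rightarrow> bool" where
  "definable_group L M A \<rho> G \<longleftrightarrow>
     group G \<and> definable L M A \<rho> (carrier G) \<and>
     definable L M A (\<rho> @ \<rho> @ \<rho>) (graph2 (carrier G) (carrier G) (mult G))"

definition binding_group ::
  "('f, 'r, 's) lang \<Rightarrow> ('f, 'r, 's, 'm) struct \<Rightarrow> 'm set \<Rightarrow> 'm list set \<Rightarrow> 's list
     \<Rightarrow> ('f, 'r, 's, 'm) pfm set \<Rightarrow> 's list \<Rightarrow> 'm list monoid \<Rightarrow> ('m list \<Rightarrow> 'm list \<Rightarrow> 'm list) \<Rightarrow> bool"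
  where
  "binding_group L M B C \<sigma> p \<rho> G act \<longleftrightarrow>
     definable_group L M B \<rho> G \<and>
     faithful_action G (realizations M \<sigma> p) act \<and>
     (\<exists>D. definable L M B (\<rho> @ \<sigma> @ \<sigma>) D \<and>
        graph2 (carrier G) (realizations M \<sigma> p) act =
          D \<inter> {g @ a @ b | g a b. g \<in> carrier G \<and> a \<in> realizations M \<sigma> p \<and> b \<in> realizations M \<sigma> p}) \<and>
     (\<exists>\<Phi>\<in>iso G (Aut_over L M B C \<sigma> p).
        \<forall>g\<in>carrier G. \<forall>a\<in>realizations M \<sigma> p. \<Phi> g a = act g a)"

definition right_action :: "('h, 'x) monoid_scheme \<Rightarrow> 'a set \<Rightarrow> ('a \<Rightarrow> 'h \<Rightarrow> 'a) \<Rightarrow> bool" where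
  "right_action H S act \<longleftrightarrow>
     group H \<and>
     (\<forall>a\<in>S. \<forall>h\<in>carrier H. act a h \<in> S) \<and>
     (\<forall>a\<in>S. act a \<one>\<^bsub>H\<^esub> = a) \<and>
     (\<forall>a\<in>S. \<forall>h\<in>carrier H. \<forall>k\<in>carrier H. act (act a h) k = act a (h \<otimes>\<^bsub>H\<^esub> k))"

definition bitorsor ::
  "('g, 'x) monoid_scheme \<Rightarrow> ('g \<Rightarrow> 'a \<Rightarrow> 'a) \<Rightarrow> 'a set \<Rightarrow> ('h, 'y) monoid_scheme \<Rightarrow> ('a \<Rightarrow> 'h \<Rightarrow> 'a)
     \<Rightarrow> bool" where
  "bitorsor G l S H r \<longleftrightarrow>
     group_action G S l \<and> (\<forall>a\<in>S. \<forall>b\<in>S. \<exists>!g. g \<in> carrier G \<and> l g a = b) \<and>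
     right_action H S r \<and> (\<forall>a\<in>S. \<forall>b\<in>S. \<exists>!h. h \<in> carrier H \<and> r a h = b) \<and>
     (\<forall>g\<in>carrier G. \<forall>a\<in>S. \<forall>h\<in>carrier H. r (l g a) h = l g (r a h))"

definition definable_bitorsor ::
  "('f, 'r, 's) lang \<Rightarrow> ('f, 'r, 's, 'm) struct \<Rightarrow> 'm set
     \<Rightarrow> 's list \<Rightarrow> 'm list monoid \<Rightarrow> ('m list \<Rightarrow> 'm list \<Rightarrow> 'm list)
     \<Rightarrow> 's list \<Rightarrow> 'm list set
     \<Rightarrow> 's list \<Rightarrow> 'm list monoid \<Rightarrow> ('m list \<Rightarrow> 'm list \<Rightarrow> 'm list) \<Rightarrow> bool" where
  "definable_bitorsor L M A \<rho> G l \<sigma> S \<eta> H r \<longleftrightarrow>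
     bitorsor G l S H r \<and>
     definable_group L M A \<rho> G \<and> definable L M A \<sigma> S \<and> definable_group L M A \<eta> H \<and>
     definable L M A (\<rho> @ \<sigma> @ \<sigma>) (graph2 (carrier G) S l) \<and>
     definable L M A (\<sigma> @ \<eta> @ \<sigma>) (graph2 S (carrier H) r)"

end

theory Submission
  imports Defs
begin

text \<open>
  Compactness and internality give finitely many \<open>B\<close>-definable partial functions \<open>F\<^sub>i(x, c)\<close>, with
  \<open>c\<close> a tuple from \<open>C\<close>, such that any two realizations of \<open>p\<close> satisfy \<open>b = F\<^sub>i(a, c)\<close> for some \<open>i\<close> and
  \<open>c\<close>. Isolated types are dense over \<open>B \<union> C\<close>, which together with weak orthogonality makes \<open>p\<close> isolated,
  so its set of realizations \<open>P\<close> is \<open>B\<close>-definable. Types in a totally transcendental theory are definable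
  (by finiteness of the local ranks), so a small partial elementary map extending the identity of \<open>C\<close>
  extends, by back and forth, to an automorphism; by weak orthogonality \<open>Aut\<^sub>B(p/C)\<close> is then transitive
  on \<open>P\<close>, and freely so because \<open>P\<close> lies in \<open>dcl(BaC)\<close>. The relation
  \<open>Q(a, b, a', b')\<close>: ``some automorphism takes \<open>a\<close> to \<open>b\<close> and \<open>a'\<close> to \<open>b'\<close>'' holds iff \<open>a' = F\<^sub>i(a, c)\<close> and
  \<open>b' = F\<^sub>i(b, c)\<close> for some \<open>i\<close> and \<open>c\<close>, so it is \<open>B\<close>-definable. Eliminating imaginaries, the binding group
  is the quotient of \<open>P \<times> P\<close> that identifies \<open>(b, a)\<close> with \<open>(b', a')\<close> if \<open>Q(a, b, a', b')\<close>, and the group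
  acting on the right is the quotient that identifies \<open>(a, b)\<close> with \<open>(a', b')\<close> if \<open>Q(a, a', b, b')\<close>; the
  class of \<open>(a, F\<^sub>i(a, c))\<close> in the latter does not depend on \<open>a\<close>, so it lies in \<open>dcl(BC)\<close>.
\<close>

section \<open>Syntax\<close>

text \<open>The obstacle is the size of \<open>C\<close>, which may be that of the whole model:
  saturation cannot realize types over \<open>B\<close> and \<open>C\<close> directly. Definability
  of types removes it. For each formula, the type of an element over a domain containing
  \<open>C\<close> is given by one definable set with finitely many parameters, so "for all
  \<open>c\<close> from \<open>C\<close>" becomes a quantifier, and the type to be realized lives
  over a small set, with one tuple of parameters per formula. Local ranks are finite because, by
  saturation, a set of infinite rank splits into two such sets, and endless splitting contradicts
  ordinal Morley rank; the same argument gives the sets that isolate types. Automorphisms over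
  \<open>B\<close> and \<open>C\<close> fix \<open>c\<close>, so they carry an equation
  \<open>a' = F\<^sub>i(a, c)\<close> to the one between the images with the same \<open>c\<close>;
  this is why a relation about automorphisms is first order. \<open>Q\<close> has two readings: one
  automorphism takes \<open>a\<close> to \<open>b\<close> and \<open>a'\<close> to
  \<open>b'\<close>, and the pairs \<open>(a, a')\<close> and \<open>(b, b')\<close> are conjugate.
  The readings give the two groups and make their actions commute.\<close>

lemma finite_tvars: "finite (tvars t)"
  by (induction t) auto

lemma finite_fv: "finite (fv \<phi>)"
  by (induction \<phi>) (auto simp: finite_tvars)

lemma eval_cong: "(\<And>v. v \<in> tvars t \<Longrightarrow> e v = e' v) \<Longrightarrow> eval M e t = eval M e' t"
proof (induction t)
  case (Fn f ts)
  then have "map (eval M e) ts = map (eval M e') ts" by (intro map_cong refl) auto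
  then show ?case by (simp only: eval.simps)
qed auto

lemma sat_cong: "(\<And>v. v \<in> fv \<phi> \<Longrightarrow> e v = e' v) \<Longrightarrow> sat M e \<phi> \<longleftrightarrow> sat M e' \<phi>"
proof (induction \<phi> arbitrary: e e')
  case (Eq t u)
  then show ?case using eval_cong[of t e e' M] eval_cong[of u e e' M] by auto
next
  case (Rel R ts)
  then have "map (eval M e) ts = map (eval M e') ts" by (intro map_cong refl eval_cong) auto
  then show ?case by (simp only: sat.simps)
next
  case (Imp \<phi>1 \<phi>2)
  show ?case using Imp.IH(1)[of e e'] Imp.IH(2)[of e e'] Imp.prems by simp
next
  case (All v \<phi>)
  have "sat M (e(v := a)) \<phi> \<longleftrightarrow> sat M (e'(v := a)) \<phi>" for a
    using All.prems by (intro All.IH) auto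
  then show ?case by simp
qed auto

primrec ren_trm :: "('s \<times> nat \<Rightarrow> 's \<times> nat) \<Rightarrow> ('f, 's) trm \<Rightarrow> ('f, 's) trm" where
  "ren_trm r (Var v) = Var (r v)"
| "ren_trm r (Fn f ts) = Fn f (map (ren_trm r) ts)"

lemma tvars_ren_trm: "tvars (ren_trm r t) = r ` tvars t"
  by (induction t) auto

lemma eval_ren_trm: "eval M e (ren_trm r t) = eval M (\<lambda>v. e (r v)) t"
proof (induction t)
  case (Fn f ts)
  then have "map (eval M e) (map (ren_trm r) ts) = map (eval M (\<lambda>v. e (r v))) ts"
    unfolding map_map by (intro map_cong refl) auto
  then show ?case by (simp only: eval.simps ren_trm.simps)
qed auto

lemma has_sort_ren_trm:
  assumes "\<And>v. fst (r v) = fst v" "has_sort L t s"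
  shows "has_sort L (ren_trm r t) s"
  using assms(2)
proof (induction rule: has_sort.induct)
  case (1 s i)
  obtain j where "r (s, i) = (s, j)" using assms(1)[of "(s, i)"] by (metis fst_conv surj_pair)
  then show ?case by (simp add: has_sort.intros)
next
  case (2 f ts)
  then show ?case by (auto intro!: has_sort.intros simp: list_all2_map1 elim: list_all2_mono)
qed

text \<open>A bound variable goes to one outside the image of the free variables, so nothing is
  captured and \<open>r\<close> need not be injective. The renaming changes under each quantifier,
  hence the induction over all \<open>r\<close>.\<close>

lemma renaming:
  assumes "\<And>v. fst (r v) = fst v" "wf_fm L \<phi>"
  shows "\<exists>\<phi>'. wf_fm L \<phi>' \<and> fv \<phi>' \<subseteq> r ` fv \<phi> \<and> (\<forall>e. sat M e \<phi>' \<longleftrightarrow> sat M (\<lambda>v. e (r v)) \<phi>)"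
  using assms
proof (induction \<phi> arbitrary: r)
  case Bot
  then show ?case by (intro exI[of _ Bot]) auto
next
  case (Eq t u)
  then have "wf_fm L (Eq (ren_trm r t) (ren_trm r u))"
    using has_sort_ren_trm[of r L] by (metis wf_fm.simps(2))
  then show ?case
    by (intro exI[of _ "Eq (ren_trm r t) (ren_trm r u)"]) (auto simp: tvars_ren_trm eval_ren_trm)
next
  case (Rel R ts)
  have "map (eval M e) (map (ren_trm r) ts) = map (eval M (\<lambda>v. e (r v))) ts" for e
    unfolding map_map by (intro map_cong refl) (simp add: eval_ren_trm)
  moreover have "list_all2 (has_sort L) (map (ren_trm r) ts) (rargs L R)"
    using Rel by (auto simp: list_all2_map1 intro: has_sort_ren_trm elim!: list_all2_mono)
  ultimately show ?case using Rel.prems(2)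
    by (intro exI[of _ "Rel R (map (ren_trm r) ts)"])
      (auto simp: tvars_ren_trm simp del: map_map)
next
  case (Imp \<phi>1 \<phi>2)
  obtain \<psi>1 where 1: "wf_fm L \<psi>1" "fv \<psi>1 \<subseteq> r ` fv \<phi>1" "\<forall>e. sat M e \<psi>1 \<longleftrightarrow> sat M (\<lambda>v. e (r v)) \<phi>1"
    using Imp by (metis wf_fm.simps(4))
  obtain \<psi>2 where 2: "wf_fm L \<psi>2" "fv \<psi>2 \<subseteq> r ` fv \<phi>2" "\<forall>e. sat M e \<psi>2 \<longleftrightarrow> sat M (\<lambda>v. e (r v)) \<phi>2"
    using Imp by (metis wf_fm.simps(4))
  show ?case using 1 2 by (intro exI[of _ "Imp \<psi>1 \<psi>2"]) auto
next
  case (All v \<phi>)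
  obtain n where n: "(fst v, n) \<notin> r ` fv \<phi>"
  proof -
    have "finite (snd ` r ` fv \<phi>)" by (simp add: finite_fv)
    then obtain n where "n \<notin> snd ` r ` fv \<phi>" using ex_new_if_finite infinite_UNIV_nat by blast
    then show thesis using that by force
  qed
  let ?w = "(fst v, n)"
  have "\<And>u. fst ((r(v := ?w)) u) = fst u" using All.prems(1) by simp
  then obtain \<psi> where \<psi>: "wf_fm L \<psi>" "fv \<psi> \<subseteq> r(v := ?w) ` fv \<phi>"
      "\<And>e. sat M e \<psi> \<longleftrightarrow> sat M (\<lambda>u. e ((r(v := ?w)) u)) \<phi>"
    using All.IH[of "r(v := ?w)"] All.prems(2) by auto
  have "sat M (e(?w := a)) \<psi> \<longleftrightarrow> sat M ((\<lambda>v. e (r v))(v := a)) \<phi>" for e a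
    unfolding \<psi>(3) using n by (intro sat_cong) force
  moreover have "fv \<psi> - {?w} \<subseteq> r ` (fv \<phi> - {v})" using \<psi>(2) by auto
  ultimately show ?case using \<psi>(1) by (intro exI[of _ "All ?w \<psi>"]) auto
qed

lemma holds_cong_take:
  "formula_in L \<sigma> \<phi> \<Longrightarrow> length as = length \<sigma> \<Longrightarrow> (\<And>i. i < length \<sigma> \<Longrightarrow> as ! i = bs ! i) \<Longrightarrow>
    holds M \<phi> as \<longleftrightarrow> holds M \<phi> bs"
  unfolding holds_def formula_in_def by (intro sat_cong) auto

text \<open>Variables are numbered by position, so permuting, merging or padding blocks of variables
  is a renaming of indices: \<open>js ! k\<close> is the place of the new context at which variable
  \<open>k\<close> is read.\<close>

lemma formula_reindex:
  assumes "formula_in L \<sigma> \<phi>" "length js = length \<sigma>"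
    "\<And>k. k < length \<sigma> \<Longrightarrow> js ! k < length \<tau> \<and> \<tau> ! (js ! k) = \<sigma> ! k"
  obtains \<phi>' where "formula_in L \<tau> \<phi>'" "\<And>as. holds M \<phi>' as \<longleftrightarrow> holds M \<phi> (map ((!) as) js)"
proof -
  let ?r = "\<lambda>(s, i). (s, js ! i)"
  have wf: "wf_fm L \<phi>" and fv: "fv \<phi> \<subseteq> {(\<sigma> ! i, i) | i. i < length \<sigma>}"
    using assms(1) by (auto simp: formula_in_def)
  obtain \<phi>' where \<phi>': "wf_fm L \<phi>'" "fv \<phi>' \<subseteq> ?r ` fv \<phi>" "\<And>e. sat M e \<phi>' \<longleftrightarrow> sat M (\<lambda>v. e (?r v)) \<phi>"
    using renaming[of ?r L \<phi> M] wf by auto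
  show thesis
  proof
    show "formula_in L \<tau> \<phi>'"
      unfolding formula_in_def using \<phi>'(1,2) fv assms(3) by force
    fix as
    show "holds M \<phi>' as \<longleftrightarrow> holds M \<phi> (map ((!) as) js)"
      unfolding holds_def \<phi>'(3) using fv assms(2) by (intro sat_cong) auto
  qed
qed

lemma formula_in_Imp [simp]:
  "formula_in L \<sigma> (Imp \<phi> \<psi>) \<longleftrightarrow> formula_in L \<sigma> \<phi> \<and> formula_in L \<sigma> \<psi>"
  by (auto simp: formula_in_def)

lemma formula_in_Bot [simp]: "formula_in L \<sigma> Bot"
  by (auto simp: formula_in_def)

lemma holds_Imp [simp]: "holds M (Imp \<phi> \<psi>) as \<longleftrightarrow> (holds M \<phi> as \<longrightarrow> holds M \<psi> as)"
  by (simp add: holds_def)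

lemma holds_Bot [simp]: "\<not> holds M Bot as"
  by (simp add: holds_def)

lemma formula_in_append:
  assumes "formula_in L \<sigma> \<phi>"
  shows "formula_in L (\<sigma> @ \<tau>) \<phi>"
proof -
  have "{(\<sigma> ! i, i) | i. i < length \<sigma>} \<subseteq> {((\<sigma> @ \<tau>) ! i, i) | i. i < length (\<sigma> @ \<tau>)}"
    by (auto simp: nth_append)
  then show ?thesis using assms unfolding formula_in_def by blast
qed

lemma holds_append:
  "formula_in L \<sigma> \<phi> \<Longrightarrow> length as = length \<sigma> \<Longrightarrow> holds M \<phi> (as @ bs) \<longleftrightarrow> holds M \<phi> as"
  by (rule sym, rule holds_cong_take) (auto simp: nth_append)

text \<open>The quantified variable is the last one, so that no other variable has to be
  renumbered.\<close>

lemma formula_Ex1: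
  assumes "formula_in L (\<sigma> @ [s]) \<phi>"
  obtains \<phi>' where "formula_in L \<sigma> \<phi>'"
    "\<And>as. length as = length \<sigma> \<Longrightarrow> holds M \<phi>' as \<longleftrightarrow> (\<exists>a\<in>univ M s. holds M \<phi> (as @ [a]))"
proof
  let ?\<phi>' = "Neg (All (s, length \<sigma>) (Neg \<phi>))"
  have wf: "wf_fm L \<phi>" and fv: "fv \<phi> \<subseteq> {((\<sigma> @ [s]) ! i, i) | i. i < Suc (length \<sigma>)}"
    using assms by (auto simp: formula_in_def)
  have "fv \<phi> - {(s, length \<sigma>)} \<subseteq> {(\<sigma> ! i, i) | i. i < length \<sigma>}"
    using fv by (fastforce simp: nth_append less_Suc_eq)
  then show "formula_in L \<sigma> ?\<phi>'" using wf by (simp add: formula_in_def)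
  fix as :: "'d list" assume len: "length as = length \<sigma>"
  have "sat M ((\<lambda>(s, i). as ! i)((s, length \<sigma>) := a)) \<phi> \<longleftrightarrow> sat M (\<lambda>(s, i). (as @ [a]) ! i) \<phi>" for a
    using fv len by (intro sat_cong) (fastforce simp: nth_append less_Suc_eq)
  then show "holds M ?\<phi>' as \<longleftrightarrow> (\<exists>a\<in>univ M s. holds M \<phi> (as @ [a]))"
    by (simp add: holds_def)
qed

section \<open>Tuples\<close>

lemma length_tuples: "as \<in> tuples M \<sigma> \<Longrightarrow> length as = length \<sigma>"
  by (auto simp: tuples_def list_all2_lengthD)

lemma tuples_Nil [simp]: "tuples M [] = {[]}"
  by (auto simp: tuples_def)

lemma Cons_in_tuples [simp]: "a # as \<in> tuples M (s # \<sigma>) \<longleftrightarrow> a \<in> univ M s \<and> as \<in> tuples M \<sigma>"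
  by (auto simp: tuples_def)

lemma tuples_Cons: "as \<in> tuples M (s # \<sigma>) \<longleftrightarrow> (\<exists>b bs. as = b # bs \<and> b \<in> univ M s \<and> bs \<in> tuples M \<sigma>)"
  by (auto simp: tuples_def list_all2_Cons2)

lemma append_in_tuples: "as \<in> tuples M \<sigma> \<Longrightarrow> bs \<in> tuples M \<tau> \<Longrightarrow> as @ bs \<in> tuples M (\<sigma> @ \<tau>)"
  by (auto simp: tuples_def intro: list_all2_appendI)

lemma append_in_tuples_iff [simp]:
  "length as = length \<sigma> \<Longrightarrow> as @ bs \<in> tuples M (\<sigma> @ \<tau>) \<longleftrightarrow> as \<in> tuples M \<sigma> \<and> bs \<in> tuples M \<tau>"
  by (auto simp: tuples_def list_all2_append)

lemma tuples_append:
  "as \<in> tuples M (\<sigma> @ \<tau>) \<longleftrightarrow> (\<exists>x y. as = x @ y \<and> x \<in> tuples M \<sigma> \<and> y \<in> tuples M \<tau>)"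
proof
  assume "as \<in> tuples M (\<sigma> @ \<tau>)"
  then obtain us vs where "as = us @ vs" "list_all2 (\<lambda>a s. a \<in> univ M s) us \<sigma>"
    "list_all2 (\<lambda>a s. a \<in> univ M s) vs \<tau>" unfolding tuples_def list_all2_append2 by blast
  then show "\<exists>x y. as = x @ y \<and> x \<in> tuples M \<sigma> \<and> y \<in> tuples M \<tau>" unfolding tuples_def by blast
qed (auto intro: append_in_tuples)

lemma nth_in_univ: "as \<in> tuples M \<sigma> \<Longrightarrow> i < length \<sigma> \<Longrightarrow> as ! i \<in> univ M (\<sigma> ! i)"
  by (auto simp: tuples_def list_all2_conv_all_nth)

lemma tuples_conv_nth: "as \<in> tuples M \<sigma> \<longleftrightarrow> length as = length \<sigma> \<and> (\<forall>i<length \<sigma>. as ! i \<in> univ M (\<sigma> ! i))"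
  by (auto simp: tuples_def list_all2_conv_all_nth)

lemma ex_tuples_of: "set as \<subseteq> elements M \<Longrightarrow> \<exists>\<sigma>. as \<in> tuples M \<sigma>"
proof (induction as)
  case (Cons a as)
  then obtain \<sigma> s where "as \<in> tuples M \<sigma>" "a \<in> univ M s" by (auto simp: elements_def)
  then show ?case by (intro exI[of _ "s # \<sigma>"]) simp
qed (auto intro: exI[of _ "[]"])

lemma set_tuples: "as \<in> tuples M \<sigma> \<Longrightarrow> set as \<subseteq> elements M"
  by (auto simp: tuples_conv_nth in_set_conv_nth elements_def) blast

definition envs :: "('f, 'r, 's, 'm) struct \<Rightarrow> 's list list \<Rightarrow> 'm list list set" where
  "envs M \<Gamma> = {e. list_all2 (\<lambda>a \<sigma>. a \<in> tuples M \<sigma>) e \<Gamma>}"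

lemma envs_Nil [simp]: "e \<in> envs M [] \<longleftrightarrow> e = []"
  by (auto simp: envs_def)

lemma envs_Cons: "e \<in> envs M (\<sigma> # \<Gamma>) \<longleftrightarrow> (\<exists>a e'. e = a # e' \<and> a \<in> tuples M \<sigma> \<and> e' \<in> envs M \<Gamma>)"
  by (auto simp: envs_def list_all2_Cons2)

lemma Cons_in_envs [simp]: "a # e \<in> envs M (\<sigma> # \<Gamma>) \<longleftrightarrow> a \<in> tuples M \<sigma> \<and> e \<in> envs M \<Gamma>"
  by (auto simp: envs_def)

lemma concat_in_tuples: "e \<in> envs M \<Gamma> \<Longrightarrow> concat e \<in> tuples M (concat \<Gamma>)"
  by (induction \<Gamma> arbitrary: e) (auto simp: envs_Cons length_tuples)

lemma length_concat_envs: "e \<in> envs M \<Gamma> \<Longrightarrow> length (concat e) = length (concat \<Gamma>)"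
  by (rule length_tuples[OF concat_in_tuples])

lemma tuples_concat:
  "as \<in> tuples M (concat \<Gamma>) \<longleftrightarrow> (\<exists>e\<in>envs M \<Gamma>. as = concat e)"
proof
  show "as \<in> tuples M (concat \<Gamma>) \<Longrightarrow> \<exists>e\<in>envs M \<Gamma>. as = concat e"
  proof (induction \<Gamma> arbitrary: as)
    case (Cons \<sigma> \<Gamma>)
    then obtain x y where xy: "as = x @ y" "x \<in> tuples M \<sigma>" "y \<in> tuples M (concat \<Gamma>)"
      by (auto simp: tuples_append)
    then obtain e where "e \<in> envs M \<Gamma>" "y = concat e" using Cons.IH by blast
    then show ?case using xy by (intro bexI[of _ "x # e"]) auto
  qed auto
qed (auto intro: concat_in_tuples)

section \<open>Definable predicates\<close>

text \<open>Environments are lists of tuples, of sorts \<open>\<Gamma>\<close>. A quantifier pushes its variable in front of the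
  environment, so that variables are \<open>hd\<close>, \<open>\<lambda>e. hd (tl e)\<close>, and so on, and definability can be proved by
  resolution with the closure rules \<open>Dp_\<close> and \<open>tm_\<close> (for terms).\<close>

definition Dp ::
  "('f, 'r, 's) lang \<Rightarrow> ('f, 'r, 's, 'm) struct \<Rightarrow> 'm set \<Rightarrow> 's list list \<Rightarrow> ('m list list \<Rightarrow> bool) \<Rightarrow> bool"
  where
  "Dp L M A \<Gamma> P \<longleftrightarrow> (\<exists>\<phi> bs \<tau>. bs \<in> tuples M \<tau> \<and> set bs \<subseteq> A \<and> formula_in L (concat \<Gamma> @ \<tau>) \<phi> \<and>
     (\<forall>e\<in>envs M \<Gamma>. P e \<longleftrightarrow> holds M \<phi> (concat e @ bs)))"

text \<open>A term only selects coordinates of the environment followed by parameters; function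
  symbols stay inside formulas. Substituting such a term into a formula is therefore a
  reindexing.\<close>

definition tm ::
  "('f, 'r, 's, 'm) struct \<Rightarrow> 'm set \<Rightarrow> 's list list \<Rightarrow> ('m list list \<Rightarrow> 'm list) \<Rightarrow> 's list \<Rightarrow> bool"
  where
  "tm M A \<Gamma> x \<sigma> \<longleftrightarrow> (\<exists>bs \<tau> js. bs \<in> tuples M \<tau> \<and> set bs \<subseteq> A \<and> length js = length \<sigma> \<and>
     (\<forall>k<length \<sigma>. js ! k < length (concat \<Gamma> @ \<tau>) \<and> (concat \<Gamma> @ \<tau>) ! (js ! k) = \<sigma> ! k) \<and>
     (\<forall>e\<in>envs M \<Gamma>. x e = map ((!) (concat e @ bs)) js))"

lemma tm_in_tuples:
  assumes "tm M A \<Gamma> x \<sigma>" "e \<in> envs M \<Gamma>"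
  shows "x e \<in> tuples M \<sigma>"
proof -
  obtain bs \<tau> js where *: "bs \<in> tuples M \<tau>" "length js = length \<sigma>"
     "\<And>k. k<length \<sigma> \<Longrightarrow> js ! k < length (concat \<Gamma> @ \<tau>) \<and> (concat \<Gamma> @ \<tau>) ! (js ! k) = \<sigma> ! k"
     "x e = map ((!) (concat e @ bs)) js"
    using assms unfolding tm_def by blast
  have "concat e @ bs \<in> tuples M (concat \<Gamma> @ \<tau>)"
    using *(1) assms(2) by (intro append_in_tuples concat_in_tuples)
  from nth_in_univ[OF this] have "x e ! k \<in> univ M (\<sigma> ! k)" if "k < length \<sigma>" for k
    using *(2,4) *(3)[OF that] that by (metis nth_map)
  then show ?thesis using *(2,4) by (simp add: tuples_conv_nth)
qed

lemma map_nth_append1: "map ((!) (xs @ ys)) [0..<length xs] = xs"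
  by (rule nth_equalityI) (auto simp: nth_append)

lemma map_nth_append2: "map ((!) (xs @ ys @ zs)) [length xs..<length xs + length ys] = ys"
  by (rule nth_equalityI) (auto simp: nth_append)

lemma Dp_holds_tm:
  assumes "formula_in L (\<sigma> @ \<tau>1) \<phi>" "bs1 \<in> tuples M \<tau>1" "set bs1 \<subseteq> A" "tm M A \<Gamma> x \<sigma>"
  shows "Dp L M A \<Gamma> (\<lambda>e. holds M \<phi> (x e @ bs1))"
proof -
  obtain bs \<tau> js where *: "bs \<in> tuples M \<tau>" "set bs \<subseteq> A" "length js = length \<sigma>"
     "\<And>k. k<length \<sigma> \<Longrightarrow> js ! k < length (concat \<Gamma> @ \<tau>) \<and> (concat \<Gamma> @ \<tau>) ! (js ! k) = \<sigma> ! k"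
     "\<And>e. e \<in> envs M \<Gamma> \<Longrightarrow> x e = map ((!) (concat e @ bs)) js"
    using assms(4) unfolding tm_def by blast
  let ?n = "length (concat \<Gamma> @ \<tau>)"
  \<comment> \<open>The first part reads the coordinates that \<open>x\<close> selects; the interval
    reads \<open>bs1\<close>, placed behind the parameters of \<open>x\<close>.\<close>
  let ?js = "js @ [?n..<?n + length \<tau>1]"
  have "length ?js = length (\<sigma> @ \<tau>1)" using *(3) by simp
  moreover have "?js ! k < length (concat \<Gamma> @ \<tau> @ \<tau>1) \<and> (concat \<Gamma> @ \<tau> @ \<tau>1) ! (?js ! k) = (\<sigma> @ \<tau>1) ! k"
    if "k < length (\<sigma> @ \<tau>1)" for k
  proof (cases "k < length \<sigma>")
    case True
    then show ?thesis using *(3) *(4)[OF True] by (auto simp: nth_append)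
  next
    case False
    then show ?thesis using that *(3) by (auto simp: nth_append)
  qed
  ultimately obtain \<phi>' where \<phi>': "formula_in L (concat \<Gamma> @ \<tau> @ \<tau>1) \<phi>'"
    "\<And>as. holds M \<phi>' as \<longleftrightarrow> holds M \<phi> (map ((!) as) ?js)"
    using formula_reindex[OF assms(1)] by blast
  have "holds M \<phi> (x e @ bs1) \<longleftrightarrow> holds M \<phi>' (concat e @ bs @ bs1)" if e: "e \<in> envs M \<Gamma>" for e
  proof -
    have n: "?n = length (concat e @ bs)"
      using length_concat_envs[OF e] length_tuples[OF *(1)] by simp
    have "map ((!) (concat e @ bs @ bs1)) js = map ((!) (concat e @ bs)) js"
    proof (rule map_cong[OF refl])
      fix j assume "j \<in> set js"
      then have "j < length (concat e @ bs)" using *(3,4) n by (metis in_set_conv_nth)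
      then show "(concat e @ bs @ bs1) ! j = (concat e @ bs) ! j"
        using nth_append[of "concat e @ bs" bs1 j] by simp
    qed
    moreover have "map ((!) (concat e @ bs @ bs1)) [?n..<?n + length \<tau>1] = bs1"
      unfolding n using map_nth_append2[of "concat e @ bs" bs1 "[]"] length_tuples[OF assms(2)] by simp
    ultimately show ?thesis using *(5)[OF e] by (simp only: \<phi>'(2) map_append)
  qed
  moreover have "bs @ bs1 \<in> tuples M (\<tau> @ \<tau>1)" "set (bs @ bs1) \<subseteq> A"
    using *(1,2) assms by (auto intro: append_in_tuples)
  ultimately show ?thesis unfolding Dp_def using \<phi>'(1) by blast
qed

section \<open>Closure of definable predicates under connectives and quantifiers\<close>

lemma Dp_cong: "Dp L M A \<Gamma> P \<Longrightarrow> (\<And>e. e \<in> envs M \<Gamma> \<Longrightarrow> P e \<longleftrightarrow> Q e) \<Longrightarrow> Dp L M A \<Gamma> Q"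
  unfolding Dp_def by blast

lemma tm_mono: "tm M A \<Gamma> x \<sigma> \<Longrightarrow> A \<subseteq> A' \<Longrightarrow> tm M A' \<Gamma> x \<sigma>"
  unfolding tm_def by blast

lemma Dp_False: "Dp L M A \<Gamma> (\<lambda>e. False)"
  unfolding Dp_def by (intro exI[of _ Bot] exI[of _ "[]"]) auto

lemma Dp_imp:
  assumes "Dp L M A \<Gamma> P" "Dp L M A \<Gamma> Q"
  shows "Dp L M A \<Gamma> (\<lambda>e. P e \<longrightarrow> Q e)"
proof -
  obtain \<phi>1 bs1 \<tau>1 where 1: "bs1 \<in> tuples M \<tau>1" "set bs1 \<subseteq> A" "formula_in L (concat \<Gamma> @ \<tau>1) \<phi>1"
     "\<And>e. e\<in>envs M \<Gamma> \<Longrightarrow> P e \<longleftrightarrow> holds M \<phi>1 (concat e @ bs1)" using assms(1) unfolding Dp_def by blast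
  obtain \<phi>2 bs2 \<tau>2 where 2: "bs2 \<in> tuples M \<tau>2" "set bs2 \<subseteq> A" "formula_in L (concat \<Gamma> @ \<tau>2) \<phi>2"
     "\<And>e. e\<in>envs M \<Gamma> \<Longrightarrow> Q e \<longleftrightarrow> holds M \<phi>2 (concat e @ bs2)" using assms(2) unfolding Dp_def by blast
  let ?n = "length (concat \<Gamma> @ \<tau>1)"
  \<comment> \<open>The second formula has to skip \<open>bs1\<close>, the parameters of the
    first.\<close>
  let ?js = "[0..<length (concat \<Gamma>)] @ [?n..<?n + length \<tau>2]"
  have "length ?js = length (concat \<Gamma> @ \<tau>2)" by simp
  moreover have "?js ! k < length (concat \<Gamma> @ \<tau>1 @ \<tau>2) \<and>
      (concat \<Gamma> @ \<tau>1 @ \<tau>2) ! (?js ! k) = (concat \<Gamma> @ \<tau>2) ! k" if "k < length (concat \<Gamma> @ \<tau>2)" for k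
    using that by (auto simp: nth_append)
  ultimately obtain \<phi>' where \<phi>': "formula_in L (concat \<Gamma> @ \<tau>1 @ \<tau>2) \<phi>'"
    "\<And>as. holds M \<phi>' as \<longleftrightarrow> holds M \<phi>2 (map ((!) as) ?js)"
    using formula_reindex[OF 2(3)] by blast
  have "(P e \<longrightarrow> Q e) \<longleftrightarrow> holds M (Imp \<phi>1 \<phi>') (concat e @ bs1 @ bs2)" if e: "e \<in> envs M \<Gamma>" for e
  proof -
    have len: "length (concat \<Gamma>) = length (concat e)" "length \<tau>1 = length bs1" "length \<tau>2 = length bs2"
      using length_concat_envs[OF e] length_tuples[OF 1(1)] length_tuples[OF 2(1)] by simp_all
    have "map ((!) (concat e @ bs1 @ bs2)) ?js = concat e @ bs2"
      using map_nth_append1[of "concat e" "bs1 @ bs2"] map_nth_append2[of "concat e @ bs1" bs2 "[]"]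
      by (simp add: len)
    moreover have "holds M \<phi>1 (concat e @ bs1 @ bs2) \<longleftrightarrow> holds M \<phi>1 (concat e @ bs1)"
      using holds_append[OF 1(3), of "concat e @ bs1" M bs2] len by simp
    ultimately show ?thesis using 1(4)[OF e] 2(4)[OF e] by (simp only: holds_Imp \<phi>'(2))
  qed
  moreover have "formula_in L (concat \<Gamma> @ \<tau>1 @ \<tau>2) (Imp \<phi>1 \<phi>')"
    using formula_in_append[OF 1(3), of \<tau>2] \<phi>'(1) by simp
  moreover have "bs1 @ bs2 \<in> tuples M (\<tau>1 @ \<tau>2)" "set (bs1 @ bs2) \<subseteq> A"
    using 1(1,2) 2(1,2) by (auto intro: append_in_tuples)
  ultimately show ?thesis unfolding Dp_def by blast
qed

lemma Dp_not: "Dp L M A \<Gamma> P \<Longrightarrow> Dp L M A \<Gamma> (\<lambda>e. \<not> P e)"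
  using Dp_imp[OF _ Dp_False] by fastforce

lemma Dp_True: "Dp L M A \<Gamma> (\<lambda>e. True)"
  using Dp_not[OF Dp_False] by simp

lemma Dp_disj: "Dp L M A \<Gamma> P \<Longrightarrow> Dp L M A \<Gamma> Q \<Longrightarrow> Dp L M A \<Gamma> (\<lambda>e. P e \<or> Q e)"
  by (rule Dp_cong[OF Dp_imp[OF Dp_not, of L M A \<Gamma> P Q]]) auto

lemma Dp_conj: "Dp L M A \<Gamma> P \<Longrightarrow> Dp L M A \<Gamma> Q \<Longrightarrow> Dp L M A \<Gamma> (\<lambda>e. P e \<and> Q e)"
  using Dp_not[OF Dp_imp[OF _ Dp_not], of L M A \<Gamma> P Q] by simp

lemma Dp_iff: "Dp L M A \<Gamma> P \<Longrightarrow> Dp L M A \<Gamma> Q \<Longrightarrow> Dp L M A \<Gamma> (\<lambda>e. P e \<longleftrightarrow> Q e)"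
  by (rule Dp_cong[OF Dp_conj[OF Dp_imp[of L M A \<Gamma> P Q] Dp_imp[of L M A \<Gamma> Q P]]]) auto

lemma Dp_finite_all:
  assumes "finite I" "\<And>i. i \<in> I \<Longrightarrow> Dp L M A \<Gamma> (P i)"
  shows "Dp L M A \<Gamma> (\<lambda>e. \<forall>i\<in>I. P i e)"
  using assms by (induction I) (auto intro: Dp_True Dp_conj)

lemma Dp_finite_ex:
  assumes "finite I" "\<And>i. i \<in> I \<Longrightarrow> Dp L M A \<Gamma> (P i)"
  shows "Dp L M A \<Gamma> (\<lambda>e. \<exists>i\<in>I. P i e)"
  using assms by (induction I) (auto intro: Dp_False Dp_disj)

lemma formula_Ex:
  assumes "formula_in L (\<tau> @ \<sigma>) \<phi>"
  shows "\<exists>\<phi>'. formula_in L \<sigma> \<phi>' \<and> (\<forall>as. length as = length \<sigma> \<longrightarrow>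
    (holds M \<phi>' as \<longleftrightarrow> (\<exists>ts\<in>tuples M \<tau>. holds M \<phi> (ts @ as))))"
  using assms
proof (induction \<tau> arbitrary: \<phi>)
  case Nil
  then show ?case by auto
next
  case (Cons s \<tau>)
  let ?n = "length (\<tau> @ \<sigma>)"
  \<comment> \<open>The outermost variable is moved from the front to the end, where a single
    quantifier can bind it.\<close>
  let ?js = "?n # [0..<?n]"
  have "?js ! k < length (\<tau> @ \<sigma> @ [s]) \<and> (\<tau> @ \<sigma> @ [s]) ! (?js ! k) = ((s # \<tau>) @ \<sigma>) ! k"
    if "k < length ((s # \<tau>) @ \<sigma>)" for k
    using that by (cases k) (auto simp: nth_append)
  then obtain \<phi>1 where \<phi>1: "formula_in L ((\<tau> @ \<sigma>) @ [s]) \<phi>1"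
    "\<And>as. holds M \<phi>1 as \<longleftrightarrow> holds M \<phi> (map ((!) as) ?js)"
    using formula_reindex[OF Cons.prems, of ?js "\<tau> @ \<sigma> @ [s]" M] by auto
  obtain \<phi>2 where \<phi>2: "formula_in L (\<tau> @ \<sigma>) \<phi>2"
    "\<And>as. length as = ?n \<Longrightarrow> holds M \<phi>2 as \<longleftrightarrow> (\<exists>a\<in>univ M s. holds M \<phi>1 (as @ [a]))"
    using formula_Ex1[OF \<phi>1(1)] by metis
  obtain \<phi>3 where \<phi>3: "formula_in L \<sigma> \<phi>3"
    "\<And>as. length as = length \<sigma> \<Longrightarrow> holds M \<phi>3 as \<longleftrightarrow> (\<exists>ts\<in>tuples M \<tau>. holds M \<phi>2 (ts @ as))"
    using Cons.IH[OF \<phi>2(1)] by blast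
  have "holds M \<phi>3 as \<longleftrightarrow> (\<exists>ts\<in>tuples M (s # \<tau>). holds M \<phi> (ts @ as))" if len: "length as = length \<sigma>" for as
  proof -
    have "holds M \<phi>2 (ts @ as) \<longleftrightarrow> (\<exists>a\<in>univ M s. holds M \<phi> (a # ts @ as))" if ts: "ts \<in> tuples M \<tau>" for ts
    proof -
      have n: "?n = length (ts @ as)" using len length_tuples[OF ts] by simp
      have "map ((!) ((ts @ as) @ [a])) ?js = a # ts @ as" for a
        unfolding n using map_nth_append1[of "ts @ as" "[a]"] by simp
      then show ?thesis using \<phi>2(2)[of "ts @ as"] n by (simp only: \<phi>1(2))
    qed
    then have "holds M \<phi>3 as \<longleftrightarrow> (\<exists>ts\<in>tuples M \<tau>. \<exists>a\<in>univ M s. holds M \<phi> (a # ts @ as))"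
      unfolding \<phi>3(2)[OF len] by blast
    also have "\<dots> \<longleftrightarrow> (\<exists>ts\<in>tuples M (s # \<tau>). holds M \<phi> (ts @ as))"
      unfolding Bex_def tuples_Cons by (metis append_Cons)
    finally show ?thesis .
  qed
  then show ?case using \<phi>3(1) by blast
qed

lemma Dp_ex:
  assumes "Dp L M A (\<sigma> # \<Gamma>) (\<lambda>e. P (tl e) (hd e))"
  shows "Dp L M A \<Gamma> (\<lambda>e. \<exists>a\<in>tuples M \<sigma>. P e a)"
proof -
  obtain \<phi> bs \<tau> where 1: "bs \<in> tuples M \<tau>" "set bs \<subseteq> A" "formula_in L (\<sigma> @ (concat \<Gamma> @ \<tau>)) \<phi>"
     and 2: "\<And>e. e\<in>envs M (\<sigma> # \<Gamma>) \<Longrightarrow> P (tl e) (hd e) \<longleftrightarrow> holds M \<phi> (concat e @ bs)"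
    using assms unfolding Dp_def by auto
  obtain \<phi>' where \<phi>': "formula_in L (concat \<Gamma> @ \<tau>) \<phi>'" "\<And>as. length as = length (concat \<Gamma> @ \<tau>) \<Longrightarrow>
    (holds M \<phi>' as \<longleftrightarrow> (\<exists>ts\<in>tuples M \<sigma>. holds M \<phi> (ts @ as)))"
    using formula_Ex[OF 1(3)] by blast
  have "(\<exists>a\<in>tuples M \<sigma>. P e a) \<longleftrightarrow> holds M \<phi>' (concat e @ bs)" if e: "e \<in> envs M \<Gamma>" for e
  proof -
    have "P e a \<longleftrightarrow> holds M \<phi> (a @ concat e @ bs)" if "a \<in> tuples M \<sigma>" for a
      using 2[of "a # e"] that e by simp
    then show ?thesis using \<phi>'(2)[of "concat e @ bs"] length_concat_envs[OF e] length_tuples[OF 1(1)] by simp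
  qed
  then show ?thesis unfolding Dp_def using 1 \<phi>'(1) by blast
qed

lemma Dp_all:
  assumes "Dp L M A (\<sigma> # \<Gamma>) (\<lambda>e. P (tl e) (hd e))"
  shows "Dp L M A \<Gamma> (\<lambda>e. \<forall>a\<in>tuples M \<sigma>. P e a)"
  using Dp_not[OF Dp_ex[OF Dp_not[OF assms]]] by simp

section \<open>Terms as selections of coordinates\<close>

lemma tm_hd: "tm M A (\<sigma> # \<Gamma>) hd \<sigma>"
proof -
  have "hd e = map ((!) (concat e @ [])) [0..<length \<sigma>]" if e: "e \<in> envs M (\<sigma> # \<Gamma>)" for e
  proof -
    obtain a e' where "e = a # e'" "a \<in> tuples M \<sigma>" using e by (auto simp: envs_Cons)
    then show ?thesis using map_nth_append1[of a "concat e'"] length_tuples[of a M \<sigma>] by simp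
  qed
  then show ?thesis unfolding tm_def
    by (intro exI[of _ "[]"] exI[of _ "[0..<length \<sigma>]"]) (auto simp: nth_append)
qed

lemma tm_tl:
  assumes "tm M A \<Gamma> x \<sigma>"
  shows "tm M A (\<tau> # \<Gamma>) (\<lambda>e. x (tl e)) \<sigma>"
proof -
  obtain bs \<tau>1 js where *: "bs \<in> tuples M \<tau>1" "set bs \<subseteq> A" "length js = length \<sigma>"
     "\<And>k. k<length \<sigma> \<Longrightarrow> js ! k < length (concat \<Gamma> @ \<tau>1) \<and> (concat \<Gamma> @ \<tau>1) ! (js ! k) = \<sigma> ! k"
     "\<And>e. e \<in> envs M \<Gamma> \<Longrightarrow> x e = map ((!) (concat e @ bs)) js"
    using assms unfolding tm_def by blast
  have "x (tl e) = map ((!) (concat e @ bs)) (map ((+) (length \<tau>)) js)" if e: "e \<in> envs M (\<tau> # \<Gamma>)" for e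
  proof -
    obtain a e' where "e = a # e'" "a \<in> tuples M \<tau>" "e' \<in> envs M \<Gamma>" using e by (auto simp: envs_Cons)
    then show ?thesis using *(5)[of e'] length_tuples[of a M \<tau>] by (auto simp: nth_append)
  qed
  moreover have "\<forall>k<length \<sigma>. map ((+) (length \<tau>)) js ! k < length (concat (\<tau> # \<Gamma>) @ \<tau>1) \<and>
      (concat (\<tau> # \<Gamma>) @ \<tau>1) ! (map ((+) (length \<tau>)) js ! k) = \<sigma> ! k"
    using *(3,4) by (auto simp: nth_append)
  ultimately show ?thesis unfolding tm_def using *(1,2,3) by (metis length_map)
qed

lemma tm_const:
  assumes "a \<in> tuples M \<sigma>" "set a \<subseteq> A"
  shows "tm M A \<Gamma> (\<lambda>e. a) \<sigma>"
proof -
  let ?n = "length (concat \<Gamma>)"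
  have "a = map ((!) (concat e @ a)) [?n..<?n + length a]" if e: "e \<in> envs M \<Gamma>" for e
    using map_nth_append2[of "concat e" a "[]"] length_concat_envs[OF e] by simp
  then show ?thesis unfolding tm_def using assms length_tuples[OF assms(1)]
    by (intro exI[of _ a] exI[of _ \<sigma>] exI[of _ "[?n..<?n + length a]"]) (auto simp: nth_append)
qed

lemma tm_append:
  assumes "tm M A \<Gamma> x \<sigma>" "tm M A \<Gamma> y \<tau>"
  shows "tm M A \<Gamma> (\<lambda>e. x e @ y e) (\<sigma> @ \<tau>)"
proof -
  obtain bs1 \<tau>1 js where *: "bs1 \<in> tuples M \<tau>1" "set bs1 \<subseteq> A" "length js = length \<sigma>"
     "\<And>k. k<length \<sigma> \<Longrightarrow> js ! k < length (concat \<Gamma> @ \<tau>1) \<and> (concat \<Gamma> @ \<tau>1) ! (js ! k) = \<sigma> ! k"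
     "\<And>e. e \<in> envs M \<Gamma> \<Longrightarrow> x e = map ((!) (concat e @ bs1)) js"
    using assms(1) unfolding tm_def by blast
  obtain bs2 \<tau>2 ks where **: "bs2 \<in> tuples M \<tau>2" "set bs2 \<subseteq> A" "length ks = length \<tau>"
     "\<And>k. k<length \<tau> \<Longrightarrow> ks ! k < length (concat \<Gamma> @ \<tau>2) \<and> (concat \<Gamma> @ \<tau>2) ! (ks ! k) = \<tau> ! k"
     "\<And>e. e \<in> envs M \<Gamma> \<Longrightarrow> y e = map ((!) (concat e @ bs2)) ks"
    using assms(2) unfolding tm_def by blast
  \<comment> \<open>Places of \<open>y\<close> in the environment stay; those among its parameters
    move behind \<open>bs1\<close>.\<close>
  let ?f = "\<lambda>k. if k < length (concat \<Gamma>) then k else k + length \<tau>1"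
  let ?js = "js @ map ?f ks"
  have j: "j < length (concat \<Gamma> @ \<tau>1)" if "j \<in> set js" for j
    using *(3,4) that by (metis in_set_conv_nth)
  have "x e @ y e = map ((!) (concat e @ bs1 @ bs2)) ?js" if e: "e \<in> envs M \<Gamma>" for e
  proof -
    have len: "length (concat \<Gamma>) = length (concat e)" "length \<tau>1 = length bs1"
      using length_concat_envs[OF e] length_tuples[OF *(1)] by simp_all
    have "map ((!) (concat e @ bs1 @ bs2)) js = map ((!) (concat e @ bs1)) js"
    proof (rule map_cong[OF refl])
      fix i assume "i \<in> set js"
      then have "i < length (concat e @ bs1)" using j len by simp
      then show "(concat e @ bs1 @ bs2) ! i = (concat e @ bs1) ! i"
        using nth_append[of "concat e @ bs1" bs2 i] by simp
    qed
    moreover have "map ((!) (concat e @ bs1 @ bs2)) (map ?f ks) = map ((!) (concat e @ bs2)) ks"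
      by (auto simp: len nth_append)
    ultimately show ?thesis using *(5)[OF e] **(5)[OF e] by simp
  qed
  moreover have "?js ! k < length (concat \<Gamma> @ \<tau>1 @ \<tau>2) \<and>
      (concat \<Gamma> @ \<tau>1 @ \<tau>2) ! (?js ! k) = (\<sigma> @ \<tau>) ! k" if "k < length (\<sigma> @ \<tau>)" for k
  proof (cases "k < length \<sigma>")
    case True
    then show ?thesis using *(3) *(4)[OF True] by (auto simp: nth_append)
  next
    case False
    then have k: "k - length \<sigma> < length \<tau>" using that by auto
    then show ?thesis using **(4)[OF k] *(3) **(3) False by (auto simp: nth_append)
  qed
  moreover have "bs1 @ bs2 \<in> tuples M (\<tau>1 @ \<tau>2)" "set (bs1 @ bs2) \<subseteq> A"
    using *(1,2) **(1,2) by (auto intro: append_in_tuples)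
  moreover have "length ?js = length (\<sigma> @ \<tau>)" using *(3) **(3) by simp
  ultimately show ?thesis unfolding tm_def by blast
qed

lemma tm_nth:
  assumes "tm M A \<Gamma> x \<sigma>" "i < length \<sigma>"
  shows "tm M A \<Gamma> (\<lambda>e. [x e ! i]) [\<sigma> ! i]"
proof -
  obtain bs \<tau>1 js where *: "bs \<in> tuples M \<tau>1" "set bs \<subseteq> A" "length js = length \<sigma>"
     "\<And>k. k<length \<sigma> \<Longrightarrow> js ! k < length (concat \<Gamma> @ \<tau>1) \<and> (concat \<Gamma> @ \<tau>1) ! (js ! k) = \<sigma> ! k"
     "\<And>e. e \<in> envs M \<Gamma> \<Longrightarrow> x e = map ((!) (concat e @ bs)) js"
    using assms(1) unfolding tm_def by blast
  have "[x e ! i] = map ((!) (concat e @ bs)) [js ! i]" if "e \<in> envs M \<Gamma>" for e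
    using *(5)[OF that] *(3) assms(2) by simp
  moreover have "\<forall>k<length [\<sigma> ! i]. [js ! i] ! k < length (concat \<Gamma> @ \<tau>1) \<and>
      (concat \<Gamma> @ \<tau>1) ! ([js ! i] ! k) = [\<sigma> ! i] ! k" using *(4)[OF assms(2)] by simp
  moreover have "length [js ! i] = length [\<sigma> ! i]" by simp
  ultimately show ?thesis unfolding tm_def using *(1,2) by blast
qed

lemma tm_Nil: "tm M A \<Gamma> (\<lambda>e. []) []"
  by (rule tm_const) auto

section \<open>Passage between definable sets and definable predicates, and change of
  parameters\<close>

lemma definable_iff_formula:
  "definable L M A \<sigma> X \<longleftrightarrow> (\<exists>\<phi> bs \<tau>. bs \<in> tuples M \<tau> \<and> set bs \<subseteq> A \<and> formula_in L (\<sigma> @ \<tau>) \<phi> \<and>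
     X = {as \<in> tuples M \<sigma>. holds M \<phi> (as @ bs)})"
  unfolding definable_def pfms_def sols_def by fastforce

lemma definable_sub: "definable L M A \<sigma> X \<Longrightarrow> X \<subseteq> tuples M \<sigma>"
  by (auto simp: definable_iff_formula)

lemma definable_mono: "definable L M A \<sigma> X \<Longrightarrow> A \<subseteq> A' \<Longrightarrow> definable L M A' \<sigma> X"
  unfolding definable_iff_formula by blast

lemma Dp_in:
  assumes "definable L M A' \<sigma> X" "A' \<subseteq> A" "tm M A \<Gamma> x \<sigma>"
  shows "Dp L M A \<Gamma> (\<lambda>e. x e \<in> X)"
proof -
  obtain \<phi> bs \<tau> where *: "bs \<in> tuples M \<tau>" "set bs \<subseteq> A" "formula_in L (\<sigma> @ \<tau>) \<phi>"
     "X = {as \<in> tuples M \<sigma>. holds M \<phi> (as @ bs)}"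
    using assms unfolding definable_iff_formula by blast
  show ?thesis
    by (rule Dp_cong[OF Dp_holds_tm[OF *(3,1,2) assms(3)]]) (auto simp: *(4) tm_in_tuples[OF assms(3)])
qed

lemma definableI:
  assumes "X \<subseteq> tuples M \<sigma>" "Dp L M A [\<sigma>] (\<lambda>e. hd e \<in> X)"
  shows "definable L M A \<sigma> X"
proof -
  obtain \<phi> bs \<tau> where *: "bs \<in> tuples M \<tau>" "set bs \<subseteq> A" "formula_in L (\<sigma> @ \<tau>) \<phi>"
     "\<And>e. e \<in> envs M [\<sigma>] \<Longrightarrow> hd e \<in> X \<longleftrightarrow> holds M \<phi> (concat e @ bs)"
    using assms(2) unfolding Dp_def by auto
  have "X = {as \<in> tuples M \<sigma>. holds M \<phi> (as @ bs)}"
    using assms(1) *(4)[of "[_]"] by auto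
  then show ?thesis unfolding definable_iff_formula using * by blast
qed

lemma definable_Collect:
  assumes "Dp L M A [\<sigma>] (\<lambda>e. P (hd e))"
  shows "definable L M A \<sigma> {x \<in> tuples M \<sigma>. P x}"
  by (rule definableI, blast, rule Dp_cong[OF assms]) (auto simp: envs_Cons)

text \<open>Each block has the length of its list of sorts, so a flat tuple can be cut up in only
  one way.\<close>

lemma concat_inj_envs:
  "e \<in> envs M \<Gamma> \<Longrightarrow> e' \<in> envs M \<Gamma> \<Longrightarrow> concat e = concat e' \<Longrightarrow> e = e'"
proof (induction \<Gamma> arbitrary: e e')
  case (Cons \<sigma> \<Gamma>)
  then obtain a b f f' where *: "e = a # f" "e' = b # f'" "f \<in> envs M \<Gamma>" "f' \<in> envs M \<Gamma>" "length a = length b"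
    by (auto simp: envs_Cons length_tuples)
  then show ?case using Cons.IH Cons.prems(3) by simp
qed simp

lemma definable_concat:
  assumes "Dp L M A \<Gamma> P"
  shows "definable L M A (concat \<Gamma>) {concat e | e. e \<in> envs M \<Gamma> \<and> P e}"
proof -
  obtain \<phi> bs \<tau> where *: "bs \<in> tuples M \<tau>" "set bs \<subseteq> A" "formula_in L (concat \<Gamma> @ \<tau>) \<phi>"
     "\<And>e. e \<in> envs M \<Gamma> \<Longrightarrow> P e \<longleftrightarrow> holds M \<phi> (concat e @ bs)"
    using assms unfolding Dp_def by auto
  have "{concat e | e. e \<in> envs M \<Gamma> \<and> P e} = {as \<in> tuples M (concat \<Gamma>). holds M \<phi> (as @ bs)}"
    using concat_inj_envs *(4) by (auto simp: tuples_concat)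
  then show ?thesis unfolding definable_iff_formula using * by blast
qed

lemma definable_of_Dp:
  assumes "Dp L M A \<Gamma> P"
  obtains Y where "definable L M A (concat \<Gamma>) Y" "\<And>e. e \<in> envs M \<Gamma> \<Longrightarrow> P e \<longleftrightarrow> concat e \<in> Y"
  using that[OF definable_concat[OF assms]] concat_inj_envs by fastforce

lemma definable_Collect2:
  assumes "Dp L M A [\<sigma>, \<tau>] (\<lambda>e. P (hd e) (hd (tl e)))"
  shows "definable L M A (\<sigma> @ \<tau>) {x @ y | x y. x \<in> tuples M \<sigma> \<and> y \<in> tuples M \<tau> \<and> P x y}"
proof -
  have "{concat e | e. e \<in> envs M [\<sigma>, \<tau>] \<and> P (hd e) (hd (tl e))} =
      {x @ y | x y. x \<in> tuples M \<sigma> \<and> y \<in> tuples M \<tau> \<and> P x y}" (is "?A = ?B")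
  proof (intro equalityI subsetI)
    fix z assume "z \<in> ?B"
    then obtain x y where "z = x @ y" "x \<in> tuples M \<sigma>" "y \<in> tuples M \<tau>" "P x y" by blast
    then show "z \<in> ?A" by (intro CollectI exI[of _ "[x, y]"]) simp
  next
    fix z assume "z \<in> ?A"
    then obtain e where "z = concat e" "e \<in> envs M [\<sigma>, \<tau>]" "P (hd e) (hd (tl e))" by blast
    then show "z \<in> ?B" by (auto simp: envs_Cons) blast
  qed
  then show ?thesis using definable_concat[OF assms] by simp
qed

lemma definable_Collect3:
  assumes "Dp L M A [\<sigma>, \<tau>, \<rho>] (\<lambda>e. P (hd e) (hd (tl e)) (hd (tl (tl e))))"
  shows "definable L M A (\<sigma> @ \<tau> @ \<rho>)
    {x @ y @ z | x y z. x \<in> tuples M \<sigma> \<and> y \<in> tuples M \<tau> \<and> z \<in> tuples M \<rho> \<and> P x y z}"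
proof -
  have "{concat e | e. e \<in> envs M [\<sigma>, \<tau>, \<rho>] \<and> P (hd e) (hd (tl e)) (hd (tl (tl e)))} =
      {x @ y @ z | x y z. x \<in> tuples M \<sigma> \<and> y \<in> tuples M \<tau> \<and> z \<in> tuples M \<rho> \<and> P x y z}"
    (is "?A = ?B")
  proof (intro equalityI subsetI)
    fix w assume "w \<in> ?B"
    then obtain x y z where "w = x @ y @ z" "x \<in> tuples M \<sigma>" "y \<in> tuples M \<tau>" "z \<in> tuples M \<rho>"
      "P x y z" by blast
    then show "w \<in> ?A" by (intro CollectI exI[of _ "[x, y, z]"]) simp
  next
    fix z assume "z \<in> ?A"
    then obtain e where "z = concat e" "e \<in> envs M [\<sigma>, \<tau>, \<rho>]" "P (hd e) (hd (tl e)) (hd (tl (tl e)))" by blast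
    then show "z \<in> ?B" by (auto simp: envs_Cons) blast
  qed
  then show ?thesis using definable_concat[OF assms] by simp
qed

lemma Dp_eq1:
  assumes "tm M A \<Gamma> x [s]" "tm M A \<Gamma> y [s]"
  shows "Dp L M A \<Gamma> (\<lambda>e. x e = y e)"
proof -
  let ?\<phi> = "Eq (Var (s, 0)) (Var (s, Suc 0))"
  have \<phi>: "formula_in L (([s] @ [s]) @ []) ?\<phi>"
    by (auto simp: formula_in_def intro: has_sort.intros)
  have "holds M ?\<phi> ((x e @ y e) @ []) \<longleftrightarrow> x e = y e" if "e \<in> envs M \<Gamma>" for e
    using tm_in_tuples[OF assms(1) that] tm_in_tuples[OF assms(2) that]
    by (auto simp: tuples_Cons holds_def)
  then show ?thesis
    by (rule Dp_cong[OF Dp_holds_tm[OF \<phi> _ _ tm_append[OF assms]], rotated 2]) auto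
qed

lemma Dp_eq:
  assumes "tm M A \<Gamma> x \<sigma>" "tm M A \<Gamma> y \<sigma>"
  shows "Dp L M A \<Gamma> (\<lambda>e. x e = y e)"
proof -
  have "Dp L M A \<Gamma> (\<lambda>e. \<forall>i\<in>{..<length \<sigma>}. [x e ! i] = [y e ! i])"
    using Dp_eq1[OF tm_nth[OF assms(1)] tm_nth[OF assms(2)]] by (intro Dp_finite_all) auto
  then show ?thesis
    by (rule Dp_cong)
      (use assms[THEN tm_in_tuples, THEN length_tuples] in \<open>auto intro: nth_equalityI\<close>)
qed

lemma Dp_exX:
  assumes "definable L M A' \<sigma> X" "A' \<subseteq> A" "Dp L M A (\<sigma> # \<Gamma>) (\<lambda>e. P (tl e) (hd e))"
  shows "Dp L M A \<Gamma> (\<lambda>e. \<exists>a\<in>X. P e a)"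
proof -
  have "Dp L M A \<Gamma> (\<lambda>e. \<exists>a\<in>tuples M \<sigma>. a \<in> X \<and> P e a)"
    by (intro Dp_ex Dp_conj Dp_in[OF assms(1,2)] tm_hd assms(3))
  then show ?thesis by (rule Dp_cong) (use definable_sub[OF assms(1)] in blast)
qed

lemma Dp_allX:
  assumes "definable L M A' \<sigma> X" "A' \<subseteq> A" "Dp L M A (\<sigma> # \<Gamma>) (\<lambda>e. P (tl e) (hd e))"
  shows "Dp L M A \<Gamma> (\<lambda>e. \<forall>a\<in>X. P e a)"
  using Dp_not[OF Dp_exX[OF assms(1,2) Dp_not[OF assms(3)]]] by simp

lemmas Dp_logic = Dp_all Dp_ex Dp_conj Dp_disj Dp_iff Dp_imp Dp_not
lemmas tm_intros = tm_hd tm_tl tm_append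

lemma definable_tuples: "definable L M A \<sigma> (tuples M \<sigma>)"
  using definable_Collect[OF Dp_True, of L M A \<sigma>] by simp

lemma definable_Int: "definable L M A \<sigma> X \<Longrightarrow> definable L M A \<sigma> Y \<Longrightarrow> definable L M A \<sigma> (X \<inter> Y)"
  by (rule definableI) (auto dest: definable_sub intro!: Dp_conj Dp_in tm_intros)

lemma definable_Diff: "definable L M A \<sigma> X \<Longrightarrow> definable L M A \<sigma> Y \<Longrightarrow> definable L M A \<sigma> (X - Y)"
  by (rule definableI) (auto dest: definable_sub intro!: Dp_conj Dp_not Dp_in tm_intros)

lemma definable_Inter:
  assumes "finite \<F>" "\<And>X. X \<in> \<F> \<Longrightarrow> definable L M A \<sigma> X"
  shows "definable L M A \<sigma> {x \<in> tuples M \<sigma>. \<forall>X\<in>\<F>. x \<in> X}"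
  by (rule definable_Collect) (auto intro!: Dp_finite_all Dp_in tm_intros assms)

text \<open>Each entry of \<open>bs\<close> is a constant from \<open>A\<close> or a coordinate of
  \<open>e\<close>. In the second case, disjointness of the sorts makes the sort prescribed by
  \<open>\<tau>\<close> equal to that of the coordinate.\<close>

lemma tm_of_params:
  assumes "disjoint_family (univ M)" "e \<in> envs M \<Gamma>" "bs \<in> tuples M \<tau>" "set bs \<subseteq> A \<union> set (concat e)"
  shows "\<exists>x. tm M A \<Gamma> x \<tau> \<and> x e = bs"
  using assms(3,4)
proof (induction bs arbitrary: \<tau>)
  case Nil
  then show ?case using tm_Nil length_tuples by force
next
  case (Cons b bs)
  then obtain s \<tau>' where \<tau>: "\<tau> = s # \<tau>'" "b \<in> univ M s" "bs \<in> tuples M \<tau>'"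
    by (cases \<tau>) (auto dest: length_tuples)
  then obtain x where x: "tm M A \<Gamma> x \<tau>'" "x e = bs" using Cons by auto
  have "\<exists>y. tm M A \<Gamma> y [s] \<and> y e = [b]"
  proof (cases "b \<in> A")
    case True
    then show ?thesis using \<tau> by (intro exI[of _ "\<lambda>_. [b]"]) (auto intro: tm_const)
  next
    case False
    then obtain i where i: "i < length (concat e)" "b = concat e ! i"
      using Cons.prems(2) by (metis UnE in_set_conv_nth list.set_intros(1) subset_eq)
    have i': "i < length (concat \<Gamma>)" using i length_concat_envs[OF assms(2)] by simp
    have "b \<in> univ M (concat \<Gamma> ! i)" using nth_in_univ[OF concat_in_tuples[OF assms(2)] i'] i by simp
    then have s: "s = concat \<Gamma> ! i" using \<tau>(2) assms(1) by (auto simp: disjoint_family_on_def)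
    have "tm M A \<Gamma> (\<lambda>e. [concat e ! i]) [concat \<Gamma> ! i]"
      unfolding tm_def using i' 
      by (intro exI[of _ "[]"] exI[of _ "[i]"]) (auto simp: nth_append length_concat_envs)
    then show ?thesis using i s by auto
  qed
  then obtain y where "tm M A \<Gamma> y [s]" "y e = [b]" by blast
  then show ?case using tm_append[OF _ x(1), of y "[s]"] x(2) \<tau>(1)
    by (intro exI[of _ "\<lambda>e. y e @ x e"]) auto
qed

text \<open>The parameters of the formula form a term in \<open>a\<close> over \<open>A\<close>;
  replacing \<open>a\<close> by a variable in this term turns the definition into a family over
  \<open>A\<close>.\<close>

lemma definable_pull:
  assumes "disjoint_family (univ M)" "definable L M (A \<union> set a) \<sigma> X" "a \<in> tuples M \<xi>"
  obtains Y where "definable L M A (\<sigma> @ \<xi>) Y" "X = {x \<in> tuples M \<sigma>. x @ a \<in> Y}"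
proof -
  obtain \<phi> bs \<tau> where *: "bs \<in> tuples M \<tau>" "set bs \<subseteq> A \<union> set a" "formula_in L (\<sigma> @ \<tau>) \<phi>"
     "X = {as \<in> tuples M \<sigma>. holds M \<phi> (as @ bs)}"
    using assms(2) unfolding definable_iff_formula by blast
  obtain x where x: "tm M A [\<xi>] x \<tau>" "x [a] = bs"
    using tm_of_params[OF assms(1), of "[a]" "[\<xi>]" bs \<tau> A] * assms(3) by auto
  define Y where "Y = {u @ v | u v. u \<in> tuples M \<sigma> \<and> v \<in> tuples M \<xi> \<and> holds M \<phi> (u @ x [v])}"
  have "Dp L M A [\<sigma>, \<xi>] (\<lambda>e. holds M \<phi> ((hd e @ x (tl e)) @ []))"
    using *(3) by (intro Dp_holds_tm[of L "\<sigma> @ \<tau>" "[]"] tm_intros x) auto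
  then have "Dp L M A [\<sigma>, \<xi>] (\<lambda>e. holds M \<phi> (hd e @ x [hd (tl e)]))"
    by (rule Dp_cong) (auto simp: envs_Cons)
  then have "definable L M A (\<sigma> @ \<xi>) Y" unfolding Y_def by (rule definable_Collect2)
  moreover have "X = {u \<in> tuples M \<sigma>. u @ a \<in> Y}"
  proof (intro equalityI subsetI)
    fix u assume u: "u \<in> X"
    then have "u \<in> tuples M \<sigma>" "u @ a \<in> Y" unfolding Y_def using *(4) assms(3) x(2) by blast+
    then show "u \<in> {u \<in> tuples M \<sigma>. u @ a \<in> Y}" by simp
  next
    fix u assume u: "u \<in> {u \<in> tuples M \<sigma>. u @ a \<in> Y}"
    then obtain u' v where v: "u @ a = u' @ v" "u' \<in> tuples M \<sigma>" "v \<in> tuples M \<xi>" "holds M \<phi> (u' @ x [v])"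
      "u \<in> tuples M \<sigma>" unfolding Y_def by blast
    then have "u = u'" "v = a" using length_tuples[of _ M \<sigma>] by (metis append_eq_append_conv)+
    then show "u \<in> X" using v x(2) *(4) by simp
  qed
  ultimately show thesis using that by blast
qed

lemma definable_push:
  assumes "definable L M A (\<sigma> @ \<xi>) Y" "a \<in> tuples M \<xi>"
  shows "definable L M (A \<union> set a) \<sigma> {x \<in> tuples M \<sigma>. x @ a \<in> Y}"
  by (rule definable_Collect) (auto intro!: Dp_in[OF assms(1)] tm_intros tm_const assms(2))

lemma definable_finite_params:
  assumes "definable L M (A \<union> D) \<sigma> X"
  obtains Z where "finite Z" "Z \<subseteq> D" "definable L M (A \<union> Z) \<sigma> X"
proof -
  obtain \<phi> bs \<tau> where *: "bs \<in> tuples M \<tau>" "set bs \<subseteq> A \<union> D" "formula_in L (\<sigma> @ \<tau>) \<phi>"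
     "X = {as \<in> tuples M \<sigma>. holds M \<phi> (as @ bs)}"
    using assms unfolding definable_iff_formula by blast
  then have "definable L M (A \<union> (set bs \<inter> D)) \<sigma> X" unfolding definable_iff_formula by blast
  then show thesis using that[of "set bs \<inter> D"] by auto
qed

text \<open>Elementary maps and elimination of imaginaries speak of sets defined without parameters;
  this form turns all parameters into arguments.\<close>

lemma definable_params:
  assumes "definable L M A \<sigma> X"
  obtains e \<xi> Y where "e \<in> tuples M \<xi>" "set e \<subseteq> A" "definable L M {} (\<sigma> @ \<xi>) Y" "X = {x \<in> tuples M \<sigma>. x @ e \<in> Y}"
proof -
  obtain \<phi> bs \<tau> where *: "bs \<in> tuples M \<tau>" "set bs \<subseteq> A" "formula_in L (\<sigma> @ \<tau>) \<phi>"
     "X = {as \<in> tuples M \<sigma>. holds M \<phi> (as @ bs)}"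
    using assms unfolding definable_iff_formula by blast
  let ?Y = "{y \<in> tuples M (\<sigma> @ \<tau>). holds M \<phi> (y @ [])}"
  have "definable L M {} (\<sigma> @ \<tau>) ?Y"
    unfolding definable_iff_formula using *(3)
    by (intro exI[of _ \<phi>] exI[of _ "[]"] exI[of _ "[]"]) auto
  moreover have "X = {x \<in> tuples M \<sigma>. x @ bs \<in> ?Y}"
    using *(1,4) by (auto intro: append_in_tuples)
  ultimately show thesis using that *(1,2) by blast
qed

lemma definable_formula:
  assumes "formula_in L \<sigma> \<phi>"
  shows "definable L M A \<sigma> {x \<in> tuples M \<sigma>. holds M \<phi> x}"
  unfolding definable_iff_formula using assms
  by (intro exI[of _ \<phi>] exI[of _ "[]"] exI[of _ "[]"]) auto

section \<open>Saturation and total transcendence\<close>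

text \<open>Iterated negations of \<open>Bot\<close> are pairwise distinct. As
  \<open>\<kappa>\<close> exceeds the number of formulas, it is infinite, and finite sets are
  small.\<close>

lemma infinite_formulas: "infinite {\<phi>. wf_fm L \<phi>}"
proof -
  let ?f = "\<lambda>n. (Neg ^^ n) Bot"
  have "inj ?f"
  proof (rule injI)
    fix m n assume "?f m = ?f n"
    then show "m = n"
    proof (induction m arbitrary: n)
      case 0
      then show ?case by (cases n) auto
    next
      case (Suc m)
      then show ?case by (cases n) auto
    qed
  qed
  moreover have "wf_fm L (?f n)" for n by (induction n) auto
  then have "range ?f \<subseteq> {\<phi>. wf_fm L \<phi>}" by blast
  ultimately show ?thesis using finite_subset finite_imageD infinite_UNIV_nat by metis
qed

lemma sufficiently_saturated_infinite:
  assumes "sufficiently_saturated L M \<kappa>"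
  shows "infinite (Field \<kappa>)"
proof
  assume fin: "finite (Field \<kappa>)"
  have c: "Card_order \<kappa>" and l: "|{\<phi>. wf_fm L \<phi>}| <o \<kappa>"
    using assms by (auto simp: sufficiently_saturated_def)
  have "|{\<phi>. wf_fm L \<phi>}| \<le>o |Field \<kappa>|"
    using l c by (meson card_of_Field_ordIso ordIso_symmetric ordLeq_ordIso_trans ordLess_imp_ordLeq)
  then show False using fin infinite_formulas card_of_ordLeq_finite by blast
qed

lemma finite_small:
  assumes "sufficiently_saturated L M \<kappa>" "finite Z"
  shows "|Z| <o \<kappa>"
proof (rule finite_ordLess_infinite)
  show "Well_order \<kappa>"
    using assms(1) unfolding sufficiently_saturated_def by (simp add: card_order_on_well_order_on)
  show "infinite (Field \<kappa>)" by (rule sufficiently_saturated_infinite[OF assms(1)])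
  show "Well_order |Z|" by (rule card_of_Well_order)
  show "finite (Field |Z| )" unfolding Field_card_of by (rule assms(2))
qed

text \<open>Saturation speaks of complete types. Zorn's lemma enlarges the family to a maximal
  finitely satisfiable set of formulas. This set is complete: if it omitted a formula and its
  negation, each would be refuted by a finite part, and the union of the two parts would have no
  realization.\<close>

lemma saturated_Inter:
  assumes sat: "saturated L M \<kappa>" and A: "A \<subseteq> elements M" "|A| <o \<kappa>"
    and def: "\<And>X. X \<in> \<F> \<Longrightarrow> definable L M A \<sigma> X"
    and fip: "\<And>\<F>'. finite \<F>' \<Longrightarrow> \<F>' \<subseteq> \<F> \<Longrightarrow> \<exists>x\<in>tuples M \<sigma>. \<forall>X\<in>\<F>'. x \<in> X"
  shows "\<exists>x\<in>tuples M \<sigma>. \<forall>X\<in>\<F>. x \<in> X"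
proof -
  define fs where "fs p \<longleftrightarrow> p \<subseteq> pfms L M A \<sigma> \<and> (\<forall>p0\<subseteq>p. finite p0 \<longrightarrow> realizations M \<sigma> p0 \<noteq> {})" for p
  define p0 where "p0 = {\<psi>\<in>pfms L M A \<sigma>. sols M \<sigma> \<psi> \<in> \<F>}"
  have "fs p0" unfolding fs_def
  proof (intro conjI allI impI)
    fix q assume q: "q \<subseteq> p0" "finite q"
    have "sols M \<sigma> ` q \<subseteq> \<F>" using q(1) by (auto simp: p0_def)
    then obtain x where "x\<in>tuples M \<sigma>" "\<forall>X\<in>sols M \<sigma> ` q. x \<in> X" using fip[of "sols M \<sigma> ` q"] q(2) by blast
    then show "realizations M \<sigma> q \<noteq> {}" by (auto simp: realizations_def)
  qed (auto simp: p0_def)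
  have "\<exists>p\<in>{p. p0 \<subseteq> p \<and> fs p}. \<forall>q\<in>{p. p0 \<subseteq> p \<and> fs p}. p \<subseteq> q \<longrightarrow> q = p"
  proof (rule subset_Zorn_nonempty)
    show "{p. p0 \<subseteq> p \<and> fs p} \<noteq> {}" using \<open>fs p0\<close> by blast
    fix \<C> assume ne: "\<C> \<noteq> {}" and ch: "subset.chain {p. p0 \<subseteq> p \<and> fs p} \<C>"
    then have C: "\<And>p. p \<in> \<C> \<Longrightarrow> p0 \<subseteq> p \<and> fs p" by (auto simp: subset.chain_def)
    have "realizations M \<sigma> q \<noteq> {}" if q: "q \<subseteq> \<Union>\<C>" "finite q" for q
    proof -
      obtain p where "p \<in> \<C>" "q \<subseteq> p" using finite_subset_Union_chain[OF q(2,1) ne ch] by blast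
      then show ?thesis using C q(2) by (auto simp: fs_def)
    qed
    moreover have "\<Union>\<C> \<subseteq> pfms L M A \<sigma>" using C by (auto simp: fs_def)
    ultimately have "fs (\<Union>\<C>)" by (simp add: fs_def)
    then show "\<Union>\<C> \<in> {p. p0 \<subseteq> p \<and> fs p}" using ne C by blast
  qed
  then obtain p where pin: "p \<in> {p. p0 \<subseteq> p \<and> fs p}"
    and mx: "\<forall>q\<in>{p. p0 \<subseteq> p \<and> fs p}. p \<subseteq> q \<longrightarrow> q = p" by (elim bexE)
  from pin have p: "p0 \<subseteq> p" "fs p" by simp_all
  have max: "q = p" if "p \<subseteq> q" "fs q" for q using mx that p(1) by simp
  have split: "\<psi> \<in> p \<or> (\<exists>q\<subseteq>p. finite q \<and> realizations M \<sigma> (insert \<psi> q) = {})" if \<psi>: "\<psi> \<in> pfms L M A \<sigma>" for \<psi>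
  proof (rule disjCI)
    assume H: "\<not> (\<exists>q\<subseteq>p. finite q \<and> realizations M \<sigma> (insert \<psi> q) = {})"
    have "fs (insert \<psi> p)" unfolding fs_def
    proof (intro conjI allI impI)
      show "insert \<psi> p \<subseteq> pfms L M A \<sigma>" using p(2) \<psi> by (auto simp: fs_def)
      fix q assume "q \<subseteq> insert \<psi> p" "finite q"
      then have "q - {\<psi>} \<subseteq> p" "finite (q - {\<psi>})" by auto
      then have "realizations M \<sigma> (insert \<psi> (q - {\<psi>})) \<noteq> {}" using H by blast
      then show "realizations M \<sigma> q \<noteq> {}" by (auto simp: realizations_def)
    qed
    then show "\<psi> \<in> p" using max[of "insert \<psi> p"] by blast
  qed
  have "(\<phi>, bs) \<in> p \<or> (Neg \<phi>, bs) \<in> p" if in_p: "(\<phi>, bs) \<in> pfms L M A \<sigma>" for \<phi> bs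
  proof (rule ccontr)
    assume H: "\<not> ?thesis"
    have "(Neg \<phi>, bs) \<in> pfms L M A \<sigma>" using in_p by (auto simp: pfms_def)
    then obtain q1 q2 where q: "q1 \<subseteq> p" "finite q1" "realizations M \<sigma> (insert (\<phi>, bs) q1) = {}"
       "q2 \<subseteq> p" "finite q2" "realizations M \<sigma> (insert (Neg \<phi>, bs) q2) = {}"
      using split[OF in_p] split[of "(Neg \<phi>, bs)"] H by blast
    then have "realizations M \<sigma> (q1 \<union> q2) \<noteq> {}" using p(2) by (auto simp: fs_def)
    then show False using q(3,6) by (fastforce simp: realizations_def sols_def)
  qed
  then have "p \<in> types L M A \<sigma>" using p(2) by (auto simp: types_def fs_def)
  then obtain x where x: "x \<in> realizations M \<sigma> p" using sat A unfolding saturated_def by blast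
  have "x \<in> X" if "X \<in> \<F>" for X
  proof -
    obtain \<psi> where "\<psi> \<in> pfms L M A \<sigma>" "X = sols M \<sigma> \<psi>" using def[OF \<open>X \<in> \<F>\<close>] by (auto simp: definable_def)
    then have "\<psi> \<in> p" using p(1) that by (auto simp: p0_def)
    then show ?thesis using x \<open>X = sols M \<sigma> \<psi>\<close> by (auto simp: realizations_def)
  qed
  then show ?thesis using x by (auto simp: realizations_def)
qed

text \<open>Splitting again and again one of the two halves, and keeping the other, gives infinitely
  many disjoint members of \<open>K\<close> inside \<open>X\<close>. They all have rank at least
  \<beta> by induction, for every \<beta> below \<alpha>.\<close>

lemma splitting_morley_ge:
  assumes K: "\<And>X. K X \<Longrightarrow> X \<noteq> {} \<and> definable L M (elements M) \<sigma> X"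
    and split: "\<And>X. K X \<Longrightarrow> \<exists>Y Z. K Y \<and> K Z \<and> Y \<subseteq> X \<and> Z \<subseteq> X \<and> Y \<inter> Z = {}"
    and r: "Well_order r" and X: "K X"
  shows "morley_ge L M \<sigma> r X \<alpha>"
proof -
  have "wf (r - Id)" using r by (simp add: well_order_on_def)
  then show ?thesis using X
  proof (induction \<alpha> arbitrary: X)
    case (less \<alpha>)
    \<comment> \<open>\<open>fst (f n)\<close> is the half that is kept, and
      \<open>snd (f n)\<close> is the half that is split at the next stage.\<close>
    have "\<exists>f. \<forall>n::nat. (K (fst (f n)) \<and> K (snd (f n)) \<and> fst (f n) \<inter> snd (f n) = {} \<and> fst (f n) \<union> snd (f n) \<subseteq> X)
        \<and> fst (f (Suc n)) \<union> snd (f (Suc n)) \<subseteq> snd (f n)"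
    proof (rule dependent_nat_choice)
      show "\<exists>x. K (fst x) \<and> K (snd x) \<and> fst x \<inter> snd x = {} \<and> fst x \<union> snd x \<subseteq> X"
        using split[OF less.prems] by auto
      fix x and n :: nat
      assume "K (fst x) \<and> K (snd x) \<and> fst x \<inter> snd x = {} \<and> fst x \<union> snd x \<subseteq> X"
      moreover from this obtain Y Z where "K Y" "K Z" "Y \<subseteq> snd x" "Z \<subseteq> snd x" "Y \<inter> Z = {}"
        using split[of "snd x"] by auto
      ultimately show "\<exists>y. (K (fst y) \<and> K (snd y) \<and> fst y \<inter> snd y = {} \<and> fst y \<union> snd y \<subseteq> X) \<and>
           fst y \<union> snd y \<subseteq> snd x"
        by (intro exI[of _ "(Y, Z)"]) auto
    qed
    then obtain f where f: "\<And>n. K (fst (f n))" "\<And>n. fst (f n) \<inter> snd (f n) = {}"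
        "\<And>n. fst (f n) \<subseteq> X" "\<And>n. fst (f (Suc n)) \<subseteq> snd (f n)" "\<And>n. snd (f (Suc n)) \<subseteq> snd (f n)"
      by blast
    have "snd (f n) \<subseteq> snd (f m)" if "m \<le> n" for m n
      using that by (induction n rule: dec_induct) (use f(5) in blast)+
    then have "fst (f n) \<subseteq> snd (f m)" if "m < n" for m n
      using that f(4)[of "n - 1"] by (metis Suc_pred' bot_nat_0.not_eq_extremum less_Suc_eq_le less_zeroE order_trans)
    then have "fst (f m) \<inter> fst (f n) = {}" if "m < n" for m n
      using that f(2)[of m] by blast
    then have disj: "disjoint_family (\<lambda>n. fst (f n))"
      by (auto simp: disjoint_family_on_def) (metis disjoint_iff linorder_neqE_nat)
    show ?case
    proof (rule morley_ge.intros)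
      show "X \<noteq> {}" using K less.prems by blast
      show "\<forall>\<beta>. (\<beta>, \<alpha>) \<in> r \<and> \<beta> \<noteq> \<alpha> \<longrightarrow> (\<exists>F :: nat \<Rightarrow> _ list set. disjoint_family F \<and>
         (\<forall>i. F i \<subseteq> X \<and> definable L M (elements M) \<sigma> (F i) \<and> morley_ge L M \<sigma> r (F i) \<beta>))"
        using disj f(1,3) K less.IH by (intro allI impI exI[of _ "\<lambda>n. fst (f n)"]) auto
    qed
  qed
qed

text \<open>Total transcendence enters in this form: with \<open>K\<close> the nonempty sets
  definable over a given parameter set it yields isolated types, with \<open>K\<close> the sets of
  infinite local rank it yields definability of types.\<close>

lemma no_splitting:
  assumes "totally_transcendental L M"
    and "\<And>X. K X \<Longrightarrow> X \<noteq> {} \<and> definable L M (elements M) \<sigma> X"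
    and "\<And>X. K X \<Longrightarrow> \<exists>Y Z. K Y \<and> K Z \<and> Y \<subseteq> X \<and> Z \<subseteq> X \<and> Y \<inter> Z = {}"
  shows "\<not> K X"
  using splitting_morley_ge[of K L M \<sigma>] assms unfolding totally_transcendental_def by metis

text \<open>An atom of the Boolean algebra of \<open>A\<close>-definable sets isolates a complete
  type over \<open>A\<close>. If \<open>X\<close> contained none, every nonempty
  \<open>A\<close>-definable subset of \<open>X\<close> would be cut into two such subsets.\<close>

lemma ex_definable_atom:
  assumes tt: "totally_transcendental L M" and A: "A \<subseteq> elements M"
    and X: "definable L M A \<sigma> X" "X \<noteq> {}"
  obtains Y where "definable L M A \<sigma> Y" "Y \<subseteq> X" "Y \<noteq> {}"
    "\<And>Z. definable L M A \<sigma> Z \<Longrightarrow> Y \<subseteq> Z \<or> Y \<inter> Z = {}"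
proof -
  define K where "K Y \<longleftrightarrow> definable L M A \<sigma> Y \<and> Y \<subseteq> X \<and> Y \<noteq> {}" for Y
  have "\<exists>Y. K Y \<and> (\<forall>Z. definable L M A \<sigma> Z \<longrightarrow> Y \<subseteq> Z \<or> Y \<inter> Z = {})"
  proof (rule ccontr)
    assume H: "\<not> ?thesis"
    have "\<not> K X"
    proof (rule no_splitting[OF tt])
      fix Y assume Y: "K Y"
      then show "Y \<noteq> {} \<and> definable L M (elements M) \<sigma> Y"
        using definable_mono[OF _ A] by (auto simp: K_def)
      obtain Z where Z: "definable L M A \<sigma> Z" "\<not> Y \<subseteq> Z" "Y \<inter> Z \<noteq> {}" using H Y by blast
      then have "K (Y \<inter> Z)" "K (Y - Z)"
        using Y by (auto simp: K_def intro: definable_Int definable_Diff)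
      then show "\<exists>Y' Z. K Y' \<and> K Z \<and> Y' \<subseteq> Y \<and> Z \<subseteq> Y \<and> Y' \<inter> Z = {}" by blast
    qed
    then show False using X by (simp add: K_def)
  qed
  then show thesis using that by (auto simp: K_def)
qed

section \<open>Local ranks and definability of types\<close>

text \<open>Shelah's 2-rank of \<open>X\<close> with respect to the family \<open>(\<Phi> y)\<close>.\<close>

primrec rank_ge :: "'b set \<Rightarrow> ('b \<Rightarrow> 'a set) \<Rightarrow> nat \<Rightarrow> 'a set \<Rightarrow> bool" where
  "rank_ge U \<Phi> 0 X = (X \<noteq> {})"
| "rank_ge U \<Phi> (Suc n) X = (\<exists>y\<in>U. rank_ge U \<Phi> n (X \<inter> \<Phi> y) \<and> rank_ge U \<Phi> n (X - \<Phi> y))"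

lemma rank_ge_mono: "rank_ge U \<Phi> n X \<Longrightarrow> X \<subseteq> X' \<Longrightarrow> rank_ge U \<Phi> n X'"
proof (induction n arbitrary: X X')
  case (Suc n)
  then obtain y where "y \<in> U" "rank_ge U \<Phi> n (X \<inter> \<Phi> y)" "rank_ge U \<Phi> n (X - \<Phi> y)" by auto
  then show ?case using Suc.IH[of "X \<inter> \<Phi> y" "X' \<inter> \<Phi> y"] Suc.IH[of "X - \<Phi> y" "X' - \<Phi> y"] Suc.prems(2)
    by auto
qed auto

lemma rank_ge_SucD: "rank_ge U \<Phi> (Suc n) X \<Longrightarrow> rank_ge U \<Phi> n X"
  using rank_ge_mono[of U \<Phi> n _ X] by auto

lemma rank_ge_le: "rank_ge U \<Phi> n X \<Longrightarrow> m \<le> n \<Longrightarrow> rank_ge U \<Phi> m X"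
  by (induction n) (use rank_ge_SucD le_Suc_eq in blast)+

text \<open>Unfolding the rank once quantifies over a splitting parameter \<open>y\<close>, which
  then becomes a further argument of the two halves. The induction therefore runs over all families
  \<open>W\<close> and all terms \<open>z\<close>.\<close>

lemma Dp_rank_ge:
  assumes F: "definable L M A (\<sigma> @ \<upsilon>) F" and "definable L M A (\<sigma> @ \<xi>) W" "tm M A \<Gamma> z \<xi>"
  shows "Dp L M A \<Gamma> (\<lambda>e. rank_ge (tuples M \<upsilon>) (\<lambda>y. {x. x @ y \<in> F}) n {x \<in> tuples M \<sigma>. x @ z e \<in> W})"
  using assms(2,3)
proof (induction n arbitrary: \<xi> W \<Gamma> z)
  case 0
  have "Dp L M A \<Gamma> (\<lambda>e. \<exists>x\<in>tuples M \<sigma>. x @ z e \<in> W)"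
    by (intro Dp_ex Dp_in[OF 0(1)] tm_intros 0) auto
  then show ?case by (rule Dp_cong) auto
next
  case (Suc n)
  define W1 where "W1 = {x @ u @ y | x u y. x \<in> tuples M \<sigma> \<and> u \<in> tuples M \<xi> \<and> y \<in> tuples M \<upsilon> \<and> x @ u \<in> W \<and> x @ y \<in> F}"
  define W2 where "W2 = {x @ u @ y | x u y. x \<in> tuples M \<sigma> \<and> u \<in> tuples M \<xi> \<and> y \<in> tuples M \<upsilon> \<and> x @ u \<in> W \<and> x @ y \<notin> F}"
  have W1: "definable L M A (\<sigma> @ \<xi> @ \<upsilon>) W1" unfolding W1_def
    by (intro definable_Collect3 Dp_conj Dp_in[OF Suc.prems(1)] Dp_in[OF F] tm_intros) auto
  have W2: "definable L M A (\<sigma> @ \<xi> @ \<upsilon>) W2" unfolding W2_def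
    by (intro definable_Collect3 Dp_conj Dp_not Dp_in[OF Suc.prems(1)] Dp_in[OF F] tm_intros) auto
  let ?r = "rank_ge (tuples M \<upsilon>) (\<lambda>y. {x. x @ y \<in> F}) n"
  have z: "tm M A (\<upsilon> # \<Gamma>) (\<lambda>e. z (tl e) @ hd e) (\<xi> @ \<upsilon>)" by (intro tm_intros Suc.prems)
  have "Dp L M A \<Gamma> (\<lambda>e. \<exists>y\<in>tuples M \<upsilon>. ?r {x \<in> tuples M \<sigma>. x @ z e @ y \<in> W1} \<and> ?r {x \<in> tuples M \<sigma>. x @ z e @ y \<in> W2})"
    by (intro Dp_ex Dp_conj Suc.IH[OF W1 z] Suc.IH[OF W2 z])
  then show ?case
  proof (rule Dp_cong)
    fix e assume e: "e \<in> envs M \<Gamma>"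
    have zt: "z e \<in> tuples M \<xi>" by (rule tm_in_tuples[OF Suc.prems(2) e])
    have app: "x = x' \<and> z e = u' \<and> y = y'" if "x @ z e @ y = x' @ u' @ y'"
      "x \<in> tuples M \<sigma>" "x' \<in> tuples M \<sigma>" "u' \<in> tuples M \<xi>" for x y x' u' y'
      using that zt by (simp add: length_tuples)
    have in1: "x @ z e @ y \<in> W1 \<longleftrightarrow> x @ z e \<in> W \<and> x @ y \<in> F"
      and in2: "x @ z e @ y \<in> W2 \<longleftrightarrow> x @ z e \<in> W \<and> x @ y \<notin> F"
      if "x \<in> tuples M \<sigma>" "y \<in> tuples M \<upsilon>" for x y
      unfolding W1_def W2_def mem_Collect_eq using that zt app[of x y] by blast+
    have "{x \<in> tuples M \<sigma>. x @ z e @ y \<in> W1} = {x \<in> tuples M \<sigma>. x @ z e \<in> W} \<inter> {x. x @ y \<in> F}"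
      "{x \<in> tuples M \<sigma>. x @ z e @ y \<in> W2} = {x \<in> tuples M \<sigma>. x @ z e \<in> W} - {x. x @ y \<in> F}"
      if y: "y \<in> tuples M \<upsilon>" for y
      using in1[OF _ y] in2[OF _ y] by auto
    then show "(\<exists>y\<in>tuples M \<upsilon>. ?r {x \<in> tuples M \<sigma>. x @ z e @ y \<in> W1} \<and> ?r {x \<in> tuples M \<sigma>. x @ z e @ y \<in> W2}) \<longleftrightarrow>
      rank_ge (tuples M \<upsilon>) (\<lambda>y. {x. x @ y \<in> F}) (Suc n) {x \<in> tuples M \<sigma>. x @ z e \<in> W}"
      by simp
  qed
qed

lemma definable_rank_ge:
  assumes F: "definable L M A (\<sigma> @ \<upsilon>) F" and X: "definable L M A \<sigma> X"
  shows "definable L M A \<upsilon> {y \<in> tuples M \<upsilon>. rank_ge (tuples M \<upsilon>) (\<lambda>y. {x. x @ y \<in> F}) n (X \<inter> {x. x @ y \<in> F})}"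
    and "definable L M A \<upsilon> {y \<in> tuples M \<upsilon>. rank_ge (tuples M \<upsilon>) (\<lambda>y. {x. x @ y \<in> F}) n (X - {x. x @ y \<in> F})}"
proof -
  define W1 where "W1 = {x @ y | x y. x \<in> tuples M \<sigma> \<and> y \<in> tuples M \<upsilon> \<and> x \<in> X \<and> x @ y \<in> F}"
  define W2 where "W2 = {x @ y | x y. x \<in> tuples M \<sigma> \<and> y \<in> tuples M \<upsilon> \<and> x \<in> X \<and> x @ y \<notin> F}"
  have W1: "definable L M A (\<sigma> @ \<upsilon>) W1" unfolding W1_def
    by (intro definable_Collect2 Dp_conj Dp_in[OF X] Dp_in[OF F] tm_intros) auto
  have W2: "definable L M A (\<sigma> @ \<upsilon>) W2" unfolding W2_def
    by (intro definable_Collect2 Dp_conj Dp_not Dp_in[OF X] Dp_in[OF F] tm_intros) auto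
  have *: "{x \<in> tuples M \<sigma>. x @ y \<in> W1} = X \<inter> {x. x @ y \<in> F}"
    "{x \<in> tuples M \<sigma>. x @ y \<in> W2} = X - {x. x @ y \<in> F}" if y: "y \<in> tuples M \<upsilon>" for y
    unfolding W1_def W2_def using definable_sub[OF X] y by (auto simp: length_tuples)
  let ?r = "rank_ge (tuples M \<upsilon>) (\<lambda>y. {x. x @ y \<in> F}) n"
  have "definable L M A \<upsilon> {y \<in> tuples M \<upsilon>. ?r {x \<in> tuples M \<sigma>. x @ y \<in> W1}}"
    by (intro definable_Collect Dp_rank_ge[OF F W1] tm_intros)
  then show "definable L M A \<upsilon> {y \<in> tuples M \<upsilon>. ?r (X \<inter> {x. x @ y \<in> F})}"
    using * by (simp cong: conj_cong)
  have "definable L M A \<upsilon> {y \<in> tuples M \<upsilon>. ?r {x \<in> tuples M \<sigma>. x @ y \<in> W2}}"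
    by (intro definable_Collect Dp_rank_ge[OF F W2] tm_intros)
  then show "definable L M A \<upsilon> {y \<in> tuples M \<upsilon>. ?r (X - {x. x @ y \<in> F})}"
    using * by (simp cong: conj_cong)
qed

text \<open>Let \<open>X\<close> have every finite rank. The parameters that split \<open>X\<close>
  into two pieces of rank at least \<open>n\<close> form a set that is definable over finitely many
  elements, is nonempty, and shrinks as \<open>n\<close> grows. By saturation one parameter serves
  all \<open>n\<close>, so both pieces again have every finite rank; \<open>no_splitting\<close>
  excludes this.\<close>

lemma finite_rank:
  assumes ss: "sufficiently_saturated L M \<kappa>" and tt: "totally_transcendental L M"
    and F: "definable L M {} (\<sigma> @ \<upsilon>) F" and X: "definable L M (elements M) \<sigma> X"
  shows "\<exists>n. \<not> rank_ge (tuples M \<upsilon>) (\<lambda>y. {x. x @ y \<in> F}) n X"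
proof -
  let ?r = "rank_ge (tuples M \<upsilon>) (\<lambda>y. {x. x @ y \<in> F})"
  define K where "K X \<longleftrightarrow> definable L M (elements M) \<sigma> X \<and> (\<forall>n. ?r n X)" for X
  have "\<not> K X"
  proof (rule no_splitting[OF tt])
    fix X assume K: "K X"
    then have X: "definable L M ({} \<union> elements M) \<sigma> X" and r: "\<And>n. ?r n X" by (auto simp: K_def)
    show "X \<noteq> {} \<and> definable L M (elements M) \<sigma> X" using r[of 0] X by simp
    obtain Z where Z: "finite Z" "Z \<subseteq> elements M" "definable L M ({} \<union> Z) \<sigma> X"
      using definable_finite_params[OF X] by blast
    have FZ: "definable L M Z (\<sigma> @ \<upsilon>) F" using F definable_mono by blast
    define Y where "Y n = {y \<in> tuples M \<upsilon>. ?r n (X \<inter> {x. x @ y \<in> F})} \<inter> {y \<in> tuples M \<upsilon>. ?r n (X - {x. x @ y \<in> F})}" for n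
    have "\<exists>y\<in>tuples M \<upsilon>. \<forall>U\<in>range Y. y \<in> U"
    proof (rule saturated_Inter)
      show "saturated L M \<kappa>" using ss by (simp add: sufficiently_saturated_def)
      show "Z \<subseteq> elements M" by fact
      show "|Z| <o \<kappa>" using finite_small[OF ss Z(1)] .
      show "definable L M Z \<upsilon> U" if "U \<in> range Y" for U
        using that Z(3) by (auto simp: Y_def intro!: definable_Int definable_rank_ge[OF FZ])
      fix \<F>' assume "finite \<F>'" "\<F>' \<subseteq> range Y"
      then obtain I where I: "finite I" "\<F>' = Y ` I" by (meson finite_subset_image)
      define N where "N = Max (insert 0 I)"
      have N: "n \<le> N" if "n \<in> I" for n using that I(1) by (simp add: N_def)
      obtain y where y: "y \<in> tuples M \<upsilon>" "?r N (X \<inter> {x. x @ y \<in> F})" "?r N (X - {x. x @ y \<in> F})"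
        using r[of "Suc N"] by auto
      have "y \<in> Y n" if "n \<in> I" for n
        using y rank_ge_le[OF y(2) N[OF that]] rank_ge_le[OF y(3) N[OF that]] by (simp add: Y_def)
      then show "\<exists>y\<in>tuples M \<upsilon>. \<forall>U\<in>\<F>'. y \<in> U" using y(1) I(2) by blast
    qed
    then obtain y where y: "y \<in> tuples M \<upsilon>" "\<And>n. y \<in> Y n" by auto
    have "definable L M (elements M) \<sigma> {x \<in> tuples M \<sigma>. x @ y \<in> F}"
      using definable_mono[OF definable_push[OF F y(1)]] set_tuples[OF y(1)] by auto
    then have "definable L M (elements M) \<sigma> (X \<inter> {x \<in> tuples M \<sigma>. x @ y \<in> F})"
      "definable L M (elements M) \<sigma> (X - {x \<in> tuples M \<sigma>. x @ y \<in> F})"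
      using K by (auto simp: K_def intro: definable_Int definable_Diff)
    moreover have "X \<inter> {x \<in> tuples M \<sigma>. x @ y \<in> F} = X \<inter> {x. x @ y \<in> F}"
       "X - {x \<in> tuples M \<sigma>. x @ y \<in> F} = X - {x. x @ y \<in> F}"
      using definable_sub[OF X] by auto
    ultimately have "K (X \<inter> {x. x @ y \<in> F})" "K (X - {x. x @ y \<in> F})"
      using y(2) by (auto simp: K_def Y_def)
    then show "\<exists>Y Z. K Y \<and> K Z \<and> Y \<subseteq> X \<and> Z \<subseteq> X \<and> Y \<inter> Z = {}" by blast
  qed
  then show ?thesis using X by (simp add: K_def)
qed

text \<open>If \<open>X \<ni> d\<close> is \<open>D\<close>-definable of minimal rank \<open>m\<close>, then \<open>d @ y \<in> F\<close> iff \<open>X \<inter> \<Phi> y\<close> still has rank \<open>m\<close>,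
  as otherwise \<open>X\<close> would split into two pieces of rank \<open>m\<close>.\<close>

lemma type_definable:
  assumes ss: "sufficiently_saturated L M \<kappa>" and tt: "totally_transcendental L M"
    and F: "definable L M {} (\<sigma> @ \<upsilon>) F" and D: "D \<subseteq> elements M" and d: "d \<in> tuples M \<sigma>"
  obtains T where "definable L M D \<upsilon> T"
    "\<And>y. y \<in> tuples M \<upsilon> \<Longrightarrow> set y \<subseteq> D \<Longrightarrow> d @ y \<in> F \<longleftrightarrow> y \<in> T"
proof -
  let ?r = "rank_ge (tuples M \<upsilon>) (\<lambda>y. {x. x @ y \<in> F})"
  define P where "P n \<longleftrightarrow> (\<exists>X. definable L M D \<sigma> X \<and> d \<in> X \<and> \<not> ?r n X)" for n
  have "\<exists>n. P n"
    using finite_rank[OF ss tt F definable_tuples] definable_tuples d unfolding P_def by blast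
  then obtain n where n: "P n" "\<And>m. m < n \<Longrightarrow> \<not> P m" by (metis exists_least_iff)
  obtain X where X: "definable L M D \<sigma> X" "d \<in> X" "\<not> ?r n X" using n(1) unfolding P_def by blast
  \<comment> \<open>Rank 0 means nonempty and \<open>X\<close> contains \<open>d\<close>, so the
    least \<open>n\<close> is not 0. By minimality every \<open>D\<close>-definable set containing
    \<open>d\<close> has rank at least \<open>m\<close>, while \<open>X\<close> does not have rank
    \<open>Suc m\<close>.\<close>
  obtain m where m: "n = Suc m" using X(2,3) by (cases n) auto
  have FD: "definable L M D (\<sigma> @ \<upsilon>) F" using F definable_mono by blast
  have min: "?r m X'" if "definable L M D \<sigma> X'" "d \<in> X'" for X'
    using n(2)[of m] m that unfolding P_def by blast
  show thesis
  proof
    show "definable L M D \<upsilon> {y \<in> tuples M \<upsilon>. ?r m (X \<inter> {x. x @ y \<in> F})}"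
      by (rule definable_rank_ge[OF FD X(1)])
    fix y assume y: "y \<in> tuples M \<upsilon>" "set y \<subseteq> D"
    have Fy: "definable L M D \<sigma> {x \<in> tuples M \<sigma>. x @ y \<in> F}"
      using definable_mono[OF definable_push[OF F y(1)]] y(2) by auto
    have eq: "X \<inter> {x \<in> tuples M \<sigma>. x @ y \<in> F} = X \<inter> {x. x @ y \<in> F}"
       "X - {x \<in> tuples M \<sigma>. x @ y \<in> F} = X - {x. x @ y \<in> F}"
      using definable_sub[OF X(1)] by auto
    \<comment> \<open>As \<open>y\<close> lies in \<open>D\<close>, both halves of \<open>X\<close>
      are \<open>D\<close>-definable. The one that contains \<open>d\<close> keeps rank
      \<open>m\<close>, and the two cannot both have it.\<close>
    have "?r m (X \<inter> {x. x @ y \<in> F})" if "d @ y \<in> F"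
      using min[OF definable_Int[OF X(1) Fy]] that X(2) eq(1) by simp
    moreover have "?r m (X - {x. x @ y \<in> F})" if "d @ y \<notin> F"
      using min[OF definable_Diff[OF X(1) Fy]] that X(2) eq(2) by simp
    ultimately show "d @ y \<in> F \<longleftrightarrow> y \<in> {y \<in> tuples M \<upsilon>. ?r m (X \<inter> {x. x @ y \<in> F})}"
      using X(3) m y(1) by auto
  qed
qed

section \<open>Elementary maps\<close>

definition pairs_in :: "('m \<times> 'm) set \<Rightarrow> 'm list \<Rightarrow> 'm list \<Rightarrow> bool" where
  "pairs_in R as bs \<longleftrightarrow> length as = length bs \<and> set (zip as bs) \<subseteq> R"

text \<open>A partial elementary map is a relation here, so that passing to the converse and adding
  pairs are plain set operations. That it is single valued follows from preservation of the equality
  formula.\<close>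

definition elem_map :: "('f, 'r, 's) lang \<Rightarrow> ('f, 'r, 's, 'm) struct \<Rightarrow> ('m \<times> 'm) set \<Rightarrow> bool" where
  "elem_map L M R \<longleftrightarrow> R \<subseteq> elements M \<times> elements M \<and> (\<forall>as bs \<tau>. pairs_in R as bs \<and> as \<in> tuples M \<tau> \<longrightarrow>
     bs \<in> tuples M \<tau> \<and> (\<forall>\<phi>. formula_in L \<tau> \<phi> \<longrightarrow> (holds M \<phi> as \<longleftrightarrow> holds M \<phi> bs)))"

lemma pairs_in_mono: "pairs_in R as bs \<Longrightarrow> R \<subseteq> R' \<Longrightarrow> pairs_in R' as bs"
  by (auto simp: pairs_in_def)

lemma pairs_in_append:
  "pairs_in R as bs \<Longrightarrow> pairs_in R as' bs' \<Longrightarrow> pairs_in R (as @ as') (bs @ bs')"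
  by (auto simp: pairs_in_def)

lemma pairs_in_Cons: "pairs_in R (a # as) (b # bs) \<longleftrightarrow> (a, b) \<in> R \<and> pairs_in R as bs"
  by (auto simp: pairs_in_def)

lemma pairs_in_Nil: "pairs_in R [] []"
  by (auto simp: pairs_in_def)

lemma pairs_in_Id: "Id_on (set c) \<subseteq> R \<Longrightarrow> pairs_in R c c"
  by (auto simp: pairs_in_def set_zip)

lemma pairs_in_subsets:
  assumes "pairs_in R as bs"
  shows "set as \<subseteq> Domain R" "set bs \<subseteq> Range R"
proof -
  have "set as = fst ` set (zip as bs)" "set bs = snd ` set (zip as bs)"
    using assms by (simp_all add: pairs_in_def flip: set_map)
  then show "set as \<subseteq> Domain R" "set bs \<subseteq> Range R"
    using assms by (force simp: pairs_in_def)+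
qed

lemma pairs_in_ex: "set as \<subseteq> Domain R \<Longrightarrow> \<exists>bs. pairs_in R as bs"
proof (induction as)
  case (Cons a as)
  then obtain b bs where "(a, b) \<in> R" "pairs_in R as bs" by auto
  then have "pairs_in R (a # as) (b # bs)" by (simp add: pairs_in_Cons)
  then show ?case by blast
qed (use pairs_in_Nil in blast)

lemma pairs_in_converse: "pairs_in (R\<inverse>) as bs \<longleftrightarrow> pairs_in R bs as"
proof -
  have "set (zip as bs) \<subseteq> R\<inverse> \<longleftrightarrow> set (zip bs as) \<subseteq> R" if "length as = length bs"
    using that by (auto simp: set_zip)
  then show ?thesis by (auto simp: pairs_in_def)
qed

lemma elem_mapD:
  assumes "elem_map L M R" "pairs_in R as bs" "as \<in> tuples M \<tau>"
  shows "bs \<in> tuples M \<tau>" "formula_in L \<tau> \<phi> \<Longrightarrow> holds M \<phi> as \<longleftrightarrow> holds M \<phi> bs"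
  using assms unfolding elem_map_def by blast+

lemma elem_map_definable:
  assumes "elem_map L M R" "pairs_in R as bs" "as \<in> tuples M \<tau>" "definable L M {} \<tau> Y"
  shows "as \<in> Y \<longleftrightarrow> bs \<in> Y"
proof -
  obtain \<phi> where "formula_in L \<tau> \<phi>" "Y = {as \<in> tuples M \<tau>. holds M \<phi> as}"
  proof -
    obtain \<phi> bs \<tau>' where *: "bs \<in> tuples M \<tau>'" "set bs \<subseteq> {}" "formula_in L (\<tau> @ \<tau>') \<phi>"
      "Y = {as \<in> tuples M \<tau>. holds M \<phi> (as @ bs)}"
      using assms(4) unfolding definable_iff_formula by blast
    then have "bs = []" by simp
    then have "\<tau>' = []" using *(1) length_tuples by fastforce
    then show thesis using that[of \<phi>] * \<open>bs = []\<close> by simp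
  qed
  then show ?thesis using elem_mapD[OF assms(1-3)] assms(3) by blast
qed

lemma tuples_sorts_unique:
  assumes "disjoint_family (univ M)" "as \<in> tuples M \<sigma>" "as \<in> tuples M \<tau>"
  shows "\<sigma> = \<tau>"
proof (rule nth_equalityI)
  show "length \<sigma> = length \<tau>" using assms(2,3) length_tuples by metis
  fix i assume "i < length \<sigma>"
  then have "as ! i \<in> univ M (\<sigma> ! i)" "as ! i \<in> univ M (\<tau> ! i)"
    using assms(2,3) by (auto simp: tuples_conv_nth)
  then show "\<sigma> ! i = \<tau> ! i" using assms(1) unfolding disjoint_family_on_def by blast
qed

text \<open>Sorts are also reflected, because a tuple determines its list of sorts when the sorts
  are disjoint.\<close>

lemma elem_map_converse:
  assumes "disjoint_family (univ M)" "elem_map L M R"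
  shows "elem_map L M (R\<inverse>)"
  unfolding elem_map_def
proof (intro conjI allI impI, unfold pairs_in_converse)
  have R: "R \<subseteq> elements M \<times> elements M" using assms(2) by (simp add: elem_map_def)
  then show "R\<inverse> \<subseteq> elements M \<times> elements M" by auto
  fix as bs \<tau> assume *: "pairs_in R bs as \<and> as \<in> tuples M \<tau>"
  have "set bs \<subseteq> elements M" using pairs_in_subsets(1)[of R bs as] * R by blast
  then obtain \<tau>' where \<tau>': "bs \<in> tuples M \<tau>'" using ex_tuples_of by blast
  then have "as \<in> tuples M \<tau>'" using elem_mapD(1)[OF assms(2)] * by blast
  then have "\<tau> = \<tau>'" using tuples_sorts_unique[OF assms(1)] * by blast
  then show bs: "bs \<in> tuples M \<tau>" using \<tau>' by simp
  fix \<phi> assume "formula_in L \<tau> \<phi>"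
  then show "holds M \<phi> as \<longleftrightarrow> holds M \<phi> bs" using elem_mapD(2)[OF assms(2) _ bs] * by blast
qed

lemma pairs_in_zip:
  assumes "pairs_in (set (zip us vs)) as bs" "length us = length vs"
  obtains js where "as = map ((!) us) js" "bs = map ((!) vs) js" "\<And>j. j \<in> set js \<Longrightarrow> j < length us"
proof -
  have "\<forall>k<length as. \<exists>j<length us. us ! j = as ! k \<and> vs ! j = bs ! k"
  proof (intro allI impI)
    fix k assume "k < length as"
    then have "(as ! k, bs ! k) \<in> set (zip as bs)" using assms(1) by (auto simp: pairs_in_def set_zip)
    then have "(as ! k, bs ! k) \<in> set (zip us vs)" using assms(1) by (auto simp: pairs_in_def)
    then show "\<exists>j<length us. us ! j = as ! k \<and> vs ! j = bs ! k" by (auto simp: set_zip)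
  qed
  then obtain j where j: "\<And>k. k < length as \<Longrightarrow> j k < length us \<and> us ! j k = as ! k \<and> vs ! j k = bs ! k"
    by metis
  have "length as = length bs" using assms(1) by (simp add: pairs_in_def)
  then show thesis using j
    by (intro that[of "map j [0..<length as]"]) (auto intro!: nth_equalityI)
qed

text \<open>Corresponding tuples taken from the two lists select entries by the same index list
  \<open>js\<close>, possibly with repetitions. A formula about them is a reindexed formula about
  the full lists.\<close>

lemma elem_map_zip:
  assumes dis: "disjoint_family (univ M)"
    and uv: "us \<in> tuples M \<tau>" "vs \<in> tuples M \<tau>" "\<And>\<phi>. formula_in L \<tau> \<phi> \<Longrightarrow> holds M \<phi> us \<longleftrightarrow> holds M \<phi> vs"
  shows "elem_map L M (set (zip us vs))"
  unfolding elem_map_def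
proof (intro conjI allI impI)
  show "set (zip us vs) \<subseteq> elements M \<times> elements M"
    using set_tuples[OF uv(1)] set_tuples[OF uv(2)] by (auto dest: set_zip_leftD set_zip_rightD)
  fix as bs \<tau>' assume *: "pairs_in (set (zip us vs)) as bs \<and> as \<in> tuples M \<tau>'"
  have len: "length us = length \<tau>" "length vs = length \<tau>" using uv(1,2) length_tuples by auto
  obtain js where js: "as = map ((!) us) js" "bs = map ((!) vs) js" "\<And>j. j \<in> set js \<Longrightarrow> j < length us"
    using pairs_in_zip[of us vs as bs] * len by auto
  have "as \<in> tuples M (map ((!) \<tau>) js)"
    unfolding js(1) using js(3) uv(1) len by (auto simp: tuples_conv_nth)
  then have \<tau>': "\<tau>' = map ((!) \<tau>) js" using tuples_sorts_unique[OF dis] * by blast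
  show "bs \<in> tuples M \<tau>'"
    unfolding js(2) \<tau>' using js(3) uv(2) len by (auto simp: tuples_conv_nth)
  fix \<phi> assume \<phi>: "formula_in L \<tau>' \<phi>"
  obtain \<phi>' where \<phi>': "formula_in L \<tau> \<phi>'" "\<And>as. holds M \<phi>' as \<longleftrightarrow> holds M \<phi> (map ((!) as) js)"
    using formula_reindex[OF \<phi>, of js \<tau> M] js(3) len \<tau>' by auto
  show "holds M \<phi> as \<longleftrightarrow> holds M \<phi> bs"
    using uv(3)[OF \<phi>'(1)] by (simp add: \<phi>'(2) js)
qed

text \<open>Elementarity is tested on one finite tuple at a time, and each such tuple uses finitely
  many pairs.\<close>

lemma elem_map_finite_character:
  assumes "R \<subseteq> elements M \<times> elements M" "\<And>F. finite F \<Longrightarrow> F \<subseteq> R \<Longrightarrow> \<exists>R'. F \<subseteq> R' \<and> elem_map L M R'"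
  shows "elem_map L M R"
  unfolding elem_map_def
proof (intro conjI allI impI)
  fix as bs \<tau> assume *: "pairs_in R as bs \<and> as \<in> tuples M \<tau>"
  then obtain R' where R': "set (zip as bs) \<subseteq> R'" "elem_map L M R'"
    using assms(2)[of "set (zip as bs)"] by (auto simp: pairs_in_def)
  then have "pairs_in R' as bs" using * by (simp add: pairs_in_def)
  from elem_mapD[OF R'(2) this] * show "bs \<in> tuples M \<tau>"
    "\<And>\<phi>. formula_in L \<tau> \<phi> \<Longrightarrow> holds M \<phi> as \<longleftrightarrow> holds M \<phi> bs" by blast+
qed (rule assms(1))

lemma elem_map_fun:
  assumes "elem_map L M R" "(x, y) \<in> R" "(x, y') \<in> R"
  shows "y = y'"
proof -
  obtain s where s: "x \<in> univ M s" using assms(1,2) by (auto simp: elem_map_def elements_def)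
  let ?X = "{u @ v | u v. u \<in> tuples M [s] \<and> v \<in> tuples M [s] \<and> u = v}"
  have X: "definable L M {} ([s] @ [s]) ?X"
    by (intro definable_Collect2 Dp_eq[of _ _ _ _ "[s]"] tm_intros)
  have "pairs_in R ([x] @ [x]) ([y] @ [y'])" using assms(2,3) by (simp add: pairs_in_def)
  moreover have "[x] @ [x] \<in> tuples M ([s] @ [s])" using s by simp
  moreover have "[x] @ [x] \<in> ?X" using s by (intro CollectI exI[of _ "[x]"]) simp
  ultimately have "[y] @ [y'] \<in> ?X" using elem_map_definable[OF assms(1) _ _ X] by blast
  then show ?thesis by (auto simp: tuples_Cons)
qed

section \<open>Automorphisms\<close>

lemma elem_map_sort:
  assumes "elem_map L M R" "(x, y) \<in> R" "x \<in> univ M s"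
  shows "y \<in> univ M s"
  using elem_mapD(1)[OF assms(1), of "[x]" "[y]" "[s]"] assms(2,3) by (simp add: pairs_in_def)

text \<open>Preserved equality in both directions makes \<open>h\<close> a bijection on each sort.
  Compatibility with symbols is preservation of one atomic formula for each symbol, written in the
  variables numbered by position.\<close>

lemma elem_map_automorphism:
  assumes S: "lang_structure L M" and R: "elem_map L M R" "Domain R = elements M" "Range R = elements M"
    and A: "Id_on A \<subseteq> R"
  obtains h where "h \<in> automorphisms L M A" "\<And>x y. (x, y) \<in> R \<Longrightarrow> h x = y"
proof -
  define h where "h x = (THE y. (x, y) \<in> R)" for x
  have dis: "disjoint_family (univ M)" using S by (simp add: lang_structure_def)
  have h: "h x = y" if "(x, y) \<in> R" for x y
    unfolding h_def using elem_map_fun[OF R(1)] that by blast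
  have hR: "(x, h x) \<in> R" if "x \<in> elements M" for x using that R(2) h by (metis DomainE)
  have inj: "x = x'" if "(x, y) \<in> R" "(x', y) \<in> R" for x x' y
    using elem_map_fun[OF elem_map_converse[OF dis R(1)]] that by blast
  have univ: "x \<in> elements M" if "x \<in> univ M s" for x s using that by (auto simp: elements_def)
  have pairs: "pairs_in R as (map h as)" if "as \<in> tuples M \<tau>" for as \<tau>
    using set_tuples[OF that] hR nth_mem by (force simp: pairs_in_def set_zip)
  have "bij_betw h (univ M s) (univ M s)" for s
  proof (rule bij_betwI')
    fix x y assume "x \<in> univ M s" "y \<in> univ M s"
    then show "h x = h y \<longleftrightarrow> x = y" using hR univ inj by metis
  next
    fix x assume "x \<in> univ M s"
    then show "h x \<in> univ M s" using elem_map_sort[OF R(1)] hR univ by blast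
  next
    fix y assume y: "y \<in> univ M s"
    then obtain x where x: "(x, y) \<in> R" using R(3) univ by blast
    then have "x \<in> univ M s" using elem_map_sort[OF elem_map_converse[OF dis R(1)]] y by blast
    then show "\<exists>x\<in>univ M s. y = h x" using h x by blast
  qed
  moreover have "h (fint M f as) = fint M f (map h as)" if f: "f \<in> funs L" and as: "as \<in> tuples M (fargs L f)" for f as
  proof -
    let ?n = "length (fargs L f)"
    let ?vs = "map (\<lambda>i. Var (fargs L f ! i, i)) [0..<?n]"
    \<comment> \<open>The arguments occupy positions 0 to \<open>?n - 1\<close>, and the value
      stands at position \<open>?n\<close>.\<close>
    let ?\<phi> = "Eq (Fn f ?vs) (Var (fres L f, ?n))"
    let ?\<tau> = "fargs L f @ [fres L f]"
    have "list_all2 (has_sort L) ?vs (fargs L f)"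
      by (auto simp: list_all2_conv_all_nth intro: has_sort.intros)
    then have "has_sort L (Fn f ?vs) (fres L f)" using has_sort.intros(2)[OF f] by blast
    then have wf: "wf_fm L ?\<phi>" using has_sort.intros(1)[of L "fres L f"] unfolding wf_fm.simps by blast
    have "fv ?\<phi> = (\<lambda>i. (?\<tau> ! i, i)) ` {..<length ?\<tau>}"
      by (auto simp: nth_append lessThan_Suc)
    then have \<phi>: "formula_in L ?\<tau> ?\<phi>" using wf unfolding formula_in_def by blast
    have \<phi>_iff: "holds M ?\<phi> (as @ [b]) \<longleftrightarrow> fint M f as = b" if "length as = ?n" for as b
    proof -
      have "map (eval M (\<lambda>(s, i). (as @ [b]) ! i)) ?vs = as"
        using that by (auto intro!: nth_equalityI simp: nth_append)
      moreover have "(as @ [b]) ! ?n = b" by (simp flip: that)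
      ultimately show ?thesis by (simp add: holds_def del: map_map)
    qed
    have res: "fint M f as \<in> univ M (fres L f)" using S f as by (auto simp: lang_structure_def)
    let ?as = "as @ [fint M f as]"
    have "?as \<in> tuples M ?\<tau>" using as res by (auto intro: append_in_tuples)
    from elem_mapD(2)[OF R(1) pairs[OF this] this \<phi>] show ?thesis
      using length_tuples[OF as] by (simp add: \<phi>_iff)
  qed
  moreover have "rint M Q (map h as) \<longleftrightarrow> rint M Q as" if Q: "Q \<in> rels L" and as: "as \<in> tuples M (rargs L Q)" for Q as
  proof -
    let ?n = "length (rargs L Q)"
    let ?vs = "map (\<lambda>i. Var (rargs L Q ! i, i)) [0..<?n]"
    let ?\<phi> = "Rel Q ?vs"
    have "list_all2 (has_sort L) ?vs (rargs L Q)"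
      by (auto simp: list_all2_conv_all_nth intro: has_sort.intros)
    then have wf: "wf_fm L ?\<phi>" using Q by simp
    have "fv ?\<phi> = (\<lambda>i. (rargs L Q ! i, i)) ` {..<?n}" by auto
    then have \<phi>: "formula_in L (rargs L Q) ?\<phi>" using wf unfolding formula_in_def by blast
    have \<phi>_iff: "holds M ?\<phi> as \<longleftrightarrow> rint M Q as" if "length as = ?n" for as
    proof -
      have "map (eval M (\<lambda>(s, i). as ! i)) ?vs = as"
        using that by (auto intro!: nth_equalityI)
      then show ?thesis using that by (simp add: holds_def del: map_map)
    qed
    from elem_mapD(2)[OF R(1) pairs[OF as] as \<phi>] show ?thesis
      using length_tuples[OF as] by (simp add: \<phi>_iff)
  qed
  moreover have "h a = a" if "a \<in> A" for a using h A that by blast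
  ultimately have "h \<in> automorphisms L M A" by (simp add: automorphisms_def)
  then show thesis using that h by blast
qed

lemma automorphism_univ: "h \<in> automorphisms L M A \<Longrightarrow> a \<in> univ M s \<Longrightarrow> h a \<in> univ M s"
  by (auto simp: automorphisms_def bij_betw_def)

lemma automorphism_tuples: "h \<in> automorphisms L M A \<Longrightarrow> as \<in> tuples M \<sigma> \<Longrightarrow> map h as \<in> tuples M \<sigma>"
  by (auto simp: tuples_conv_nth automorphism_univ)

lemma eval_automorphism:
  assumes S: "lang_structure L M" and h: "h \<in> automorphisms L M A" and "has_sort L t s"
    and "\<And>v. v \<in> tvars t \<Longrightarrow> e v \<in> univ M (fst v)"
  shows "eval M e t \<in> univ M s \<and> h (eval M e t) = eval M (\<lambda>v. h (e v)) t"
  using assms(3,4)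
proof (induction rule: has_sort.induct)
  case (1 s i)
  then show ?case by force
next
  case (2 f ts)
  have *: "list_all2 (\<lambda>t s. eval M e t \<in> univ M s \<and> h (eval M e t) = eval M (\<lambda>v. h (e v)) t) ts (fargs L f)"
    unfolding list_all2_conv_all_nth
  proof (intro conjI allI impI)
    show "length ts = length (fargs L f)" using 2(2) list_all2_lengthD by blast
    fix i assume i: "i < length ts"
    then have "\<And>v. v \<in> tvars (ts ! i) \<Longrightarrow> e v \<in> univ M (fst v)"
      using 2(3) nth_mem by (metis UN_I tvars.simps(2) set_map)
    with list_all2_nthD[OF 2(2) i]
    show "eval M e (ts ! i) \<in> univ M (fargs L f ! i)"
      "h (eval M e (ts ! i)) = eval M (\<lambda>v. h (e v)) (ts ! i)" by blast+
  qed
  then have "map (eval M e) ts \<in> tuples M (fargs L f)"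
    by (auto simp: tuples_def list_all2_map1 elim: list_all2_mono)
  moreover have "map h (map (eval M e) ts) = map (eval M (\<lambda>v. h (e v))) ts"
    using * by (auto simp: list_all2_conv_all_nth in_set_conv_nth)
  ultimately show ?case using S h 2(1) by (simp add: lang_structure_def automorphisms_def del: map_map)
qed

text \<open>Values of the right sort are demanded at free variables only, because the assignment
  that \<open>holds\<close> builds from a tuple ignores the sort component of a variable.\<close>

lemma sat_automorphism:
  assumes S: "lang_structure L M" and h: "h \<in> automorphisms L M A" and "wf_fm L \<phi>"
    and "\<And>v. v \<in> fv \<phi> \<Longrightarrow> e v \<in> univ M (fst v)"
  shows "sat M (\<lambda>v. h (e v)) \<phi> \<longleftrightarrow> sat M e \<phi>"
  using assms(3,4)
proof (induction \<phi> arbitrary: e)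
  case (Eq t u)
  then obtain s where s: "has_sort L t s" "has_sort L u s" by auto
  have "eval M e t \<in> univ M s \<and> h (eval M e t) = eval M (\<lambda>v. h (e v)) t"
    by (rule eval_automorphism[OF S h s(1)]) (use Eq in auto)
  moreover have "eval M e u \<in> univ M s \<and> h (eval M e u) = eval M (\<lambda>v. h (e v)) u"
    by (rule eval_automorphism[OF S h s(2)]) (use Eq in auto)
  moreover have "inj_on h (univ M s)" using h by (auto simp: automorphisms_def bij_betw_def)
  ultimately show ?case unfolding sat.simps by (metis inj_onD)
next
  case (Rel Q ts)
  have *: "list_all2 (\<lambda>t s. eval M e t \<in> univ M s \<and> h (eval M e t) = eval M (\<lambda>v. h (e v)) t) ts (rargs L Q)"
    unfolding list_all2_conv_all_nth
  proof (intro conjI allI impI)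
    have l: "list_all2 (has_sort L) ts (rargs L Q)" using Rel by simp
    show "length ts = length (rargs L Q)" using l list_all2_lengthD by blast
    fix i assume i: "i < length ts"
    then have "\<And>v. v \<in> tvars (ts ! i) \<Longrightarrow> e v \<in> univ M (fst v)"
      using Rel(2) nth_mem by (metis UN_I fv.simps(3) set_map)
    from eval_automorphism[OF S h list_all2_nthD[OF l i] this]
    show "eval M e (ts ! i) \<in> univ M (rargs L Q ! i)"
      "h (eval M e (ts ! i)) = eval M (\<lambda>v. h (e v)) (ts ! i)" by blast+
  qed
  then have "map (eval M e) ts \<in> tuples M (rargs L Q)"
    by (auto simp: tuples_def list_all2_map1 elim: list_all2_mono)
  moreover have "map h (map (eval M e) ts) = map (eval M (\<lambda>v. h (e v))) ts"
    using * by (auto simp: list_all2_conv_all_nth in_set_conv_nth)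
  ultimately show ?case using h Rel(1) by (simp add: automorphisms_def del: map_map) metis
next
  case (Imp \<phi>1 \<phi>2)
  then show ?case by simp
next
  case (All v \<phi>)
  have img: "h ` univ M (fst v) = univ M (fst v)" using h by (auto simp: automorphisms_def bij_betw_def)
  have "sat M ((\<lambda>u. h (e u))(v := h a)) \<phi> \<longleftrightarrow> sat M (e(v := a)) \<phi>" if "a \<in> univ M (fst v)" for a
  proof -
    have "(\<lambda>u. h (e u))(v := h a) = (\<lambda>u. h ((e(v := a)) u))" by auto
    moreover have "u \<in> fv \<phi> \<Longrightarrow> (e(v := a)) u \<in> univ M (fst u)" for u
      using All.prems(2)[of u] that by (cases "u = v") simp_all
    ultimately show ?thesis using All.IH[of "e(v := a)"] All.prems(1) by (simp only: wf_fm.simps)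
  qed
  moreover have "(\<forall>a\<in>h ` univ M (fst v). sat M ((\<lambda>u. h (e u))(v := a)) \<phi>) \<longleftrightarrow>
      (\<forall>a\<in>univ M (fst v). sat M ((\<lambda>u. h (e u))(v := h a)) \<phi>)"
    by blast
  ultimately show ?case by (simp only: sat.simps img) blast
qed auto

lemma automorphism_definable:
  assumes S: "lang_structure L M" and h: "h \<in> automorphisms L M A" and X: "definable L M A \<sigma> X"
    and a: "a \<in> tuples M \<sigma>"
  shows "map h a \<in> X \<longleftrightarrow> a \<in> X"
proof -
  obtain \<phi> bs \<tau> where *: "bs \<in> tuples M \<tau>" "set bs \<subseteq> A" "formula_in L (\<sigma> @ \<tau>) \<phi>"
     "X = {as \<in> tuples M \<sigma>. holds M \<phi> (as @ bs)}"
    using X unfolding definable_iff_formula by blast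
  have "map h bs = bs" using *(2) h by (intro map_idI) (auto simp: automorphisms_def)
  then have eq: "map h a @ bs = map h (a @ bs)" by simp
  have ab: "a @ bs \<in> tuples M (\<sigma> @ \<tau>)" using a *(1) by (rule append_in_tuples)
  have wf: "wf_fm L \<phi>" and fv: "fv \<phi> \<subseteq> {((\<sigma> @ \<tau>) ! i, i) | i. i < length (\<sigma> @ \<tau>)}"
    using *(3) by (auto simp: formula_in_def)
  have "holds M \<phi> (map h (a @ bs)) \<longleftrightarrow> sat M (\<lambda>v. h ((\<lambda>(s, i). (a @ bs) ! i) v)) \<phi>"
    unfolding holds_def using fv length_tuples[OF ab] by (intro sat_cong) (auto simp del: map_append)
  also have "\<dots> \<longleftrightarrow> holds M \<phi> (a @ bs)"
    unfolding holds_def using fv ab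
    by (intro sat_automorphism[OF S h wf]) (fastforce simp: tuples_conv_nth simp del: length_append)
  finally show ?thesis using a automorphism_tuples[OF h a] by (simp add: *(4) eq del: map_append)
qed

section \<open>Powers of a definable set\<close>

definition power_sort :: "'s list \<Rightarrow> nat \<Rightarrow> 's list" where
  "power_sort \<gamma> n = concat (replicate n \<gamma>)"

text \<open>Finitely many parameters from \<open>C\<close> are collected in one flat tuple of
  members of \<open>C\<close>. Quantifying over them is then quantifying over a definable
  set.\<close>

definition power_set :: "'m list set \<Rightarrow> nat \<Rightarrow> 'm list set" where
  "power_set C n = {concat cs | cs. length cs = n \<and> set cs \<subseteq> C}"

lemma power_set_0: "power_set C 0 = {[]}"
  by (auto simp: power_set_def)

lemma power_set_Suc: "power_set C (Suc n) = {c @ d | c d. c \<in> C \<and> d \<in> power_set C n}"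
proof (intro equalityI subsetI)
  fix x assume "x \<in> power_set C (Suc n)"
  then obtain cs where "x = concat cs" "length cs = Suc n" "set cs \<subseteq> C" by (auto simp: power_set_def)
  then show "x \<in> {c @ d | c d. c \<in> C \<and> d \<in> power_set C n}"
    by (cases cs) (auto simp: power_set_def)
next
  fix x assume "x \<in> {c @ d | c d. c \<in> C \<and> d \<in> power_set C n}"
  then obtain c cs where "x = concat (c # cs)" "length (c # cs) = Suc n" "set (c # cs) \<subseteq> C"
    by (auto simp: power_set_def)
  then show "x \<in> power_set C (Suc n)" unfolding power_set_def by blast
qed

lemma definable_power_set:
  assumes "definable L M B \<gamma> C"
  shows "definable L M B (power_sort \<gamma> n) (power_set C n)"
proof (induction n)
  case 0
  show ?case using definable_tuples[of L M B "[]"] by (simp add: power_sort_def power_set_0)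
next
  case (Suc n)
  have "definable L M B (\<gamma> @ power_sort \<gamma> n) {c @ d | c d. c \<in> tuples M \<gamma> \<and> d \<in> tuples M (power_sort \<gamma> n) \<and>
      (c \<in> C \<and> d \<in> power_set C n)}"
    by (intro definable_Collect2 Dp_conj Dp_in[OF assms] Dp_in[OF Suc] tm_intros) auto
  moreover have "{c @ d | c d. c \<in> tuples M \<gamma> \<and> d \<in> tuples M (power_sort \<gamma> n) \<and> (c \<in> C \<and> d \<in> power_set C n)}
      = power_set C (Suc n)"
    unfolding power_set_Suc using definable_sub[OF assms] definable_sub[OF Suc] by blast
  ultimately show ?case by (simp add: power_sort_def)
qed

lemma coords_power_set: "c \<in> power_set C n \<Longrightarrow> set c \<subseteq> coords C"
  unfolding power_set_def coords_def by fastforce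

lemma finite_coords_power_set:
  assumes "finite Z" "Z \<subseteq> coords C"
  obtains n c where "c \<in> power_set C n" "Z \<subseteq> set c"
proof -
  have "\<forall>z\<in>Z. \<exists>c\<in>C. z \<in> set c" using assms(2) by (auto simp: coords_def)
  then obtain f where f: "\<And>z. z \<in> Z \<Longrightarrow> f z \<in> C \<and> z \<in> set (f z)" by metis
  obtain zs where zs: "set zs = Z" using assms(1) finite_list by blast
  show thesis
  proof
    show "concat (map f zs) \<in> power_set C (length zs)"
      using f zs by (auto simp: power_set_def intro!: exI[of _ "map f zs"])
    show "Z \<subseteq> set (concat (map f zs))" using f zs by auto
  qed
qed

section \<open>Back and forth\<close>

text \<open>\<open>X'\<close> is what the elementary map makes of \<open>X\<close>: the parameters
  \<open>as\<close> are replaced by their images \<open>bs\<close>. The images are confined to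
  \<open>A\<close>, so that saturation over a small \<open>A\<close> applies to
  \<open>X'\<close>.\<close>

definition corresponding ::
  "('f, 'r, 's) lang \<Rightarrow> ('f, 'r, 's, 'm) struct \<Rightarrow> ('m \<times> 'm) set \<Rightarrow> 'm set \<Rightarrow> 's list
    \<Rightarrow> 'm list set \<Rightarrow> 'm list set \<Rightarrow> bool" where
  "corresponding L M R A \<sigma> X X' \<longleftrightarrow> (\<exists>\<tau> as bs Y. pairs_in R as bs \<and> as \<in> tuples M \<tau> \<and> bs \<in> tuples M \<tau> \<and> set bs \<subseteq> A \<and>
     definable L M {} (\<sigma> @ \<tau>) Y \<and> X = {x \<in> tuples M \<sigma>. x @ as \<in> Y} \<and> X' = {x \<in> tuples M \<sigma>. x @ bs \<in> Y})"

lemma corresponding_Dp: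
  assumes "Dp L M {} (\<sigma> # \<Gamma>) P" "e \<in> envs M \<Gamma>" "e' \<in> envs M \<Gamma>"
    "pairs_in R (concat e) (concat e')" "set (concat e') \<subseteq> A"
  shows "corresponding L M R A \<sigma> {x \<in> tuples M \<sigma>. P (x # e)} {x \<in> tuples M \<sigma>. P (x # e')}"
proof -
  obtain Y where Y: "definable L M {} (\<sigma> @ concat \<Gamma>) Y" "\<And>e. e \<in> envs M (\<sigma> # \<Gamma>) \<Longrightarrow> P e \<longleftrightarrow> concat e \<in> Y"
    using definable_of_Dp[OF assms(1)] by auto
  have eq: "P (x # u) \<longleftrightarrow> x @ concat u \<in> Y" if "u \<in> envs M \<Gamma>" "x \<in> tuples M \<sigma>" for u x
    using Y(2)[of "x # u"] that by simp
  show ?thesis unfolding corresponding_def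
  proof (intro exI conjI)
    show "pairs_in R (concat e) (concat e')" by fact
    show "concat e \<in> tuples M (concat \<Gamma>)" "concat e' \<in> tuples M (concat \<Gamma>)"
      using assms(2,3) by (auto intro: concat_in_tuples)
    show "set (concat e') \<subseteq> A" by fact
    show "definable L M {} (\<sigma> @ concat \<Gamma>) Y" by fact
    show "{x \<in> tuples M \<sigma>. P (x # e)} = {x \<in> tuples M \<sigma>. x @ concat e \<in> Y}"
      "{x \<in> tuples M \<sigma>. P (x # e')} = {x \<in> tuples M \<sigma>. x @ concat e' \<in> Y}"
      using eq[OF assms(2)] eq[OF assms(3)] by blast+
  qed
qed

lemma corresponding_Int:
  assumes "corresponding L M R A \<sigma> X1 X1'" "corresponding L M R A \<sigma> X2 X2'"
  shows "corresponding L M R A \<sigma> (X1 \<inter> X2) (X1' \<inter> X2')"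
proof -
  obtain \<tau>1 as1 bs1 Y1 where 1: "pairs_in R as1 bs1" "as1 \<in> tuples M \<tau>1" "bs1 \<in> tuples M \<tau>1" "set bs1 \<subseteq> A"
     "definable L M {} (\<sigma> @ \<tau>1) Y1" "X1 = {x \<in> tuples M \<sigma>. x @ as1 \<in> Y1}" "X1' = {x \<in> tuples M \<sigma>. x @ bs1 \<in> Y1}"
    using assms(1) unfolding corresponding_def by blast
  obtain \<tau>2 as2 bs2 Y2 where 2: "pairs_in R as2 bs2" "as2 \<in> tuples M \<tau>2" "bs2 \<in> tuples M \<tau>2" "set bs2 \<subseteq> A"
     "definable L M {} (\<sigma> @ \<tau>2) Y2" "X2 = {x \<in> tuples M \<sigma>. x @ as2 \<in> Y2}" "X2' = {x \<in> tuples M \<sigma>. x @ bs2 \<in> Y2}"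
    using assms(2) unfolding corresponding_def by blast
  have "Dp L M {} [\<sigma>, \<tau>1, \<tau>2] (\<lambda>e. hd e @ hd (tl e) \<in> Y1 \<and> hd e @ hd (tl (tl e)) \<in> Y2)"
    by (intro Dp_conj Dp_in[OF 1(5)] Dp_in[OF 2(5)] tm_intros) auto
  from corresponding_Dp[OF this, of "[as1, as2]" "[bs1, bs2]" R A]
  have "corresponding L M R A \<sigma> {x \<in> tuples M \<sigma>. x @ as1 \<in> Y1 \<and> x @ as2 \<in> Y2} {x \<in> tuples M \<sigma>. x @ bs1 \<in> Y1 \<and> x @ bs2 \<in> Y2}"
    using 1 2 by (simp add: pairs_in_append)
  moreover have "{x \<in> tuples M \<sigma>. x @ as1 \<in> Y1 \<and> x @ as2 \<in> Y2} = X1 \<inter> X2"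
    "{x \<in> tuples M \<sigma>. x @ bs1 \<in> Y1 \<and> x @ bs2 \<in> Y2} = X1' \<inter> X2'" using 1(6,7) 2(6,7) by auto
  ultimately show ?thesis by simp
qed

lemma corresponding_tuples: "corresponding L M R A \<sigma> (tuples M \<sigma>) (tuples M \<sigma>)"
  using corresponding_Dp[OF Dp_True, of "[]" M "[]" "[]" R A L \<sigma>] by (simp add: pairs_in_Nil)

lemma corresponding_definable:
  assumes "corresponding L M R A \<sigma> X X'"
  shows "definable L M A \<sigma> X'"
proof -
  obtain \<tau> bs Y where "bs \<in> tuples M \<tau>" "set bs \<subseteq> A" "definable L M {} (\<sigma> @ \<tau>) Y"
     "X' = {x \<in> tuples M \<sigma>. x @ bs \<in> Y}"
    using assms unfolding corresponding_def by blast
  then show ?thesis using definable_mono[OF definable_push[of L M "{}" \<sigma> \<tau> Y bs], of A] by simp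
qed

text \<open>That a fibre of \<open>Y\<close> is nonempty is itself a condition on the parameters,
  definable without further ones, and so passes from \<open>as\<close> to \<open>bs\<close>.\<close>

lemma corresponding_nonempty:
  assumes "elem_map L M R" "corresponding L M R A \<sigma> X X'" "X \<noteq> {}"
  shows "X' \<noteq> {}"
proof -
  obtain \<tau> as bs Y where *: "pairs_in R as bs" "as \<in> tuples M \<tau>" "bs \<in> tuples M \<tau>" "set bs \<subseteq> A"
     "definable L M {} (\<sigma> @ \<tau>) Y" "X = {x \<in> tuples M \<sigma>. x @ as \<in> Y}" "X' = {x \<in> tuples M \<sigma>. x @ bs \<in> Y}"
    using assms(2) unfolding corresponding_def by blast
  have "definable L M {} \<tau> {y \<in> tuples M \<tau>. \<exists>x\<in>tuples M \<sigma>. x @ y \<in> Y}"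
    by (intro definable_Collect Dp_ex Dp_in[OF *(5)] tm_intros) auto
  from elem_map_definable[OF assms(1) *(1,2) this] show ?thesis
    using assms(3) *(2,3,6,7) by auto
qed

lemma corresponding_Inter:
  assumes "finite \<F>" "\<And>X'. X' \<in> \<F> \<Longrightarrow> \<exists>X. corresponding L M R A \<sigma> X X' \<and> d \<in> X" "d \<in> tuples M \<sigma>"
  shows "\<exists>X. corresponding L M R A \<sigma> X {x \<in> tuples M \<sigma>. \<forall>X'\<in>\<F>. x \<in> X'} \<and> d \<in> X"
  using assms(1,2)
proof (induction \<F>)
  case empty
  then show ?case using corresponding_tuples[of L M R A \<sigma>] assms(3) by auto
next
  case (insert X' \<F>)
  obtain X1 where X1: "corresponding L M R A \<sigma> X1 {x \<in> tuples M \<sigma>. \<forall>X'\<in>\<F>. x \<in> X'}" "d \<in> X1"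
    using insert.IH insert.prems by blast
  obtain X2 where X2: "corresponding L M R A \<sigma> X2 X'" "d \<in> X2" using insert.prems by blast
  have "{x \<in> tuples M \<sigma>. \<forall>X'\<in>\<F>. x \<in> X'} \<inter> X' = {x \<in> tuples M \<sigma>. \<forall>X'\<in>insert X' \<F>. x \<in> X'}" by auto
  then show ?case using corresponding_Int[OF X1(1) X2(1)] X1(2) X2(2) by auto
qed

lemma finite_ordLeq_infinite: "finite X \<Longrightarrow> infinite Y \<Longrightarrow> |X| \<le>o |Y|"
  by (meson card_of_Well_order card_of_ordLeq_finite ordLeq_total)

text \<open>A formula does not determine its context \<upsilon>, so the pair is coded as one
  formula: a trivial equation for each sort in \<upsilon>, then \<phi> behind the end marker
  \<open>Bot\<close>, which cannot be mistaken for an equation.\<close>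

lemma card_sorted_formulas: "|{(\<upsilon>, \<phi>). formula_in L (s # \<upsilon>) \<phi>}| \<le>o |{\<phi>. wf_fm L \<phi>}|"
proof (rule card_of_ordLeqI)
  let ?g = "\<lambda>(\<upsilon>, \<phi>). foldr (\<lambda>s \<psi>. Imp (Eq (Var (s, 0)) (Var (s, 0))) \<psi>) \<upsilon> (Imp Bot \<phi>)"
  show "inj_on ?g {(\<upsilon>, \<phi>). formula_in L (s # \<upsilon>) \<phi>}"
  proof (rule inj_onI)
    fix x y assume "?g x = ?g y"
    then show "x = y"
    proof (induction "fst x" arbitrary: x y)
      case Nil
      then show ?case by (cases x; cases y; cases "fst y") auto
    next
      case (Cons s \<upsilon>)
      obtain \<phi> where x: "x = (s # \<upsilon>, \<phi>)" using Cons(2) by (metis prod.collapse)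
      obtain \<upsilon>' \<psi> where y: "y = (s # \<upsilon>', \<psi>)" using Cons(3) x by (cases y; cases "fst y") auto
      then show ?case using Cons(1)[of "(\<upsilon>, \<phi>)" "(\<upsilon>', \<psi>)"] Cons(3) x by simp
    qed
  qed
  fix x assume "x \<in> {(\<upsilon>, \<phi>). formula_in L (s # \<upsilon>) \<phi>}"
  then obtain \<upsilon> \<phi> where "x = (\<upsilon>, \<phi>)" "wf_fm L \<phi>" by (auto simp: formula_in_def)
  moreover have "wf_fm L (foldr (\<lambda>s \<psi>. Imp (Eq (Var (s, 0)) (Var (s, 0))) \<psi>) \<upsilon> (Imp Bot \<phi>))"
    using \<open>wf_fm L \<phi>\<close> by (induction \<upsilon>) (auto intro: has_sort.intros)
  ultimately show "?g x \<in> {\<phi>. wf_fm L \<phi>}" by simp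
qed

text \<open>Extending \<open>R\<close> to \<open>d\<close> means realizing the image of the type of
  \<open>d\<close> over \<open>Domain R\<close>, which contains the possibly large
  \<open>coords C\<close>. For each formula with sorted context \<open>j\<close>, definability of
  types replaces truth at \<open>d\<close> by membership in \<open>\<Psi> j\<close> with parameters
  \<open>e j\<close>. After transport by \<open>R\<close> the parameters from \<open>C\<close> are
  unchanged and can be quantified.\<close>

lemma elem_map_extend:
  assumes S: "lang_structure L M" and ss: "sufficiently_saturated L M \<kappa>" and tt: "totally_transcendental L M"
    and C: "definable L M B \<gamma> C"
    and R: "R = Id_on (coords C) \<union> S" "elem_map L M R" "Id_on B \<subseteq> S" "|S| <o \<kappa>" and d: "d \<in> elements M"
  obtains d' where "elem_map L M (insert (d, d') R)"
proof -
  have dis: "disjoint_family (univ M)" using S by (simp add: lang_structure_def)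
  have Card: "Card_order \<kappa>" "|{\<phi>. wf_fm L \<phi>}| <o \<kappa>" "saturated L M \<kappa>"
    using ss by (auto simp: sufficiently_saturated_def)
  obtain s where s: "d \<in> univ M s" using d by (auto simp: elements_def)
  have RE: "R \<subseteq> elements M \<times> elements M" using R(2) by (simp add: elem_map_def)
  have D: "Domain R \<subseteq> elements M" using RE by auto
  define F where "F j = {x \<in> tuples M (s # fst j). holds M (snd j) x}" for j
  let ?J = "{(\<upsilon>, \<phi>). formula_in L (s # \<upsilon>) \<phi>}"
  have F: "definable L M {} ([s] @ fst j) (F j)" if "j \<in> ?J" for j
    using that definable_formula[of L "s # fst j" "snd j" M "{}"] by (auto simp: F_def)
  have "\<forall>j\<in>?J. \<exists>h. case h of (e, e', \<xi>, \<Psi>) \<Rightarrow> e \<in> tuples M \<xi> \<and> e' \<in> tuples M \<xi> \<and> pairs_in R e e' \<and> definable L M {} (fst j @ \<xi>) \<Psi> \<and>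
     (\<forall>y\<in>tuples M (fst j). set y \<subseteq> Domain R \<longrightarrow> (d # y \<in> F j \<longleftrightarrow> y @ e \<in> \<Psi>))"
  proof
    fix j assume j: "j \<in> ?J"
    have "[d] \<in> tuples M [s]" using s by simp
    then obtain T where T: "definable L M (Domain R) (fst j) T"
      "\<And>y. y \<in> tuples M (fst j) \<Longrightarrow> set y \<subseteq> Domain R \<Longrightarrow> [d] @ y \<in> F j \<longleftrightarrow> y \<in> T"
      using type_definable[OF ss tt F[OF j] D] by blast
    obtain e \<xi> \<Psi> where e: "e \<in> tuples M \<xi>" "set e \<subseteq> Domain R" "definable L M {} (fst j @ \<xi>) \<Psi>"
      "T = {x \<in> tuples M (fst j). x @ e \<in> \<Psi>}" using definable_params[OF T(1)] by blast
    obtain e' where e': "pairs_in R e e'" using pairs_in_ex[OF e(2)] by blast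
    then show "\<exists>h. case h of (e, e', \<xi>, \<Psi>) \<Rightarrow> e \<in> tuples M \<xi> \<and> e' \<in> tuples M \<xi> \<and> pairs_in R e e' \<and> definable L M {} (fst j @ \<xi>) \<Psi> \<and>
     (\<forall>y\<in>tuples M (fst j). set y \<subseteq> Domain R \<longrightarrow> (d # y \<in> F j \<longleftrightarrow> y @ e \<in> \<Psi>))"
      using e T(2) elem_mapD(1)[OF R(2) e' e(1)] by (intro exI[of _ "(e, e', \<xi>, \<Psi>)"]) auto
  qed
  from bchoice[OF this] obtain H where H: "\<forall>j\<in>?J. case H j of (e, e', \<xi>, \<Psi>) \<Rightarrow> e \<in> tuples M \<xi> \<and> e' \<in> tuples M \<xi> \<and> pairs_in R e e' \<and>
      definable L M {} (fst j @ \<xi>) \<Psi> \<and>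
     (\<forall>y\<in>tuples M (fst j). set y \<subseteq> Domain R \<longrightarrow> (d # y \<in> F j \<longleftrightarrow> y @ e \<in> \<Psi>))"
    by (elim exE)
  define e where "e j = fst (H j)" for j
  define e' where "e' j = fst (snd (H j))" for j
  define \<xi> where "\<xi> j = fst (snd (snd (H j)))" for j
  define \<Psi> where "\<Psi> j = snd (snd (snd (H j)))" for j
  have e: "e j \<in> tuples M (\<xi> j)" "e' j \<in> tuples M (\<xi> j)" "pairs_in R (e j) (e' j)"
     "definable L M {} (fst j @ \<xi> j) (\<Psi> j)"
     "\<And>y. y \<in> tuples M (fst j) \<Longrightarrow> set y \<subseteq> Domain R \<Longrightarrow> d # y \<in> F j \<longleftrightarrow> y @ e j \<in> \<Psi> j" if "j \<in> ?J" for j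
    using bspec[OF H that] unfolding e_def e'_def \<xi>_def \<Psi>_def case_prod_beta by blast+
  \<comment> \<open>\<open>A\<close> holds the images of the pairs outside the identity on
    \<open>C\<close>, and one finite tuple \<open>e' j\<close> for each formula. Both parts are
    small.\<close>
  define A where "A = Range S \<union> (\<Union>j\<in>?J. set (e' j))"
  have A_sub: "A \<subseteq> elements M"
    using RE R(1) pairs_in_subsets(2)[OF e(3)] unfolding A_def by blast
  have A_card: "|A| <o \<kappa>"
  proof -
    have "|snd ` S| \<le>o |S|" by (rule card_of_image)
    then have "|Range S| <o \<kappa>" using R(4) by (metis Range_snd ordLeq_ordLess_trans)
    moreover have "|\<Union>j\<in>?J. set (e' j)| \<le>o |{\<phi>. wf_fm L \<phi>}|"
    proof (rule card_of_UNION_ordLeq_infinite[OF infinite_formulas card_sorted_formulas], intro ballI)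
      fix j
      show "|set (e' j)| \<le>o |{\<phi>. wf_fm L \<phi>}|" by (rule finite_ordLeq_infinite[OF finite_set infinite_formulas])
    qed
    then have "|\<Union>j\<in>?J. set (e' j)| <o \<kappa>" using Card(2) by (rule ordLeq_ordLess_trans)
    ultimately show ?thesis unfolding A_def
      by (intro card_of_Un_ordLess_infinite_Field sufficiently_saturated_infinite[OF ss] Card(1))
  qed
  have BA: "B \<subseteq> A" using R(3) by (auto simp: A_def)
  \<comment> \<open>A single condition covers all \<open>c\<close> from the power of
    \<open>C\<close>, in place of one condition for each \<open>c\<close>.\<close>
  define X where "X j n bs u = {x \<in> tuples M [s]. \<forall>c\<in>power_set C n. x @ bs @ c \<in> F j \<longleftrightarrow> bs @ c @ u \<in> \<Psi> j}" for j n bs u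
  define \<F> where "\<F> = {X (\<tau> @ power_sort \<gamma> n, \<phi>) n bs (e' (\<tau> @ power_sort \<gamma> n, \<phi>)) | \<tau> n \<phi> as bs.
     formula_in L (s # \<tau> @ power_sort \<gamma> n) \<phi> \<and> pairs_in S as bs \<and> as \<in> tuples M \<tau>}"
  have corr: "\<exists>X. corresponding L M R A [s] X X' \<and> [d] \<in> X" if "X' \<in> \<F>" for X'
  proof -
    obtain \<tau> n \<phi> as bs j where j: "j = (\<tau> @ power_sort \<gamma> n, \<phi>)" and X': "X' = X j n bs (e' j)"
      and \<phi>: "formula_in L (s # \<tau> @ power_sort \<gamma> n) \<phi>" and as: "pairs_in S as bs" "as \<in> tuples M \<tau>"
      using \<open>X' \<in> \<F>\<close> unfolding \<F>_def by blast
    have jJ: "j \<in> ?J" using j \<phi> by simp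
    have asR: "pairs_in R as bs" using pairs_in_mono[OF as(1)] R(1) by blast
    have bs: "bs \<in> tuples M \<tau>" using elem_mapD(1)[OF R(2) asR as(2)] .
    \<comment> \<open>The power of \<open>C\<close> is defined over \<open>B\<close>. Its parameters
      \<open>b\<close> are fixed by \<open>R\<close>, so the quantifier over \<open>c\<close> keeps
      its range under transport.\<close>
    obtain b \<beta> Z where b: "b \<in> tuples M \<beta>" "set b \<subseteq> B" "definable L M {} (power_sort \<gamma> n @ \<beta>) Z"
      "power_set C n = {x \<in> tuples M (power_sort \<gamma> n). x @ b \<in> Z}"
      using definable_params[OF definable_power_set[OF C]] by blast
    let ?P = "\<lambda>e. \<forall>c\<in>tuples M (power_sort \<gamma> n). c @ hd (tl (tl (tl e))) \<in> Z \<longrightarrow>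
      (hd e @ hd (tl e) @ c \<in> F j \<longleftrightarrow> hd (tl e) @ c @ hd (tl (tl e)) \<in> \<Psi> j)"
    have F': "definable L M {} ([s] @ \<tau> @ power_sort \<gamma> n) (F j)" using F[OF jJ] j by simp
    have \<Psi>': "definable L M {} (\<tau> @ power_sort \<gamma> n @ \<xi> j) (\<Psi> j)" using e(4)[OF jJ] j by simp
    have P: "Dp L M {} ([s] # [\<tau>, \<xi> j, \<beta>]) ?P"
      by (intro Dp_all Dp_imp Dp_iff Dp_in[OF b(3)] Dp_in[OF F'] Dp_in[OF \<Psi>'] tm_intros) auto
    have bb: "pairs_in R b b" using b(2) R(1,3) by (intro pairs_in_Id) blast
    have "corresponding L M R A [s] {x \<in> tuples M [s]. ?P (x # [as, e j, b])} {x \<in> tuples M [s]. ?P (x # [bs, e' j, b])}"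
    proof (rule corresponding_Dp[OF P])
      show "[as, e j, b] \<in> envs M [\<tau>, \<xi> j, \<beta>]" "[bs, e' j, b] \<in> envs M [\<tau>, \<xi> j, \<beta>]"
        using as bs e(1,2)[OF jJ] b(1) by auto
      show "pairs_in R (concat [as, e j, b]) (concat [bs, e' j, b])"
        using asR e(3)[OF jJ] bb by (simp add: pairs_in_append)
      show "set (concat [bs, e' j, b]) \<subseteq> A"
        using pairs_in_subsets(2)[OF as(1)] jJ BA b(2) unfolding A_def by auto
    qed
    moreover have "{x \<in> tuples M [s]. ?P (x # [bs, e' j, b])} = X'"
      unfolding X' X_def b(4) by auto
    moreover have "[d] \<in> {x \<in> tuples M [s]. ?P (x # [as, e j, b])}"
    proof -
      have "[d] @ as @ c \<in> F j \<longleftrightarrow> as @ c @ e j \<in> \<Psi> j" if c: "c \<in> power_set C n" for c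
      proof -
        have "as @ c \<in> tuples M (fst j)"
          using as(2) c definable_sub[OF definable_power_set[OF C]] j by (auto intro: append_in_tuples)
        moreover have "set (as @ c) \<subseteq> Domain R"
          using pairs_in_subsets(1)[OF asR] coords_power_set[OF c] R(1) by auto
        ultimately show ?thesis using e(5)[OF jJ] by simp
      qed
      then show ?thesis using s b(4) by auto
    qed
    ultimately show ?thesis by auto
  qed
  have "\<exists>x\<in>tuples M [s]. \<forall>X'\<in>\<F>. x \<in> X'"
  proof (rule saturated_Inter[OF Card(3) A_sub A_card])
    show "definable L M A [s] X'" if "X' \<in> \<F>" for X' using corr[OF that] corresponding_definable by blast
    fix \<F>' assume "finite \<F>'" "\<F>' \<subseteq> \<F>"
    then obtain X where "corresponding L M R A [s] X {x \<in> tuples M [s]. \<forall>X'\<in>\<F>'. x \<in> X'}" "[d] \<in> X"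
      using corresponding_Inter[of \<F>' L M R A "[s]" "[d]"] corr s by auto
    then have "{x \<in> tuples M [s]. \<forall>X'\<in>\<F>'. x \<in> X'} \<noteq> {}" using corresponding_nonempty[OF R(2)] by blast
    then show "\<exists>x\<in>tuples M [s]. \<forall>X'\<in>\<F>'. x \<in> X'" by blast
  qed
  then obtain d' where d': "d' \<in> univ M s" "\<And>X'. X' \<in> \<F> \<Longrightarrow> [d'] \<in> X'" by (auto simp: tuples_Cons)
  have "elem_map L M (insert (d, d') R)"
  proof (rule elem_map_finite_character)
    show "insert (d, d') R \<subseteq> elements M \<times> elements M" using RE d d'(1) by (auto simp: elements_def)
    fix G assume G: "finite G" "G \<subseteq> insert (d, d') R"
    \<comment> \<open>A finite part of the new map is covered by the pair \<open>(d, d')\<close>, a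
      list of pairs from \<open>S\<close>, and the identity on one tuple \<open>c\<close> from a
      power of \<open>C\<close>.\<close>
    obtain zs where zs: "set zs = G \<inter> S" using G(1) finite_list by blast
    have "finite (fst ` (G \<inter> Id_on (coords C)))" "fst ` (G \<inter> Id_on (coords C)) \<subseteq> coords C" using G(1) by auto
    then obtain n c where c: "c \<in> power_set C n" "fst ` (G \<inter> Id_on (coords C)) \<subseteq> set c"
      by (rule finite_coords_power_set)
    define as where "as = map fst zs"
    define bs where "bs = map snd zs"
    have zip: "zip as bs = zs" by (simp add: as_def bs_def zip_map_fst_snd)
    then have asS: "pairs_in S as bs" using zs by (auto simp: pairs_in_def as_def bs_def)
    then have asR: "pairs_in R as bs" using pairs_in_mono R(1) by blast
    have "set as \<subseteq> elements M" using pairs_in_subsets(1)[OF asR] D by blast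
    then obtain \<tau> where as: "as \<in> tuples M \<tau>" using ex_tuples_of by blast
    then have bs: "bs \<in> tuples M \<tau>" using elem_mapD(1)[OF R(2) asR] by blast
    have ct: "c \<in> tuples M (power_sort \<gamma> n)" using c(1) definable_sub[OF definable_power_set[OF C]] by blast
    have cc: "pairs_in R c c" using coords_power_set[OF c(1)] R(1) by (intro pairs_in_Id) auto
    have "elem_map L M (set (zip (d # as @ c) (d' # bs @ c)))"
    proof (rule elem_map_zip[OF dis])
      show ds: "d # as @ c \<in> tuples M (s # \<tau> @ power_sort \<gamma> n)" and ds': "d' # bs @ c \<in> tuples M (s # \<tau> @ power_sort \<gamma> n)"
        using s d'(1) as bs ct by (auto intro: append_in_tuples)
      fix \<phi> assume \<phi>: "formula_in L (s # \<tau> @ power_sort \<gamma> n) \<phi>"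
      define j where "j = (\<tau> @ power_sort \<gamma> n, \<phi>)"
      have jJ: "j \<in> ?J" using \<phi> by (simp add: j_def)
      have "X j n bs (e' j) \<in> \<F>" unfolding \<F>_def j_def using \<phi> asS as by blast
      then have "[d'] \<in> X j n bs (e' j)" by (rule d'(2))
      then have 1: "d' # bs @ c \<in> F j \<longleftrightarrow> bs @ c @ e' j \<in> \<Psi> j" using c(1) by (auto simp: X_def)
      have "as @ c \<in> tuples M (fst j)" using as ct by (auto simp: j_def intro: append_in_tuples)
      moreover have "set (as @ c) \<subseteq> Domain R"
        using pairs_in_subsets(1)[OF asR] coords_power_set[OF c(1)] R(1) by auto
      ultimately have 2: "d # as @ c \<in> F j \<longleftrightarrow> as @ c @ e j \<in> \<Psi> j" using e(5)[OF jJ, of "as @ c"] by simp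
      have "pairs_in R ((as @ c) @ e j) ((bs @ c) @ e' j)"
        using asR cc e(3)[OF jJ] by (intro pairs_in_append)
      moreover have "(as @ c) @ e j \<in> tuples M (fst j @ \<xi> j)"
        using as ct e(1)[OF jJ] by (auto simp: j_def intro: append_in_tuples)
      ultimately have 3: "as @ c @ e j \<in> \<Psi> j \<longleftrightarrow> bs @ c @ e' j \<in> \<Psi> j"
        using elem_map_definable[OF R(2) _ _ e(4)[OF jJ]] by simp
      \<comment> \<open>Truth at \<open>d\<close> becomes membership in \<open>\<Psi> j\<close> at
        \<open>as\<close>, \<open>c\<close>, \<open>e j\<close>; \<open>R\<close> moves this to
        \<open>bs\<close>, \<open>c\<close>, \<open>e' j\<close>; the choice of \<open>d'\<close>
        turns it into truth at \<open>d'\<close>.\<close>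
      show "holds M \<phi> (d # as @ c) \<longleftrightarrow> holds M \<phi> (d' # bs @ c)"
        using 1 2 3 ds ds' by (simp add: F_def j_def)
    qed
    moreover have "G \<subseteq> set (zip (d # as @ c) (d' # bs @ c))"
    proof
      fix g assume g: "g \<in> G"
      have len: "length as = length bs" by (simp add: as_def bs_def)
      then have eq: "set (zip (d # as @ c) (d' # bs @ c)) = insert (d, d') (set zs \<union> set (zip c c))"
        using zip by simp
      consider "g = (d, d')" | "g \<in> S" | "g \<in> Id_on (coords C)" using g G(2) R(1) by blast
      then show "g \<in> set (zip (d # as @ c) (d' # bs @ c))"
      proof cases
        case 3
        then obtain x where x: "g = (x, x)" by auto
        then have "x \<in> set c" using 3 g c(2) by force
        then have "(x, x) \<in> set (zip c c)" by (auto simp: set_zip in_set_conv_nth)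
        then show ?thesis using eq x by blast
      qed (use eq zs g in blast)+
    qed
    ultimately show "\<exists>R'. G \<subseteq> R' \<and> elem_map L M R'" by blast
  qed
  then show thesis using that by blast
qed

text \<open>Only finitely many fixed elements of \<open>A\<close> occur in a finite part of the map;
  listed as a tuple \<open>c\<close>, they become parameters of a set that contains both
  \<open>a\<close> and \<open>b\<close> or neither.\<close>

lemma same_type_elem_map:
  assumes dis: "disjoint_family (univ M)" and A: "A \<subseteq> elements M"
    and ab: "a \<in> tuples M \<sigma>" "b \<in> tuples M \<sigma>" and same: "\<And>X. definable L M A \<sigma> X \<Longrightarrow> a \<in> X \<longleftrightarrow> b \<in> X"
  shows "elem_map L M (Id_on A \<union> set (zip a b))"
proof (rule elem_map_finite_character)
  show "Id_on A \<union> set (zip a b) \<subseteq> elements M \<times> elements M"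
    using A set_tuples[OF ab(1)] set_tuples[OF ab(2)] by (auto dest: set_zip_leftD set_zip_rightD)
  fix G assume G: "finite G" "G \<subseteq> Id_on A \<union> set (zip a b)"
  have len: "length a = length b" using ab length_tuples by metis
  obtain c where c: "set c = fst ` (G \<inter> Id_on A)" using G(1) finite_list by (metis finite_Int finite_imageI)
  have cA: "set c \<subseteq> A" unfolding c by auto
  then obtain \<tau> where ct: "c \<in> tuples M \<tau>" using ex_tuples_of A by (metis subset_trans)
  have "elem_map L M (set (zip (a @ c) (b @ c)))"
  proof (rule elem_map_zip[OF dis])
    show "a @ c \<in> tuples M (\<sigma> @ \<tau>)" "b @ c \<in> tuples M (\<sigma> @ \<tau>)" using ab ct by (auto intro: append_in_tuples)
    fix \<phi> assume \<phi>: "formula_in L (\<sigma> @ \<tau>) \<phi>"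
    have "definable L M A \<sigma> {x \<in> tuples M \<sigma>. holds M \<phi> (x @ c)}"
      unfolding definable_iff_formula using \<phi> cA ct by blast
    from same[OF this] show "holds M \<phi> (a @ c) \<longleftrightarrow> holds M \<phi> (b @ c)" using ab by simp
  qed
  moreover have "G \<subseteq> set (zip (a @ c) (b @ c))"
  proof
    fix g assume g: "g \<in> G"
    show "g \<in> set (zip (a @ c) (b @ c))"
    proof (cases "g \<in> Id_on A")
      case True
      then obtain x where x: "g = (x, x)" by auto
      then have "x \<in> set c" unfolding c using True g by force
      then have "(x, x) \<in> set (zip c c)" by (auto simp: set_zip in_set_conv_nth)
      then show ?thesis using len x by simp
    next
      case False
      then show ?thesis using g G(2) len by auto
    qed
  qed
  ultimately show "\<exists>R'. G \<subseteq> R' \<and> elem_map L M R'" by blast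
qed

lemma coords_elements: "definable L M B \<gamma> C \<Longrightarrow> coords C \<subseteq> elements M"
  using definable_sub[of L M B \<gamma> C] set_tuples[of _ M \<gamma>] by (auto simp: coords_def)

lemma small_insert:
  assumes "sufficiently_saturated L M \<kappa>" "|S| <o \<kappa>" "finite N"
  shows "|S \<union> N| <o \<kappa>"
  using assms finite_small[OF assms(1,3)] sufficiently_saturated_infinite[OF assms(1)]
  by (intro card_of_Un_ordLess_infinite_Field) (auto simp: sufficiently_saturated_def)

text \<open>Back and forth runs along a well-order of the elements whose proper initial segments
  have fewer elements than the model, hence fewer than \<kappa>. Each stage adds finitely many
  pairs, so that the part still to be extended stays small at every stage.\<close>

lemma homogeneity:
  assumes S: "lang_structure L M" and ss: "sufficiently_saturated L M \<kappa>" and tt: "totally_transcendental L M"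
    and C: "definable L M B \<gamma> C" and B: "B \<subseteq> elements M" "|B| <o \<kappa>"
    and ab: "a \<in> tuples M \<sigma>" "b \<in> tuples M \<sigma>"
    and same: "\<And>X. definable L M (B \<union> coords C) \<sigma> X \<Longrightarrow> a \<in> X \<longleftrightarrow> b \<in> X"
  obtains h where "h \<in> automorphisms L M (B \<union> coords C)" "map h a = b"
proof -
  have dis: "disjoint_family (univ M)" using S by (simp add: lang_structure_def)
  have Card: "Card_order \<kappa>" "|elements M| \<le>o \<kappa>" using ss by (auto simp: sufficiently_saturated_def)
  define E where "E = elements M"
  \<comment> \<open>The identity on \<open>C\<close> need not be small; it is kept apart, and only
    the remaining pairs are counted.\<close>
  define Z where "Z = Id_on (coords C)"
  have Zc: "Z\<inverse> = Z" by (auto simp: Z_def)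
  define good where "good T \<longleftrightarrow> elem_map L M (Z \<union> T) \<and> Id_on B \<subseteq> T \<and> |T| <o \<kappa>" for T
  have forth: "\<exists>N. finite N \<and> good (T \<union> N) \<and> x \<in> Domain N" if T: "good T" "x \<in> E" for T x
  proof -
    obtain x' where "elem_map L M (insert (x, x') (Z \<union> T))"
      using elem_map_extend[OF S ss tt C, of "Z \<union> T" T x] T unfolding good_def Z_def E_def by blast
    then have "good (T \<union> {(x, x')})"
      using T(1) small_insert[OF ss, of T "{(x, x')}"] by (auto simp: good_def)
    then show ?thesis by (intro exI[of _ "{(x, x')}"]) auto
  qed
  have conv: "good (T\<inverse>)" if "good T" for T
  proof -
    have "elem_map L M ((Z \<union> T)\<inverse>)" using that elem_map_converse[OF dis] by (simp add: good_def)
    moreover have "|T\<inverse>| <o \<kappa>"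
    proof -
      have "T\<inverse> = prod.swap ` T" by auto
      then have "|T\<inverse>| \<le>o |T|" by (simp add: card_of_image)
      then show ?thesis using that ordLeq_ordLess_trans by (auto simp: good_def)
    qed
    ultimately show ?thesis using that Zc by (auto simp: good_def converse_Un)
  qed
  have step: "\<exists>N. finite N \<and> good (T \<union> N) \<and> x \<in> Domain N \<and> x \<in> Range N" if T: "good T" and x: "x \<in> E" for T x
  proof -
    obtain N1 where N1: "finite N1" "good (T \<union> N1)" "x \<in> Domain N1" using forth[OF T x] by blast
    \<comment> \<open>The back step is the forth step for the converse relation, \<open>Z\<close>
      being its own converse.\<close>
    obtain N2 where N2: "finite N2" "good ((T \<union> N1)\<inverse> \<union> N2)" "x \<in> Domain N2"
      using forth[OF conv[OF N1(2)] x] by blast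
    have "((T \<union> N1)\<inverse> \<union> N2)\<inverse> = T \<union> (N1 \<union> N2\<inverse>)" by auto
    then have "good (T \<union> (N1 \<union> N2\<inverse>))" using conv[OF N2(2)] by simp
    then show ?thesis using N1 N2 by (intro exI[of _ "N1 \<union> N2\<inverse>"]) auto
  qed
  define N where "N T x = (SOME N. finite N \<and> good (T \<union> N) \<and> x \<in> Domain N \<and> x \<in> Range N)" for T x
  have N: "finite (N T x) \<and> good (T \<union> N T x) \<and> x \<in> Domain (N T x) \<and> x \<in> Range (N T x)"
    if "good T" "x \<in> E" for T x
    unfolding N_def by (rule someI_ex[OF step[OF that]])
  define S0 where "S0 = Id_on B \<union> set (zip a b)"
  have S0: "good S0"
  proof -
    have "elem_map L M (Id_on (B \<union> coords C) \<union> set (zip a b))"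
      using B(1) coords_elements[OF C] by (intro same_type_elem_map[OF dis _ ab same]) auto
    moreover have "Id_on (B \<union> coords C) \<union> set (zip a b) = Z \<union> S0" by (auto simp: Z_def S0_def)
    moreover have "|S0| <o \<kappa>"
    proof -
      have "Id_on B = (\<lambda>x. (x, x)) ` B" by auto
      then have "|Id_on B| \<le>o |B|" by (simp add: card_of_image)
      then have "|Id_on B| <o \<kappa>" using B(2) by (rule ordLeq_ordLess_trans)
      then show ?thesis unfolding S0_def by (intro small_insert[OF ss]) auto
    qed
    ultimately show ?thesis by (simp add: good_def S0_def)
  qed
  define W where "W = |E| - Id"
  have wo: "Well_order |E|" by (rule card_of_Well_order)
  have wf: "wf W" using wo by (simp add: well_order_on_def W_def)
  have FW: "x \<in> E \<and> y \<in> E" if "(x, y) \<in> W" for x y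
    using that Field_card_of[of E] by (auto simp: W_def Field_def)
  have lin: "x = y \<or> (x, y) \<in> W \<or> (y, x) \<in> W" if "x \<in> E" "y \<in> E" for x y
    using wo that unfolding well_order_on_def linear_order_on_def total_on_def Field_card_of W_def by auto
  have trW: "(x, z) \<in> W" if "(x, y) \<in> W" "(y, z) \<in> W" for x y z
    using wo that unfolding well_order_on_def linear_order_on_def partial_order_on_def preorder_on_def W_def
    by (auto dest: transD antisymD)
  \<comment> \<open>\<open>T x\<close> is the set of pairs added at stage \<open>x\<close>, and
    \<open>U x\<close> below is all of \<open>S0\<close> and the earlier stages. The recursion
    chooses by \<open>SOME\<close>; that the choice succeeds is known only once \<open>U x\<close>
    is shown to be good.\<close>
  define T where "T = wfrec W (\<lambda>f x. N (S0 \<union> (\<Union>y\<in>{y. (y, x) \<in> W}. f y)) x)"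
  define U where "U x = S0 \<union> (\<Union>y\<in>{y. (y, x) \<in> W}. T y)" for x
  have T: "T x = N (U x) x" for x
  proof -
    have "T x = N (S0 \<union> (\<Union>y\<in>{y. (y, x) \<in> W}. cut T W x y)) x"
      unfolding T_def by (subst wfrec[OF wf]) (rule refl)
    moreover have "(\<Union>y\<in>{y. (y, x) \<in> W}. cut T W x y) = (\<Union>y\<in>{y. (y, x) \<in> W}. T y)"
      by (rule SUP_cong) (auto simp: cut_apply)
    ultimately show ?thesis by (simp add: U_def)
  qed
  have UT: "U y \<union> T y \<subseteq> U z" if "(y, z) \<in> W" for y z
    using that trW by (auto simp: U_def)
  \<comment> \<open>The stages increase along \<open>W\<close>, so a finite part of the union lies
    in one of them, or in \<open>Z \<union> S0\<close> if it uses no stage.\<close>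
  have chain: "elem_map L M (Z \<union> (S0 \<union> (\<Union>y\<in>I. T y)))" if I: "I \<subseteq> E" "\<And>y. y \<in> I \<Longrightarrow> good (U y)" for I
  proof (rule elem_map_finite_character)
    have el: "elem_map L M (Z \<union> (U y \<union> T y))" if "y \<in> I" for y
      using N[OF I(2)[OF that]] I(1) that T by (auto simp: good_def)
    then have "Z \<union> (U y \<union> T y) \<subseteq> elements M \<times> elements M" if "y \<in> I" for y
      using that by (auto simp: elem_map_def)
    moreover have el0: "elem_map L M (Z \<union> S0)" using S0 by (simp add: good_def)
    then have "Z \<union> S0 \<subseteq> elements M \<times> elements M" by (simp add: elem_map_def)
    ultimately show "Z \<union> (S0 \<union> (\<Union>y\<in>I. T y)) \<subseteq> elements M \<times> elements M" by blast
    fix G assume G: "finite G" "G \<subseteq> Z \<union> (S0 \<union> (\<Union>y\<in>I. T y))"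
    then have "G \<subseteq> Z \<union> S0 \<or> (\<exists>z\<in>I. G \<subseteq> Z \<union> (U z \<union> T z))"
    proof (induction G)
      case (insert g G)
      have S0U: "S0 \<subseteq> U z" for z by (auto simp: U_def)
      from insert.IH insert.prems consider "G \<subseteq> Z \<union> S0" | z where "z \<in> I" "G \<subseteq> Z \<union> (U z \<union> T z)" by blast
      then show ?case
      proof cases
        case 1
        show ?thesis
        proof (cases "g \<in> Z \<union> S0")
          case False
          then obtain y where y: "y \<in> I" "g \<in> T y" using insert.prems by blast
          then have "insert g G \<subseteq> Z \<union> (U y \<union> T y)" using 1 S0U[of y] by blast
          then show ?thesis using y(1) by blast
        qed (use 1 in simp)
      next
        case (2 z)
        show ?thesis
        proof (cases "g \<in> Z \<union> S0")
          case True
          then have "insert g G \<subseteq> Z \<union> (U z \<union> T z)" using 2 S0U[of z] by blast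
          then show ?thesis using 2(1) by blast
        next
          case False
          then obtain y where y: "y \<in> I" "g \<in> T y" using insert.prems by blast
          consider "y = z" | "(y, z) \<in> W" | "(z, y) \<in> W" using lin y(1) 2(1) I(1) by blast
          then show ?thesis
          proof cases
            case 1
            then have "insert g G \<subseteq> Z \<union> (U z \<union> T z)" using 2 y by blast
            then show ?thesis using 2(1) by blast
          next
            case 22: 2
            then have "insert g G \<subseteq> Z \<union> (U z \<union> T z)" using 2 y UT[OF 22] by blast
            then show ?thesis using 2(1) by blast
          next
            case 3
            then have "insert g G \<subseteq> Z \<union> (U y \<union> T y)" using 2 y UT[OF 3] by blast
            then show ?thesis using y(1) by blast
          qed
        qed
      qed
    qed simp
    then show "\<exists>R'. G \<subseteq> R' \<and> elem_map L M R'" using el el0 by blast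
  qed
  have good: "good (U x)" if "x \<in> E" for x
    using wf that
  proof (induction x rule: wf_induct_rule)
    case (less x)
    let ?I = "{y. (y, x) \<in> W}"
    have I: "?I \<subseteq> E" "\<And>y. y \<in> ?I \<Longrightarrow> good (U y)" using less.IH FW by auto
    have "elem_map L M (Z \<union> U x)" using chain[OF I] by (simp add: U_def)
    moreover have "Id_on B \<subseteq> U x" by (auto simp: U_def S0_def)
    moreover have "|U x| <o \<kappa>"
    proof -
      have finT: "finite (T y)" if "y \<in> ?I" for y using N[OF I(2)[OF that]] I(1) that T by auto
      \<comment> \<open>A proper initial segment of a cardinal order has smaller cardinality than
        the whole.\<close>
      have "?I = underS |E| x" by (auto simp: W_def underS_def)
      moreover have "x \<in> Field |E|" using less.prems by (simp add: Field_card_of)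
      ultimately have "|?I| <o |E|" using card_of_underS[OF card_of_Card_order[of E], of x] by simp
      then have Ik: "|?I| <o \<kappa>" using Card(2) unfolding E_def by (rule ordLess_ordLeq_trans)
      have "|\<Union>y\<in>?I. T y| <o \<kappa>"
      proof (cases "finite ?I")
        case True
        then show ?thesis using finT by (intro finite_small[OF ss]) blast
      next
        case False
        have "|\<Union>y\<in>?I. T y| \<le>o |?I|"
          using finT False by (intro card_of_UNION_ordLeq_infinite card_of_mono1 finite_ordLeq_infinite ballI) auto
        then show ?thesis using Ik by (rule ordLeq_ordLess_trans)
      qed
      then show ?thesis unfolding U_def using S0
        by (intro card_of_Un_ordLess_infinite_Field sufficiently_saturated_infinite[OF ss] Card(1)) (auto simp: good_def)
    qed
    ultimately show ?case by (simp add: good_def)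
  qed
  let ?R = "Z \<union> (S0 \<union> (\<Union>y\<in>E. T y))"
  have R: "elem_map L M ?R" using chain[of E] good by blast
  have TE: "x \<in> Domain (T x) \<and> x \<in> Range (T x)" if "x \<in> E" for x using N[OF good[OF that] that] T by simp
  have "?R \<subseteq> elements M \<times> elements M" using R by (simp add: elem_map_def)
  then have dom: "Domain ?R = elements M" and ran: "Range ?R = elements M" using TE unfolding E_def by blast+
  have id: "Id_on (B \<union> coords C) \<subseteq> ?R" by (auto simp: Z_def S0_def)
  obtain h where h: "h \<in> automorphisms L M (B \<union> coords C)" "\<And>x y. (x, y) \<in> ?R \<Longrightarrow> h x = y"
  proof (rule elem_map_automorphism[OF S R dom ran id])
    fix h assume "h \<in> automorphisms L M (B \<union> coords C)" "\<And>x y. (x, y) \<in> ?R \<Longrightarrow> h x = y"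
    then show thesis by (rule that)
  qed
  have "length a = length b" using ab length_tuples by metis
  then have "map h a = b"
    using h(2) by (intro nth_equalityI) (auto simp: S0_def set_zip)
  then show thesis using that h(1) by blast
qed

section \<open>The group of arrows of a torsor\<close>

text \<open>\<open>arr a b\<close> is the class of the pair \<open>(a, b)\<close> under an equivalence relation on \<open>P \<times> P\<close> that is
  compatible with \<open>(a, b)(b, c) = (a, c)\<close>. The two groups of the bitorsor are instances: one acts on the left
  by \<open>(b, a) a = b\<close>, the other on the right by \<open>a (a, b) = b\<close>.\<close>

locale arrows =
  fixes P :: "'a set" and arr :: "'a \<Rightarrow> 'a \<Rightarrow> 'g"
  assumes nonempty: "P \<noteq> {}"
    and arr_ex: "\<lbrakk>a \<in> P; b \<in> P; a' \<in> P\<rbrakk> \<Longrightarrow> \<exists>b'\<in>P. arr a' b' = arr a b"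
    and arr_inj: "\<lbrakk>a \<in> P; b \<in> P; b' \<in> P; arr a b = arr a b'\<rbrakk> \<Longrightarrow> b = b'"
    and arr_comp: "\<lbrakk>a \<in> P; b \<in> P; c \<in> P; a' \<in> P; b' \<in> P; c' \<in> P; arr a b = arr a' b'; arr b c = arr b' c'\<rbrakk>
      \<Longrightarrow> arr a c = arr a' c'"
    and arr_sym: "\<lbrakk>a \<in> P; b \<in> P; a' \<in> P; b' \<in> P; arr a b = arr a' b'\<rbrakk> \<Longrightarrow> arr b a = arr b' a'"
    and arr_id: "\<lbrakk>a \<in> P; b \<in> P\<rbrakk> \<Longrightarrow> arr a a = arr b b"
begin

definition "arrow_set = {arr a b | a b. a \<in> P \<and> b \<in> P}"

definition "arrow_mult x y = (THE z. \<exists>a\<in>P. \<exists>b\<in>P. \<exists>c\<in>P. x = arr a b \<and> y = arr b c \<and> z = arr a c)"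

definition "arrow_group = \<lparr>carrier = arrow_set, mult = arrow_mult, one = (THE e. \<exists>a\<in>P. e = arr a a)\<rparr>"

text \<open>Restricting to \<open>P\<close> makes the map extensional, as the elements of
  \<open>BijGroup P\<close> have to be.\<close>

definition "left_act x = (\<lambda>a\<in>P. THE b. b \<in> P \<and> arr b a = x)"

definition "right_act a x = (THE b. b \<in> P \<and> arr a b = x)"

lemma arr_in: "a \<in> P \<Longrightarrow> b \<in> P \<Longrightarrow> arr a b \<in> arrow_set"
  by (auto simp: arrow_set_def)

lemma arr_mult:
  assumes "a \<in> P" "b \<in> P" "c \<in> P"
  shows "arrow_mult (arr a b) (arr b c) = arr a c"
  unfolding arrow_mult_def
proof (rule the_equality)
  show "\<exists>a'\<in>P. \<exists>b'\<in>P. \<exists>c'\<in>P. arr a b = arr a' b' \<and> arr b c = arr b' c' \<and> arr a c = arr a' c'"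
    using assms by (intro bexI[of _ a] bexI[of _ b] bexI[of _ c]) simp_all
  fix z assume "\<exists>a'\<in>P. \<exists>b'\<in>P. \<exists>c'\<in>P. arr a b = arr a' b' \<and> arr b c = arr b' c' \<and> z = arr a' c'"
  then obtain a' b' c' where "a' \<in> P" "b' \<in> P" "c' \<in> P" "arr a b = arr a' b'" "arr b c = arr b' c'" "z = arr a' c'"
    by (elim bexE conjE)
  then show "z = arr a c" using arr_comp[OF assms, of a' b' c'] by simp
qed

lemma one_arrows:
  assumes "a \<in> P"
  shows "\<one>\<^bsub>arrow_group\<^esub> = arr a a"
proof -
  have "(THE e. \<exists>a\<in>P. e = arr a a) = arr a a"
  proof (rule the_equality)
    fix e assume "\<exists>a\<in>P. e = arr a a"
    then obtain a' where "a' \<in> P" "e = arr a' a'" by (elim bexE)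
    then show "e = arr a a" using arr_id[OF assms, of a'] by simp
  qed (use assms in \<open>intro bexI[of _ a]; simp\<close>)
  then show ?thesis by (simp add: arrow_group_def)
qed

lemma arr_mult_iff:
  assumes "x \<in> arrow_set" "y \<in> arrow_set"
  shows "arrow_mult x y = z \<longleftrightarrow> (\<exists>a\<in>P. \<exists>b\<in>P. \<exists>c\<in>P. x = arr a b \<and> y = arr b c \<and> z = arr a c)"
proof
  assume z: "arrow_mult x y = z"
  obtain a b where ab: "x = arr a b" "a \<in> P" "b \<in> P" using assms(1) by (auto simp: arrow_set_def)
  obtain b' c' where "y = arr b' c'" "b' \<in> P" "c' \<in> P" using assms(2) by (auto simp: arrow_set_def)
  \<comment> \<open>The second arrow is moved so that it starts where the first one ends.\<close>
  then obtain c where "c \<in> P" "y = arr b c" using arr_ex[of b' c' b] ab by metis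
  then show "\<exists>a\<in>P. \<exists>b\<in>P. \<exists>c\<in>P. x = arr a b \<and> y = arr b c \<and> z = arr a c"
    using ab z arr_mult by blast
qed (use arr_mult in blast)

lemma arrow_from: "x \<in> arrow_set \<Longrightarrow> a \<in> P \<Longrightarrow> \<exists>b\<in>P. arr a b = x"
  unfolding arrow_set_def using arr_ex by blast

lemma arrow_to: "x \<in> arrow_set \<Longrightarrow> b \<in> P \<Longrightarrow> \<exists>a\<in>P. arr a b = x"
proof -
  assume "x \<in> arrow_set" "b \<in> P"
  then obtain a' b' where *: "a' \<in> P" "b' \<in> P" "x = arr a' b'" by (auto simp: arrow_set_def)
  then obtain a where "a \<in> P" "arr b a = arr b' a'" using arr_ex[of b' a' b] \<open>b \<in> P\<close> by blast
  then show ?thesis using arr_sym[of b a b' a'] * \<open>b \<in> P\<close> by blast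
qed

lemma arr_inj_left: "\<lbrakk>a \<in> P; a' \<in> P; b \<in> P; arr a b = arr a' b\<rbrakk> \<Longrightarrow> a = a'"
  using arr_sym[of a b a' b] arr_inj by blast

text \<open>Three elements can be written head to tail as \<open>arr a b\<close>,
  \<open>arr b c\<close>, \<open>arr c d\<close>, which makes associativity immediate; the inverse
  of \<open>arr a b\<close> is \<open>arr b a\<close>.\<close>

lemma group_arrows: "group arrow_group"
proof (rule groupI)
  obtain a0 where a0: "a0 \<in> P" using nonempty by blast
  note one = one_arrows
  show "\<one>\<^bsub>arrow_group\<^esub> \<in> carrier arrow_group" using one[OF a0] arr_in a0 by (simp add: arrow_group_def)
  fix x assume x: "x \<in> carrier arrow_group"
  then obtain a b where ab: "a \<in> P" "b \<in> P" "x = arr a b" by (auto simp: arrow_group_def arrow_set_def)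
  show "\<one>\<^bsub>arrow_group\<^esub> \<otimes>\<^bsub>arrow_group\<^esub> x = x" using one[OF ab(1)] arr_mult ab by (simp add: arrow_group_def)
  show "\<exists>y\<in>carrier arrow_group. y \<otimes>\<^bsub>arrow_group\<^esub> x = \<one>\<^bsub>arrow_group\<^esub>"
    using one[OF ab(2)] arr_mult[of b a b] arr_in[of b a] ab by (auto simp: arrow_group_def)
  fix y assume y: "y \<in> carrier arrow_group"
  then obtain c where c: "c \<in> P" "y = arr b c" using arrow_from[of y b] ab by (auto simp: arrow_group_def)
  show "x \<otimes>\<^bsub>arrow_group\<^esub> y \<in> carrier arrow_group" using ab c arr_mult arr_in by (simp add: arrow_group_def)
  fix z assume "z \<in> carrier arrow_group"
  then obtain d where "d \<in> P" "z = arr c d" using arrow_from[of z c] c by (auto simp: arrow_group_def)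
  then show "x \<otimes>\<^bsub>arrow_group\<^esub> y \<otimes>\<^bsub>arrow_group\<^esub> z = x \<otimes>\<^bsub>arrow_group\<^esub> (y \<otimes>\<^bsub>arrow_group\<^esub> z)"
    using ab c arr_mult by (simp add: arrow_group_def)
qed

lemma left_act_arr: "a \<in> P \<Longrightarrow> b \<in> P \<Longrightarrow> left_act (arr b a) a = b"
  unfolding left_act_def by (auto intro!: the_equality arr_inj_left)

lemma right_act_arr: "a \<in> P \<Longrightarrow> b \<in> P \<Longrightarrow> right_act a (arr a b) = b"
  unfolding right_act_def by (auto intro!: the_equality dest: arr_inj)

lemma left_act_iff: "x \<in> arrow_set \<Longrightarrow> a \<in> P \<Longrightarrow> left_act x a = b \<longleftrightarrow> b \<in> P \<and> arr b a = x"
  using arrow_to left_act_arr by metis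

lemma right_act_iff: "x \<in> arrow_set \<Longrightarrow> a \<in> P \<Longrightarrow> right_act a x = b \<longleftrightarrow> b \<in> P \<and> arr a b = x"
  using arrow_from right_act_arr by metis

lemma carrier_arrows: "carrier arrow_group = arrow_set"
  by (simp add: arrow_group_def)

lemma left_act_Bij:
  assumes x: "x \<in> arrow_set"
  shows "left_act x \<in> Bij P"
proof -
  have "bij_betw (left_act x) P P"
  proof (rule bij_betwI')
    fix a b assume "a \<in> P" "b \<in> P"
    then show "left_act x a = left_act x b \<longleftrightarrow> a = b" using left_act_iff[OF x] arr_inj by metis
  next
    fix a assume "a \<in> P"
    then show "left_act x a \<in> P" using left_act_iff[OF x] by blast
  next
    fix b assume "b \<in> P"
    then show "\<exists>a\<in>P. b = left_act x a" using arrow_from[OF x] left_act_iff[OF x] by metis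
  qed
  moreover have "left_act x \<in> extensional P" by (simp add: left_act_def)
  ultimately show ?thesis by (simp add: Bij_def)
qed

lemma left_act_mult:
  assumes x: "x \<in> arrow_set" and y: "y \<in> arrow_set"
  shows "left_act (arrow_mult x y) = compose P (left_act x) (left_act y)"
proof
  fix a
  show "left_act (arrow_mult x y) a = compose P (left_act x) (left_act y) a"
  proof (cases "a \<in> P")
    case True
    obtain b where b: "b \<in> P" "y = arr b a" using arrow_to[OF y True] by metis
    obtain c where c: "c \<in> P" "x = arr c b" using arrow_to[OF x b(1)] by metis
    show ?thesis using True b c by (simp add: arr_mult left_act_arr compose_def)
  qed (simp add: left_act_def compose_def)
qed

lemma left_act_hom: "left_act \<in> hom arrow_group (BijGroup P)"
  by (rule homI) (auto simp: carrier_arrows BijGroup_def left_act_Bij left_act_mult arrow_group_def)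

lemma left_faithful_action: "faithful_action arrow_group P left_act"
proof -
  have "inj_on left_act arrow_set"
  proof (rule inj_onI)
    fix x y assume xy: "x \<in> arrow_set" "y \<in> arrow_set" and eq: "left_act x = left_act y"
    obtain a where a: "a \<in> P" using nonempty by blast
    have "x = arr (left_act x a) a" using left_act_iff[OF xy(1) a, of "left_act x a"] by simp
    also have "\<dots> = arr (left_act y a) a" unfolding eq ..
    also have "\<dots> = y" using left_act_iff[OF xy(2) a, of "left_act y a"] by simp
    finally show "x = y" .
  qed
  then show ?thesis
    unfolding faithful_action_def faithful_action_axioms_def group_action_def group_hom_def group_hom_axioms_def
    using group_arrows group_BijGroup left_act_hom by (simp add: carrier_arrows)
qed

lemma left_act_unique: "a \<in> P \<Longrightarrow> b \<in> P \<Longrightarrow> \<exists>!g. g \<in> arrow_set \<and> left_act g a = b"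
  by (rule ex1I[of _ "arr b a"]) (simp_all add: left_act_arr arr_in, metis left_act_iff)

lemma right_act_unique: "a \<in> P \<Longrightarrow> b \<in> P \<Longrightarrow> \<exists>!g. g \<in> arrow_set \<and> right_act a g = b"
  by (rule ex1I[of _ "arr a b"]) (simp_all add: right_act_arr arr_in, metis right_act_iff)

lemma right_action_arrows: "right_action arrow_group P right_act"
  unfolding right_action_def
proof (intro conjI ballI)
  show "group arrow_group" by (rule group_arrows)
  fix a assume a: "a \<in> P"
  then show "right_act a \<one>\<^bsub>arrow_group\<^esub> = a" using right_act_arr one_arrows by simp
  fix x assume x: "x \<in> carrier arrow_group"
  then obtain b where b: "b \<in> P" "x = arr a b" using arrow_from[of x a] a by (auto simp: carrier_arrows)
  show "right_act a x \<in> P" using right_act_arr a b by simp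
  fix y assume y: "y \<in> carrier arrow_group"
  then obtain c where c: "c \<in> P" "y = arr b c" using arrow_from[of y b] b by (auto simp: carrier_arrows)
  show "right_act (right_act a x) y = right_act a (x \<otimes>\<^bsub>arrow_group\<^esub> y)"
    using a b c by (simp add: right_act_arr arrow_group_def arr_mult)
qed

end

text \<open>Arrows are coded by the tuples \<open>f (a @ b)\<close>. Carrier, product and both
  actions are described through representatives in \<open>P\<close>, so that all reduces to
  definability of \<open>f (x @ y) = z\<close>, kept as a conclusion for use with other
  parameters.\<close>

lemma definable_arrows:
  fixes L :: "('f, 'r, 's) lang" and f :: "'m list \<Rightarrow> 'm list"
  assumes "arrows P (\<lambda>a b. f (a @ b))"
    and P: "definable L M A \<sigma> P" and f: "f \<in> tuples M (\<sigma> @ \<sigma>) \<rightarrow> tuples M \<rho>"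
    and fdef: "definable L M A ((\<sigma> @ \<sigma>) @ \<rho>) {u @ f u | u. u \<in> tuples M (\<sigma> @ \<sigma>)}"
  defines "G \<equiv> arrows.arrow_group P (\<lambda>a b. f (a @ b))"
    and "l \<equiv> arrows.left_act P (\<lambda>a b. f (a @ b))" and "r \<equiv> arrows.right_act P (\<lambda>a b. f (a @ b))"
  shows "definable_group L M A \<rho> G"
    "definable L M A (\<rho> @ \<sigma> @ \<sigma>) (graph2 (carrier G) P l)"
    "definable L M A (\<sigma> @ \<rho> @ \<sigma>) (graph2 P (carrier G) r)"
    "\<And>\<Gamma> x y z. tm M A \<Gamma> x \<sigma> \<Longrightarrow> tm M A \<Gamma> y \<sigma> \<Longrightarrow> tm M A \<Gamma> z \<rho> \<Longrightarrow> Dp L M A \<Gamma> (\<lambda>e. f (x e @ y e) = z e)"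
    "carrier G \<subseteq> tuples M \<rho>"
proof -
  interpret arrows P "\<lambda>a b. f (a @ b)" by fact
  have PT: "P \<subseteq> tuples M \<sigma>" by (rule definable_sub[OF P])
  have fT: "f (a @ b) \<in> tuples M \<rho>" if "a \<in> tuples M \<sigma>" "b \<in> tuples M \<sigma>" for a b
    using f that by (auto intro: append_in_tuples)
  have carr: "carrier G = arrow_set" by (simp add: G_def carrier_arrows)
  show GT: "carrier G \<subseteq> tuples M \<rho>" unfolding carr arrow_set_def using fT PT by blast
  show D: "Dp L M A \<Gamma> (\<lambda>e. f (x e @ y e) = z e)"
    if "tm M A \<Gamma> x \<sigma>" "tm M A \<Gamma> y \<sigma>" "tm M A \<Gamma> z \<rho>" for \<Gamma> x y z
  proof (rule Dp_cong)
    show "Dp L M A \<Gamma> (\<lambda>e. (x e @ y e) @ z e \<in> {u @ f u | u. u \<in> tuples M (\<sigma> @ \<sigma>)})"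
      by (intro Dp_in[OF fdef] tm_append that) auto
    fix e assume e: "e \<in> envs M \<Gamma>"
    have xy: "x e @ y e \<in> tuples M (\<sigma> @ \<sigma>)" using tm_in_tuples[OF _ e] that by (intro append_in_tuples) auto
    show "(x e @ y e) @ z e \<in> {u @ f u | u. u \<in> tuples M (\<sigma> @ \<sigma>)} \<longleftrightarrow> f (x e @ y e) = z e"
    proof
      assume "(x e @ y e) @ z e \<in> {u @ f u | u. u \<in> tuples M (\<sigma> @ \<sigma>)}"
      then obtain u where u: "(x e @ y e) @ z e = u @ f u" "u \<in> tuples M (\<sigma> @ \<sigma>)" by blast
      then have "length u = length (x e @ y e)" using xy length_tuples by metis
      then show "f (x e @ y e) = z e" using u(1) by (metis append_eq_append_conv)
    next
      assume "f (x e @ y e) = z e"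
      then have "(x e @ y e) @ z e = (x e @ y e) @ f (x e @ y e)" by simp
      then show "(x e @ y e) @ z e \<in> {u @ f u | u. u \<in> tuples M (\<sigma> @ \<sigma>)}" using xy by blast
    qed
  qed
  have "definable L M A \<rho> {z \<in> tuples M \<rho>. \<exists>a\<in>P. \<exists>b\<in>P. f (a @ b) = z}"
    by (intro definable_Collect Dp_exX[OF P] D tm_intros) auto
  moreover have "{z \<in> tuples M \<rho>. \<exists>a\<in>P. \<exists>b\<in>P. f (a @ b) = z} = carrier G"
    using GT unfolding carr arrow_set_def by blast
  ultimately have Gdef: "definable L M A \<rho> (carrier G)" by simp
  have "definable L M A (\<rho> @ \<rho> @ \<rho>) {x @ y @ z | x y z. x \<in> tuples M \<rho> \<and> y \<in> tuples M \<rho> \<and> z \<in> tuples M \<rho> \<and>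
      (\<exists>a\<in>P. \<exists>b\<in>P. \<exists>c\<in>P. f (a @ b) = x \<and> f (b @ c) = y \<and> f (a @ c) = z)}"
    by (intro definable_Collect3 Dp_exX[OF P] Dp_conj D tm_intros) auto
  moreover have "{x @ y @ z | x y z. x \<in> tuples M \<rho> \<and> y \<in> tuples M \<rho> \<and> z \<in> tuples M \<rho> \<and>
      (\<exists>a\<in>P. \<exists>b\<in>P. \<exists>c\<in>P. f (a @ b) = x \<and> f (b @ c) = y \<and> f (a @ c) = z)} =
      graph2 (carrier G) (carrier G) (mult G)" (is "?A = ?B")
  proof (intro equalityI subsetI)
    fix w assume "w \<in> ?A"
    then obtain a b c where w: "a \<in> P" "b \<in> P" "c \<in> P" "w = f (a @ b) @ f (b @ c) @ f (a @ c)" by blast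
    then have "w = f (a @ b) @ f (b @ c) @ mult G (f (a @ b)) (f (b @ c))"
      using arr_mult[of a b c] by (simp add: G_def arrow_group_def)
    then show "w \<in> ?B" unfolding graph2_def carr using arr_in w by blast
  next
    fix w assume "w \<in> ?B"
    then obtain x y where w: "x \<in> arrow_set" "y \<in> arrow_set" "w = x @ y @ arrow_mult x y"
      unfolding graph2_def carr by (auto simp: G_def arrow_group_def)
    obtain a b c where abc: "a \<in> P" "b \<in> P" "c \<in> P" "x = f (a @ b)" "y = f (b @ c)" "arrow_mult x y = f (a @ c)"
      using arr_mult_iff[OF w(1,2), of "arrow_mult x y"] by blast
    have "a \<in> tuples M \<sigma>" "b \<in> tuples M \<sigma>" "c \<in> tuples M \<sigma>" using abc PT by blast+
    then have "x \<in> tuples M \<rho>" "y \<in> tuples M \<rho>" "arrow_mult x y \<in> tuples M \<rho>" using fT abc by simp_all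
    moreover have "\<exists>a\<in>P. \<exists>b\<in>P. \<exists>c\<in>P. f (a @ b) = x \<and> f (b @ c) = y \<and> f (a @ c) = arrow_mult x y"
      using abc by (intro bexI[of _ a] bexI[of _ b] bexI[of _ c]) simp_all
    ultimately show "w \<in> ?A" unfolding w(3)
      by (intro CollectI exI[of _ x] exI[of _ y] exI[of _ "arrow_mult x y"] conjI refl)
  qed
  ultimately have "definable L M A (\<rho> @ \<rho> @ \<rho>) (graph2 (carrier G) (carrier G) (mult G))" by simp
  then show "definable_group L M A \<rho> G"
    using Gdef group_arrows unfolding definable_group_def G_def by blast
  have "definable L M A (\<rho> @ \<sigma> @ \<sigma>) {x @ a @ b | x a b. x \<in> tuples M \<rho> \<and> a \<in> tuples M \<sigma> \<and> b \<in> tuples M \<sigma> \<and>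
      (a \<in> P \<and> b \<in> P \<and> f (b @ a) = x)}"
    by (intro definable_Collect3 Dp_conj Dp_in[OF P] D tm_intros) auto
  moreover have "{x @ a @ b | x a b. x \<in> tuples M \<rho> \<and> a \<in> tuples M \<sigma> \<and> b \<in> tuples M \<sigma> \<and>
      (a \<in> P \<and> b \<in> P \<and> f (b @ a) = x)} = graph2 (carrier G) P l" (is "?A = ?B")
  proof (intro equalityI subsetI)
    fix w assume "w \<in> ?A"
    then obtain a b where "a \<in> P" "b \<in> P" "w = f (b @ a) @ a @ b" by blast
    then show "w \<in> ?B" unfolding graph2_def carr l_def using left_act_arr[of a b] arr_in[of b a] by fastforce
  next
    fix w assume "w \<in> ?B"
    then obtain x a where w: "x \<in> arrow_set" "a \<in> P" "w = x @ a @ left_act x a"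
      unfolding graph2_def carr l_def by blast
    have "left_act x a \<in> P" "f (left_act x a @ a) = x" using left_act_iff[OF w(1,2)] by blast+
    then show "w \<in> ?A" using w PT GT carr by blast
  qed
  ultimately show "definable L M A (\<rho> @ \<sigma> @ \<sigma>) (graph2 (carrier G) P l)" by simp
  have "definable L M A (\<sigma> @ \<rho> @ \<sigma>) {a @ x @ b | a x b. a \<in> tuples M \<sigma> \<and> x \<in> tuples M \<rho> \<and> b \<in> tuples M \<sigma> \<and>
      (a \<in> P \<and> b \<in> P \<and> f (a @ b) = x)}"
    by (intro definable_Collect3 Dp_conj Dp_in[OF P] D tm_intros) auto
  moreover have "{a @ x @ b | a x b. a \<in> tuples M \<sigma> \<and> x \<in> tuples M \<rho> \<and> b \<in> tuples M \<sigma> \<and>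
      (a \<in> P \<and> b \<in> P \<and> f (a @ b) = x)} = graph2 P (carrier G) r" (is "?A = ?B")
  proof (intro equalityI subsetI)
    fix w assume "w \<in> ?A"
    then obtain a b where "a \<in> P" "b \<in> P" "w = a @ f (a @ b) @ b" by blast
    then show "w \<in> ?B" unfolding graph2_def carr r_def using right_act_arr[of a b] arr_in[of a b] by fastforce
  next
    fix w assume "w \<in> ?B"
    then obtain x a where w: "x \<in> arrow_set" "a \<in> P" "w = a @ x @ right_act a x"
      unfolding graph2_def carr r_def by blast
    have "right_act a x \<in> P" "f (a @ right_act a x) = x" using right_act_iff[OF w(1,2)] by blast+
    then show "w \<in> ?A" using w PT GT carr by blast
  qed
  ultimately show "definable L M A (\<sigma> @ \<rho> @ \<sigma>) (graph2 P (carrier G) r)" by simp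
qed

section \<open>Imaginaries with parameters\<close>

lemma tm_take:
  assumes "tm M A \<Gamma> x (\<sigma> @ \<tau>)"
  shows "tm M A \<Gamma> (\<lambda>e. take (length \<sigma>) (x e)) \<sigma>"
proof -
  obtain bs \<tau>1 js where *: "bs \<in> tuples M \<tau>1" "set bs \<subseteq> A" "length js = length (\<sigma> @ \<tau>)"
     "\<forall>k<length (\<sigma> @ \<tau>). js ! k < length (concat \<Gamma> @ \<tau>1) \<and> (concat \<Gamma> @ \<tau>1) ! (js ! k) = (\<sigma> @ \<tau>) ! k"
     "\<forall>e\<in>envs M \<Gamma>. x e = map ((!) (concat e @ bs)) js"
    using assms unfolding tm_def by blast
  have "(concat \<Gamma> @ \<tau>1) ! (js ! k) = \<sigma> ! k \<and> js ! k < length (concat \<Gamma> @ \<tau>1)" if "k < length \<sigma>" for k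
    using *(4)[rule_format, of k] that by (simp add: nth_append)
  then show ?thesis unfolding tm_def using *(1-3,5)
    by (intro exI[of _ bs] exI[of _ \<tau>1] exI[of _ "take (length \<sigma>) js"]) (auto simp: take_map)
qed

lemma tm_drop:
  assumes "tm M A \<Gamma> x (\<sigma> @ \<tau>)"
  shows "tm M A \<Gamma> (\<lambda>e. drop (length \<sigma>) (x e)) \<tau>"
proof -
  obtain bs \<tau>1 js where *: "bs \<in> tuples M \<tau>1" "set bs \<subseteq> A" "length js = length (\<sigma> @ \<tau>)"
     "\<forall>k<length (\<sigma> @ \<tau>). js ! k < length (concat \<Gamma> @ \<tau>1) \<and> (concat \<Gamma> @ \<tau>1) ! (js ! k) = (\<sigma> @ \<tau>) ! k"
     "\<forall>e\<in>envs M \<Gamma>. x e = map ((!) (concat e @ bs)) js"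
    using assms unfolding tm_def by blast
  have "(concat \<Gamma> @ \<tau>1) ! (js ! (length \<sigma> + k)) = \<tau> ! k \<and> js ! (length \<sigma> + k) < length (concat \<Gamma> @ \<tau>1)"
    if "k < length \<tau>" for k
    using *(4)[rule_format, of "length \<sigma> + k"] that by (simp add: nth_append)
  then show ?thesis unfolding tm_def using *(1-3,5)
    by (intro exI[of _ bs] exI[of _ \<tau>1] exI[of _ "drop (length \<sigma>) js"]) (auto simp: drop_map)
qed

lemma take_drop_tuples:
  assumes "u \<in> tuples M (\<sigma> @ \<tau>)"
  shows "take (length \<sigma>) u \<in> tuples M \<sigma>" "drop (length \<sigma>) u \<in> tuples M \<tau>"
  using assms by (auto simp: tuples_append length_tuples)

lemma elimination_of_imaginariesD:
  assumes EI: "elimination_of_imaginaries L M"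
    and R: "\<And>x. x \<in> tuples M \<sigma> \<Longrightarrow> R x x"
      "\<And>x y. x \<in> tuples M \<sigma> \<Longrightarrow> y \<in> tuples M \<sigma> \<Longrightarrow> R x y \<Longrightarrow> R y x"
      "\<And>x y z. x \<in> tuples M \<sigma> \<Longrightarrow> y \<in> tuples M \<sigma> \<Longrightarrow> z \<in> tuples M \<sigma> \<Longrightarrow> R x y \<Longrightarrow> R y z \<Longrightarrow> R x z"
    and def: "Dp L M {} [\<sigma>, \<sigma>] (\<lambda>e. R (hd e) (hd (tl e)))"
  obtains \<rho> f where "f \<in> tuples M \<sigma> \<rightarrow> tuples M \<rho>" "definable L M {} (\<sigma> @ \<rho>) {a @ f a | a. a \<in> tuples M \<sigma>}"
    "\<And>a b. a \<in> tuples M \<sigma> \<Longrightarrow> b \<in> tuples M \<sigma> \<Longrightarrow> f a = f b \<longleftrightarrow> R a b"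
proof -
  define E where "E = {(x, y). x \<in> tuples M \<sigma> \<and> y \<in> tuples M \<sigma> \<and> R x y}"
  have "equiv (tuples M \<sigma>) E"
  proof (rule equivI)
    show "E \<subseteq> tuples M \<sigma> \<times> tuples M \<sigma>" by (auto simp: E_def)
    show "refl_on (tuples M \<sigma>) E" by (rule refl_onI) (simp add: E_def R(1))
    show "sym E" by (rule symI) (use R(2) in \<open>unfold E_def, blast\<close>)
    show "trans E" by (rule transI) (use R(3) in \<open>unfold E_def, blast\<close>)
  qed
  moreover have "{a @ b | a b. (a, b) \<in> E} = {x @ y | x y. x \<in> tuples M \<sigma> \<and> y \<in> tuples M \<sigma> \<and> R x y}"
    by (auto simp: E_def)
  then have "definable L M {} (\<sigma> @ \<sigma>) {a @ b | a b. (a, b) \<in> E}" using definable_Collect2[OF def] by simp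
  ultimately have "\<exists>\<rho> f. f \<in> tuples M \<sigma> \<rightarrow> tuples M \<rho> \<and> definable L M {} (\<sigma> @ \<rho>) {a @ f a | a. a \<in> tuples M \<sigma>} \<and>
      (\<forall>a\<in>tuples M \<sigma>. \<forall>b\<in>tuples M \<sigma>. (a, b) \<in> E \<longleftrightarrow> f a = f b)"
    using EI unfolding elimination_of_imaginaries_def by blast
  then show thesis using that by (auto simp: E_def)
qed

text \<open>The parameters \<open>e\<close> become variables \<open>z\<close>; instances of the formula that are not equivalence
  relations are replaced by equality.\<close>

lemma elimination_with_parameters:
  assumes EI: "elimination_of_imaginaries L M"
    and R: "\<And>x. x \<in> tuples M \<sigma> \<Longrightarrow> R x x"
      "\<And>x y. x \<in> tuples M \<sigma> \<Longrightarrow> y \<in> tuples M \<sigma> \<Longrightarrow> R x y \<Longrightarrow> R y x"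
      "\<And>x y z. x \<in> tuples M \<sigma> \<Longrightarrow> y \<in> tuples M \<sigma> \<Longrightarrow> z \<in> tuples M \<sigma> \<Longrightarrow> R x y \<Longrightarrow> R y z \<Longrightarrow> R x z"
    and def: "Dp L M A [\<sigma>, \<sigma>] (\<lambda>e. R (hd e) (hd (tl e)))"
  obtains \<rho> f where "f \<in> tuples M \<sigma> \<rightarrow> tuples M \<rho>" "definable L M A (\<sigma> @ \<rho>) {a @ f a | a. a \<in> tuples M \<sigma>}"
    "\<And>a b. a \<in> tuples M \<sigma> \<Longrightarrow> b \<in> tuples M \<sigma> \<Longrightarrow> f a = f b \<longleftrightarrow> R a b"
proof -
  obtain Y0 where Y0: "definable L M A (\<sigma> @ \<sigma>) Y0" "\<And>e. e \<in> envs M [\<sigma>, \<sigma>] \<Longrightarrow> R (hd e) (hd (tl e)) \<longleftrightarrow> concat e \<in> Y0"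
    using definable_of_Dp[OF def] by auto
  obtain e \<xi> Y where e: "e \<in> tuples M \<xi>" "set e \<subseteq> A" and Y: "definable L M {} ((\<sigma> @ \<sigma>) @ \<xi>) Y"
    "Y0 = {x \<in> tuples M (\<sigma> @ \<sigma>). x @ e \<in> Y}"
    using definable_params[OF Y0(1)] by blast
  have Y': "definable L M {} (\<sigma> @ \<sigma> @ \<xi>) Y" using Y(1) by simp
  define S where "S z x y \<longleftrightarrow> x @ y @ z \<in> Y" for z x y
  have SR: "S e x y \<longleftrightarrow> R x y" if "x \<in> tuples M \<sigma>" "y \<in> tuples M \<sigma>" for x y
    using Y0(2)[of "[x, y]"] that unfolding Y(2) S_def by (simp add: append_in_tuples)
  define eqv where "eqv z \<longleftrightarrow> (\<forall>x\<in>tuples M \<sigma>. S z x x) \<and> (\<forall>x\<in>tuples M \<sigma>. \<forall>y\<in>tuples M \<sigma>. S z x y \<longrightarrow> S z y x) \<and>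
     (\<forall>x\<in>tuples M \<sigma>. \<forall>y\<in>tuples M \<sigma>. \<forall>w\<in>tuples M \<sigma>. S z x y \<longrightarrow> S z y w \<longrightarrow> S z x w)" for z
  let ?t = "take (length \<sigma>)" and ?d = "drop (length \<sigma>)"
  \<comment> \<open>Tuples \<open>x @ z\<close> with different \<open>z\<close> are kept apart, so
    that one relation without parameters treats all fibres at once.\<close>
  define K where "K u v \<longleftrightarrow> ?d u = ?d v \<and> (eqv (?d u) \<and> S (?d u) (?t u) (?t v) \<or> ?t u = ?t v)" for u v
  have eqv_trans: "S z x w" if "eqv z" "x \<in> tuples M \<sigma>" "y \<in> tuples M \<sigma>" "w \<in> tuples M \<sigma>" "S z x y" "S z y w" for x y w z
    using that unfolding eqv_def by blast
  obtain \<rho> f where f: "f \<in> tuples M (\<sigma> @ \<xi>) \<rightarrow> tuples M \<rho>"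
    "definable L M {} ((\<sigma> @ \<xi>) @ \<rho>) {a @ f a | a. a \<in> tuples M (\<sigma> @ \<xi>)}"
    "\<And>a b. a \<in> tuples M (\<sigma> @ \<xi>) \<Longrightarrow> b \<in> tuples M (\<sigma> @ \<xi>) \<Longrightarrow> f a = f b \<longleftrightarrow> K a b"
  proof (rule elimination_of_imaginariesD[OF EI, of "\<sigma> @ \<xi>" K])
    show "K u u" for u by (simp add: K_def)
    show "K v u" if "u \<in> tuples M (\<sigma> @ \<xi>)" "v \<in> tuples M (\<sigma> @ \<xi>)" "K u v" for u v
      using take_drop_tuples(1)[OF that(1)] take_drop_tuples(1)[OF that(2)] that(3)
      unfolding K_def eqv_def by metis
    show "K u w" if "u \<in> tuples M (\<sigma> @ \<xi>)" "v \<in> tuples M (\<sigma> @ \<xi>)" "w \<in> tuples M (\<sigma> @ \<xi>)" "K u v" "K v w" for u v w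
      using that(4,5) eqv_trans[OF _ that(1-3)[THEN take_drop_tuples(1)]] unfolding K_def by metis
    show "Dp L M {} [\<sigma> @ \<xi>, \<sigma> @ \<xi>] (\<lambda>e. K (hd e) (hd (tl e)))"
      unfolding K_def eqv_def S_def
      by (intro Dp_logic Dp_in[OF Y'] tm_hd tm_append Dp_eq[of _ _ _ _ \<sigma>] Dp_eq[of _ _ _ _ \<xi>]
          tm_take[of _ _ _ _ \<sigma> \<xi>] tm_drop[of _ _ _ _ \<sigma> \<xi>] tm_tl empty_subsetI)
  qed (rule that)
  \<comment> \<open>On the fibre over \<open>e\<close> the relation \<open>K\<close> is
    \<open>R\<close>, because \<open>R\<close> is an equivalence relation.\<close>
  define g where "g x = f (x @ e)" for x
  have xe: "x @ e \<in> tuples M (\<sigma> @ \<xi>)" if "x \<in> tuples M \<sigma>" for x using that e(1) by (rule append_in_tuples)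
  show thesis
  proof
    show gT: "g \<in> tuples M \<sigma> \<rightarrow> tuples M \<rho>" using f(1) xe by (auto simp: g_def)
    have f2: "definable L M {} (\<sigma> @ \<xi> @ \<rho>) {a @ f a | a. a \<in> tuples M (\<sigma> @ \<xi>)}" (is "definable _ _ _ _ ?F")
      using f(2) by simp
    have graph: "x @ e @ y \<in> ?F \<longleftrightarrow> y = g x" if x: "x \<in> tuples M \<sigma>" for x y
    proof
      assume "x @ e @ y \<in> ?F"
      then obtain a where a: "(x @ e) @ y = a @ f a" "a \<in> tuples M (\<sigma> @ \<xi>)" by auto
      then have "length (x @ e) = length a" using xe[OF x] length_tuples by metis
      then show "y = g x" using a(1) unfolding g_def by (metis append_eq_append_conv)
    next
      assume "y = g x"
      then have "x @ e @ y = (x @ e) @ f (x @ e)" by (simp add: g_def)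
      then show "x @ e @ y \<in> ?F" using xe[OF x] by blast
    qed
    have "definable L M A (\<sigma> @ \<rho>) {x @ y | x y. x \<in> tuples M \<sigma> \<and> y \<in> tuples M \<rho> \<and> x @ e @ y \<in> ?F}"
      by (intro definable_Collect2 Dp_in[OF f2] tm_intros tm_const e empty_subsetI)
    moreover have "(x \<in> tuples M \<sigma> \<and> y \<in> tuples M \<rho> \<and> x @ e @ y \<in> ?F) \<longleftrightarrow> x \<in> tuples M \<sigma> \<and> y = g x" for x y
      using graph[of x y] gT by blast
    ultimately show "definable L M A (\<sigma> @ \<rho>) {a @ g a | a. a \<in> tuples M \<sigma>}" by (simp add: conj_commute)
    have "eqv e" unfolding eqv_def using R SR by blast
    then show "g a = g b \<longleftrightarrow> R a b" if "a \<in> tuples M \<sigma>" "b \<in> tuples M \<sigma>" for a b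
      using f(3)[OF that[THEN xe]] SR[OF that] R(1) that by (auto simp: g_def K_def length_tuples)
  qed
qed

text \<open>The relation \<open>R\<close> is an equivalence only on pairs from \<open>P\<close>. It
  is extended by equality to all pairs, which stays \<open>A\<close>-definable because
  \<open>P\<close> is.\<close>

lemma elimination_pairs:
  assumes EI: "elimination_of_imaginaries L M" and P: "definable L M A \<sigma> P"
    and R: "\<And>a b. a \<in> P \<Longrightarrow> b \<in> P \<Longrightarrow> R a b a b"
      "\<And>a b a' b'. \<lbrakk>a \<in> P; b \<in> P; a' \<in> P; b' \<in> P; R a b a' b'\<rbrakk> \<Longrightarrow> R a' b' a b"
      "\<And>a b a' b' a'' b''. \<lbrakk>a \<in> P; b \<in> P; a' \<in> P; b' \<in> P; a'' \<in> P; b'' \<in> P; R a b a' b'; R a' b' a'' b''\<rbrakk> \<Longrightarrow> R a b a'' b''"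
    and def: "\<And>\<Gamma> x y z w. \<lbrakk>tm M A \<Gamma> x \<sigma>; tm M A \<Gamma> y \<sigma>; tm M A \<Gamma> z \<sigma>; tm M A \<Gamma> w \<sigma>\<rbrakk>
      \<Longrightarrow> Dp L M A \<Gamma> (\<lambda>e. R (x e) (y e) (z e) (w e))"
  obtains \<rho> f where "f \<in> tuples M (\<sigma> @ \<sigma>) \<rightarrow> tuples M \<rho>"
    "definable L M A ((\<sigma> @ \<sigma>) @ \<rho>) {u @ f u | u. u \<in> tuples M (\<sigma> @ \<sigma>)}"
    "\<And>a b a' b'. \<lbrakk>a \<in> P; b \<in> P; a' \<in> P; b' \<in> P\<rbrakk> \<Longrightarrow> f (a @ b) = f (a' @ b') \<longleftrightarrow> R a b a' b'"
proof -
  have PT: "P \<subseteq> tuples M \<sigma>" by (rule definable_sub[OF P])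
  let ?t = "take (length \<sigma>)" and ?d = "drop (length \<sigma>)"
  define K where "K u v \<longleftrightarrow> u = v \<or> ?t u \<in> P \<and> ?d u \<in> P \<and> ?t v \<in> P \<and> ?d v \<in> P \<and> R (?t u) (?d u) (?t v) (?d v)" for u v
  show thesis
  proof (rule elimination_with_parameters[OF EI, of "\<sigma> @ \<sigma>" K A])
    show "K u u" for u by (simp add: K_def)
    show "K v u" if "K u v" for u v using that R(2) unfolding K_def by blast
    show "K u w" if "K u v" "K v w" for u v w
      using that R(3)[of "?t u" "?d u" "?t v" "?d v" "?t w" "?d w"] unfolding K_def by (elim disjE conjE) simp_all
    show "Dp L M A [\<sigma> @ \<sigma>, \<sigma> @ \<sigma>] (\<lambda>e. K (hd e) (hd (tl e)))"
      unfolding K_def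
      by (intro Dp_disj Dp_conj def Dp_in[OF P] Dp_eq[of _ _ _ _ "\<sigma> @ \<sigma>"] tm_take[of _ _ _ _ \<sigma> \<sigma>]
          tm_drop[of _ _ _ _ \<sigma> \<sigma>] tm_hd tm_tl subset_refl)
  next
    fix \<rho> f assume f: "f \<in> tuples M (\<sigma> @ \<sigma>) \<rightarrow> tuples M \<rho>"
      "definable L M A ((\<sigma> @ \<sigma>) @ \<rho>) {a @ f a | a. a \<in> tuples M (\<sigma> @ \<sigma>)}"
      "\<And>a b. a \<in> tuples M (\<sigma> @ \<sigma>) \<Longrightarrow> b \<in> tuples M (\<sigma> @ \<sigma>) \<Longrightarrow> f a = f b \<longleftrightarrow> K a b"
    show thesis
    proof (rule that[OF f(1,2)])
      fix a b a' b' assume *: "a \<in> P" "b \<in> P" "a' \<in> P" "b' \<in> P"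
      then have T: "a \<in> tuples M \<sigma>" "b \<in> tuples M \<sigma>" "a' \<in> tuples M \<sigma>" "b' \<in> tuples M \<sigma>" using PT by auto
      then have "f (a @ b) = f (a' @ b') \<longleftrightarrow> K (a @ b) (a' @ b')" by (intro f(3) append_in_tuples)
      then show "f (a @ b) = f (a' @ b') \<longleftrightarrow> R a b a' b'"
        using * R(1)[OF *(1,2)] T[THEN length_tuples] by (auto simp: K_def)
    qed
  qed
qed

section \<open>Types\<close>

lemma sols_definable: "\<psi> \<in> pfms L M A \<sigma> \<Longrightarrow> definable L M A \<sigma> (sols M \<sigma> \<psi>)"
  by (auto simp: definable_def)

lemma type_decides:
  assumes "q \<in> types L M A \<sigma>" "definable L M A \<sigma> X"
  shows "\<exists>\<psi>\<in>q. sols M \<sigma> \<psi> = X \<or> sols M \<sigma> \<psi> = tuples M \<sigma> - X"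
proof -
  obtain \<phi> bs where *: "(\<phi>, bs) \<in> pfms L M A \<sigma>" "X = sols M \<sigma> (\<phi>, bs)"
    using assms(2) by (auto simp: definable_def)
  have "sols M \<sigma> (Neg \<phi>, bs) = tuples M \<sigma> - X" unfolding *(2) by (auto simp: sols_def)
  moreover have "(\<phi>, bs) \<in> q \<or> (Neg \<phi>, bs) \<in> q" using assms(1) *(1) by (auto simp: types_def)
  ultimately show ?thesis using *(2) by blast
qed

lemma realizations_mono: "p0 \<subseteq> p \<Longrightarrow> realizations M \<sigma> p \<subseteq> realizations M \<sigma> p0"
  by (auto simp: realizations_def)

lemma type_complete:
  assumes "p \<in> types L M A \<sigma>" "definable L M A \<sigma> X" "a \<in> realizations M \<sigma> p" "a \<in> X"
  shows "realizations M \<sigma> p \<subseteq> X"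
  using type_decides[OF assms(1,2)] assms(3,4) by (fastforce simp: realizations_def)

lemma definable_realizations:
  assumes "finite p0" "p0 \<subseteq> pfms L M A \<sigma>"
  shows "definable L M A \<sigma> (realizations M \<sigma> p0)"
proof -
  have "definable L M A \<sigma> {x \<in> tuples M \<sigma>. \<forall>X\<in>sols M \<sigma> ` p0. x \<in> X}"
    using assms by (intro definable_Inter) (auto intro: sols_definable)
  then show ?thesis by (simp add: realizations_def)
qed

text \<open>The complete type \<open>q\<close> decides \<open>X\<close> by a formula that a finite
  part of \<open>p\<close> implies. This formula holds at \<open>a\<close>, so it defines
  \<open>X\<close> and not the complement.\<close>

lemma weakly_orthogonal_decides:
  assumes "weakly_orthogonal L M B C \<sigma> p" "definable L M (B \<union> coords C) \<sigma> X"
    and a: "a \<in> realizations M \<sigma> p" "a \<in> X"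
  obtains p0 where "finite p0" "p0 \<subseteq> p" "realizations M \<sigma> p0 \<subseteq> X"
proof -
  obtain q where q: "q \<in> types L M (B \<union> coords C) \<sigma>"
    "\<And>\<psi>. \<psi> \<in> q \<Longrightarrow> \<exists>p0\<subseteq>p. finite p0 \<and> realizations M \<sigma> p0 \<subseteq> sols M \<sigma> \<psi>"
    using assms(1) unfolding weakly_orthogonal_def by blast
  obtain \<psi> where \<psi>: "\<psi> \<in> q" "sols M \<sigma> \<psi> = X \<or> sols M \<sigma> \<psi> = tuples M \<sigma> - X"
    using type_decides[OF q(1) assms(2)] by blast
  obtain p0 where p0: "p0 \<subseteq> p" "finite p0" "realizations M \<sigma> p0 \<subseteq> sols M \<sigma> \<psi>" using q(2)[OF \<psi>(1)] by blast
  have "a \<in> sols M \<sigma> \<psi>" using p0 a(1) realizations_mono[OF p0(1)] by blast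
  then show thesis using \<psi>(2) p0 a(2) that by blast
qed

lemma definable_tuple_dcl:
  assumes dis: "disjoint_family (univ M)" and b: "b \<in> tuples M \<sigma>" "set b \<subseteq> dcl L M A"
  shows "definable L M A \<sigma> {b}"
proof -
  have d: "definable L M A [\<sigma> ! i] {[b ! i]}" if i: "i < length \<sigma>" for i
  proof -
    have "b ! i \<in> dcl L M A" using b length_tuples[OF b(1)] i by (metis nth_mem subsetD)
    then obtain s where s: "b ! i \<in> univ M s" "definable L M A [s] {[b ! i]}" by (auto simp: dcl_def)
    have "[b ! i] \<in> tuples M [s]" "[b ! i] \<in> tuples M [\<sigma> ! i]" using s(1) nth_in_univ[OF b(1) i] by auto
    then have "[s] = [\<sigma> ! i]" by (rule tuples_sorts_unique[OF dis])
    then show ?thesis using s(2) by simp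
  qed
  have "Dp L M A [\<sigma>] (\<lambda>e. \<forall>i\<in>{..<length \<sigma>}. [hd e ! i] \<in> {[b ! i]})"
    by (intro Dp_finite_all finite_lessThan Dp_in[OF d _ tm_nth[OF tm_hd]]) auto
  then have "definable L M A \<sigma> {x \<in> tuples M \<sigma>. \<forall>i\<in>{..<length \<sigma>}. [x ! i] \<in> {[b ! i]}}"
    by (rule definable_Collect)
  moreover have "{x \<in> tuples M \<sigma>. \<forall>i\<in>{..<length \<sigma>}. [x ! i] \<in> {[b ! i]}} = {b}"
    using b(1) by (auto simp: length_tuples intro!: nth_equalityI)
  ultimately show ?thesis by simp
qed

lemma dcl_tupleI:
  assumes "definable L M A \<sigma> {b}"
  shows "set b \<subseteq> dcl L M A"
proof
  fix z assume "z \<in> set b"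
  have b: "b \<in> tuples M \<sigma>" using definable_sub[OF assms] by blast
  obtain i where i: "i < length \<sigma>" "z = b ! i"
    using \<open>z \<in> set b\<close> length_tuples[OF b] by (metis in_set_conv_nth)
  have "definable L M A [\<sigma> ! i] {w \<in> tuples M [\<sigma> ! i]. \<exists>y\<in>{b}. w = [y ! i]}"
    by (intro definable_Collect Dp_exX[OF assms] Dp_eq[of _ _ _ _ "[\<sigma> ! i]"] tm_nth tm_intros i(1) subset_refl)
  moreover have "{w \<in> tuples M [\<sigma> ! i]. \<exists>y\<in>{b}. w = [y ! i]} = {[z]}"
    using i nth_in_univ[OF b i(1)] by auto
  ultimately show "z \<in> dcl L M A"
    unfolding dcl_def using nth_in_univ[OF b i(1)] i(2) by auto
qed

section \<open>Internality\<close>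

text \<open>An arbitrary definable set \<open>F\<close> serves as a partial function from
  \<open>(a, c)\<close> to \<open>b\<close>, defined where its fibre is a singleton.\<close>

definition val ::
  "('f, 'r, 's, 'm) struct \<Rightarrow> 's list \<Rightarrow> 'm list set \<Rightarrow> 'm list \<Rightarrow> 'm list \<Rightarrow> 'm list \<Rightarrow> bool" where
  "val M \<sigma> F a c b \<longleftrightarrow> (\<forall>x\<in>tuples M \<sigma>. x @ a @ c \<in> F \<longleftrightarrow> x = b)"

lemma val_unique: "val M \<sigma> F a c b \<Longrightarrow> val M \<sigma> F a c b' \<Longrightarrow> b \<in> tuples M \<sigma> \<Longrightarrow> b = b'"
  unfolding val_def by blast

lemma Dp_val:
  assumes F: "definable L M A' (\<sigma> @ \<xi> @ \<tau>) F" "A' \<subseteq> A"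
    and xyz: "tm M A \<Gamma> x \<xi>" "tm M A \<Gamma> y \<tau>" "tm M A \<Gamma> z \<sigma>"
  shows "Dp L M A \<Gamma> (\<lambda>e. val M \<sigma> F (x e) (y e) (z e))"
  unfolding val_def
  by (intro Dp_all Dp_iff Dp_in[OF F] Dp_eq[of _ _ _ _ \<sigma>] tm_intros xyz)

text \<open>A definition of \<open>b\<close> uses finitely many elements of \<open>C\<close>, all
  contained in one tuple \<open>c\<close> from a power of \<open>C\<close>; then \<open>a\<close>
  and \<open>c\<close> are made variables.\<close>

lemma internal_val:
  assumes dis: "disjoint_family (univ M)" and C: "definable L M B \<gamma> C"
    and a: "a \<in> tuples M \<xi>" and b: "b \<in> tuples M \<sigma>" "set b \<subseteq> dcl L M (B \<union> set a \<union> coords C)"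
  obtains n F c where "definable L M B (\<sigma> @ \<xi> @ power_sort \<gamma> n) F" "c \<in> power_set C n" "val M \<sigma> F a c b"
proof -
  have "definable L M (B \<union> set a \<union> coords C) \<sigma> {b}" by (rule definable_tuple_dcl[OF dis b])
  then obtain Z where Z: "finite Z" "Z \<subseteq> coords C" "definable L M (B \<union> set a \<union> Z) \<sigma> {b}"
    by (rule definable_finite_params)
  obtain n c where c: "c \<in> power_set C n" "Z \<subseteq> set c" using finite_coords_power_set[OF Z(1,2)] by blast
  have "definable L M (B \<union> set (a @ c)) \<sigma> {b}" using definable_mono[OF Z(3)] c(2) by auto
  moreover have "a @ c \<in> tuples M (\<xi> @ power_sort \<gamma> n)"
    using a c(1) definable_sub[OF definable_power_set[OF C]] by (auto intro: append_in_tuples)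
  ultimately show thesis
  proof (rule definable_pull[OF dis])
    fix F assume F: "definable L M B (\<sigma> @ \<xi> @ power_sort \<gamma> n) F" "{b} = {x \<in> tuples M \<sigma>. x @ a @ c \<in> F}"
    have "val M \<sigma> F a c b" using F(2) unfolding val_def by blast
    then show thesis by (rule that[OF F(1) c(1)])
  qed
qed

definition reach ::
  "('f, 'r, 's, 'm) struct \<Rightarrow> 's list \<Rightarrow> 'm list set \<Rightarrow> (nat \<times> 'm list set) set \<Rightarrow> 'm list \<Rightarrow> 'm list \<Rightarrow> bool" where
  "reach M \<sigma> C \<F> a b \<longleftrightarrow> (\<exists>i\<in>\<F>. \<exists>c\<in>power_set C (fst i). val M \<sigma> (snd i) a c b)"

text \<open>On realizations of \<open>p\<close> this says that some automorphism over \<open>B \<union> C\<close> takes \<open>a\<close> to \<open>b\<close> and \<open>a'\<close> to \<open>b'\<close>.\<close>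

definition transport ::
  "('f, 'r, 's, 'm) struct \<Rightarrow> 's list \<Rightarrow> 'm list set \<Rightarrow> (nat \<times> 'm list set) set
    \<Rightarrow> 'm list \<Rightarrow> 'm list \<Rightarrow> 'm list \<Rightarrow> 'm list \<Rightarrow> bool" where
  "transport M \<sigma> C \<F> a b a' b' \<longleftrightarrow>
     (\<exists>i\<in>\<F>. \<exists>c\<in>power_set C (fst i). val M \<sigma> (snd i) a c a' \<and> val M \<sigma> (snd i) b c b')"

lemma Dp_reach:
  assumes "finite \<F>" "\<And>i. i \<in> \<F> \<Longrightarrow> definable L M B (\<sigma> @ \<sigma> @ power_sort \<gamma> (fst i)) (snd i)"
    and "definable L M B \<gamma> C" and BA: "B \<subseteq> A" and xy: "tm M A \<Gamma> x \<sigma>" "tm M A \<Gamma> y \<sigma>"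
  shows "Dp L M A \<Gamma> (\<lambda>e. reach M \<sigma> C \<F> (x e) (y e))"
  unfolding reach_def
  by (intro Dp_finite_ex assms(1) Dp_exX[OF definable_power_set[OF assms(3)] BA] Dp_val[OF assms(2) BA] tm_intros xy)

lemma Dp_transport:
  assumes "finite \<F>" "\<And>i. i \<in> \<F> \<Longrightarrow> definable L M B (\<sigma> @ \<sigma> @ power_sort \<gamma> (fst i)) (snd i)"
    and "definable L M B \<gamma> C" and BA: "B \<subseteq> A"
    and xy: "tm M A \<Gamma> x \<sigma>" "tm M A \<Gamma> y \<sigma>" "tm M A \<Gamma> z \<sigma>" "tm M A \<Gamma> w \<sigma>"
  shows "Dp L M A \<Gamma> (\<lambda>e. transport M \<sigma> C \<F> (x e) (y e) (z e) (w e))"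
  unfolding transport_def
  by (intro Dp_finite_ex assms(1) Dp_exX[OF definable_power_set[OF assms(3)] BA] Dp_conj Dp_val[OF assms(2) BA] tm_intros xy)

text \<open>If no finite choice sufficed, a realization of \<open>p\<close> could avoid every
  partial function \<open>i\<close>, contradicting internality. Compactness applies because avoiding
  \<open>i\<close> quantifies over \<open>c\<close> and hence is definable over \<open>B\<close> and
  \<open>a\<close> alone, a small set.\<close>

lemma uniform_internality:
  assumes S: "lang_structure L M" and ss: "sufficiently_saturated L M \<kappa>"
    and B: "B \<subseteq> elements M" "|B| <o \<kappa>" and C: "definable L M B \<gamma> C"
    and p: "p \<in> types L M B \<sigma>" and a: "a \<in> realizations M \<sigma> p"
    and int: "coords (realizations M \<sigma> p) \<subseteq> dcl L M (B \<union> set a \<union> coords C)"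
  obtains p0 \<F> where "finite p0" "p0 \<subseteq> p" "finite \<F>"
    "\<And>i. i \<in> \<F> \<Longrightarrow> definable L M B (\<sigma> @ \<sigma> @ power_sort \<gamma> (fst i)) (snd i)"
    "\<And>x. x \<in> realizations M \<sigma> p0 \<Longrightarrow> reach M \<sigma> C \<F> a x"
proof -
  have dis: "disjoint_family (univ M)" using S by (simp add: lang_structure_def)
  have aT: "a \<in> tuples M \<sigma>" using a by (simp add: realizations_def)
  have pp: "p \<subseteq> pfms L M B \<sigma>" using p by (simp add: types_def)
  let ?I = "{i. definable L M B (\<sigma> @ \<sigma> @ power_sort \<gamma> (fst i)) (snd i)}"
  let ?A = "B \<union> set a"
  define N where "N i = {x \<in> tuples M \<sigma>. \<not> reach M \<sigma> C {i} a x}" for i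
  have N: "definable L M ?A \<sigma> (N i)" if "i \<in> ?I" for i
    unfolding N_def using that aT
    by (intro definable_Collect Dp_not Dp_reach[OF _ _ C] tm_intros tm_const) auto
  have "\<exists>p0 \<F>. finite p0 \<and> p0 \<subseteq> p \<and> finite \<F> \<and> \<F> \<subseteq> ?I \<and> (\<forall>x\<in>realizations M \<sigma> p0. reach M \<sigma> C \<F> a x)"
  proof (rule ccontr)
    assume H: "\<not> ?thesis"
    have "\<exists>x\<in>tuples M \<sigma>. \<forall>X\<in>sols M \<sigma> ` p \<union> N ` ?I. x \<in> X"
    proof (rule saturated_Inter)
      show "saturated L M \<kappa>" using ss by (simp add: sufficiently_saturated_def)
      show "?A \<subseteq> elements M" using B(1) set_tuples[OF aT] by simp
      show "|?A| <o \<kappa>" using small_insert[OF ss B(2)] by simp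
      show "definable L M ?A \<sigma> X" if "X \<in> sols M \<sigma> ` p \<union> N ` ?I" for X
        using that
      proof
        assume "X \<in> sols M \<sigma> ` p"
        then have "definable L M B \<sigma> X" using pp sols_definable by blast
        then show ?thesis by (rule definable_mono) simp
      qed (use N in blast)
      fix \<F>' assume fin: "finite \<F>'" "\<F>' \<subseteq> sols M \<sigma> ` p \<union> N ` ?I"
      obtain p0 where p0: "p0 \<subseteq> p" "finite p0" "\<F>' \<inter> sols M \<sigma> ` p = sols M \<sigma> ` p0"
        using finite_subset_image[of "\<F>' \<inter> sols M \<sigma> ` p" "sols M \<sigma>" p] fin(1) by auto
      obtain J where J: "J \<subseteq> ?I" "finite J" "\<F>' \<inter> N ` ?I = N ` J"
        using finite_subset_image[of "\<F>' \<inter> N ` ?I" N ?I] fin(1) by auto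
      obtain x where x: "x \<in> realizations M \<sigma> p0" "\<not> reach M \<sigma> C J a x" using H p0(1,2) J(1,2) by blast
      have xT: "x \<in> tuples M \<sigma>" using x(1) by (simp add: realizations_def)
      have "x \<in> X" if X: "X \<in> \<F>'" for X
      proof -
        have "X \<in> \<F>' \<inter> sols M \<sigma> ` p \<or> X \<in> \<F>' \<inter> N ` ?I" using X fin(2) by (meson IntI UnE subsetD)
        then have "X \<in> sols M \<sigma> ` p0 \<or> X \<in> N ` J" by (simp only: p0(3) J(3))
        then show ?thesis using x xT by (auto simp: realizations_def N_def reach_def)
      qed
      then show "\<exists>x\<in>tuples M \<sigma>. \<forall>X\<in>\<F>'. x \<in> X" using xT by blast
    qed
    then obtain x where x: "x \<in> tuples M \<sigma>" "x \<in> realizations M \<sigma> p" "\<And>i. i \<in> ?I \<Longrightarrow> x \<in> N i"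
      by (auto simp: realizations_def)
    have "set x \<subseteq> dcl L M (B \<union> set a \<union> coords C)" using int x(2) by (auto simp: coords_def)
    then obtain n F c where "definable L M B (\<sigma> @ \<sigma> @ power_sort \<gamma> n) F" "c \<in> power_set C n" "val M \<sigma> F a c x"
      using internal_val[OF dis C aT x(1)] by blast
    then show False using x(3)[of "(n, F)"] by (auto simp: N_def reach_def)
  qed
  then obtain p0 \<F> where *: "finite p0" "p0 \<subseteq> p" "finite \<F>" "\<F> \<subseteq> ?I"
    "\<forall>x\<in>realizations M \<sigma> p0. reach M \<sigma> C \<F> a x" by blast
  show thesis
    by (rule that[of p0 \<F>]) (use * in auto)
qed

text \<open>Choose \<open>b \<in> \<Theta>\<close> with isolated type over \<open>B \<union> C\<close>. As \<open>a\<close> is definable over \<open>b\<close> and \<open>B \<union> C\<close>, its type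
  over \<open>B \<union> C\<close> is isolated too, and \<open>p\<close> implies this type.\<close>

lemma isolated_type:
  assumes S: "lang_structure L M" and tt: "totally_transcendental L M"
    and B: "B \<subseteq> elements M" and C: "definable L M B \<gamma> C"
    and p: "p \<in> types L M B \<sigma>" and a: "a \<in> realizations M \<sigma> p"
    and wo: "weakly_orthogonal L M B C \<sigma> p"
    and \<F>: "finite \<F>" "\<And>i. i \<in> \<F> \<Longrightarrow> definable L M B (\<sigma> @ \<sigma> @ power_sort \<gamma> (fst i)) (snd i)"
    and \<Theta>: "definable L M B \<sigma> \<Theta>" "a \<in> \<Theta>" "\<And>b. b \<in> \<Theta> \<Longrightarrow> reach M \<sigma> C \<F> b a"
  shows "definable L M B \<sigma> (realizations M \<sigma> p)"
proof -
  let ?A = "B \<union> coords C"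
  have pp: "p \<subseteq> pfms L M B \<sigma>" using p by (simp add: types_def)
  have aT: "a \<in> tuples M \<sigma>" using a by (simp add: realizations_def)
  have "definable L M ?A \<sigma> \<Theta>" "\<Theta> \<noteq> {}" using definable_mono[OF \<Theta>(1)] \<Theta>(2) by auto
  then obtain \<Psi> where \<Psi>: "definable L M ?A \<sigma> \<Psi>" "\<Psi> \<subseteq> \<Theta>" "\<Psi> \<noteq> {}"
    "\<And>Z. definable L M ?A \<sigma> Z \<Longrightarrow> \<Psi> \<subseteq> Z \<or> \<Psi> \<inter> Z = {}"
    using ex_definable_atom[OF tt, of ?A \<sigma> \<Theta>] B coords_elements[OF C] by blast
  obtain b where b: "b \<in> \<Psi>" using \<Psi>(3) by blast
  then have "reach M \<sigma> C \<F> b a" using \<Psi>(2) \<Theta>(3) by blast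
  then obtain i c where i: "i \<in> \<F>" and c: "c \<in> power_set C (fst i)" and v: "val M \<sigma> (snd i) b c a"
    unfolding reach_def by blast
  have cT: "c \<in> tuples M (power_sort \<gamma> (fst i))" using c definable_sub[OF definable_power_set[OF C]] by blast
  have cA: "set c \<subseteq> ?A" using coords_power_set[OF c] by blast
  \<comment> \<open>The image of the atom \<open>\<Psi>\<close> under the partial map given by
    \<open>i\<close> and \<open>c\<close>.\<close>
  define Z where "Z = {x \<in> tuples M \<sigma>. \<exists>y\<in>\<Psi>. val M \<sigma> (snd i) y c x}"
  have Zdef: "definable L M ?A \<sigma> Z" unfolding Z_def
    by (intro definable_Collect Dp_exX[OF \<Psi>(1)] Dp_val[OF \<F>(2)[OF i]] tm_intros tm_const cT cA) auto
  have aZ: "a \<in> Z" using aT b v by (auto simp: Z_def)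
  \<comment> \<open>If \<open>Y\<close> contains \<open>a\<close>, its preimage meets the atom
    \<open>\<Psi>\<close> in \<open>b\<close> and therefore contains it.\<close>
  have atom: "Z \<subseteq> Y" if Y: "definable L M ?A \<sigma> Y" "a \<in> Y" for Y
  proof -
    let ?Y' = "{y \<in> tuples M \<sigma>. \<exists>x\<in>Y. val M \<sigma> (snd i) y c x}"
    have "definable L M ?A \<sigma> ?Y'"
      by (intro definable_Collect Dp_exX[OF Y(1)] Dp_val[OF \<F>(2)[OF i]] tm_intros tm_const cT cA) auto
    moreover have "b \<in> ?Y'" using b v Y(2) definable_sub[OF \<Psi>(1)] by blast
    ultimately have "\<Psi> \<subseteq> ?Y'" using \<Psi>(4) b by blast
    then show ?thesis unfolding Z_def using val_unique by blast
  qed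
  obtain p0 where p0: "finite p0" "p0 \<subseteq> p" "realizations M \<sigma> p0 \<subseteq> Z"
    using weakly_orthogonal_decides[OF wo Zdef a aZ] by blast
  \<comment> \<open>\<open>p0\<close> implies \<open>Z\<close>, and \<open>Z\<close> implies each
    formula of \<open>p\<close>; so the finite part \<open>p0\<close> isolates
    \<open>p\<close>.\<close>
  have "realizations M \<sigma> p0 \<subseteq> realizations M \<sigma> p"
  proof
    fix x assume x: "x \<in> realizations M \<sigma> p0"
    have "x \<in> sols M \<sigma> \<psi>" if \<psi>: "\<psi> \<in> p" for \<psi>
    proof -
      have "definable L M B \<sigma> (sols M \<sigma> \<psi>)" using \<psi> pp sols_definable by blast
      then have "definable L M ?A \<sigma> (sols M \<sigma> \<psi>)" by (rule definable_mono) simp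
      moreover have "a \<in> sols M \<sigma> \<psi>" using a \<psi> by (simp add: realizations_def)
      ultimately show ?thesis using atom p0(3) x by blast
    qed
    then show "x \<in> realizations M \<sigma> p" using x by (simp add: realizations_def)
  qed
  then have "realizations M \<sigma> p = realizations M \<sigma> p0" using realizations_mono[OF p0(2)] by blast
  then show ?thesis using definable_realizations[OF p0(1)] p0(2) pp by auto
qed

lemma val_automorphism:
  assumes S: "lang_structure L M" and h: "h \<in> automorphisms L M A"
    and F: "definable L M A (\<sigma> @ \<sigma> @ \<tau>) F" and c: "c \<in> tuples M \<tau>" "set c \<subseteq> A"
    and ab: "a \<in> tuples M \<sigma>" "b \<in> tuples M \<sigma>"
  shows "val M \<sigma> F (map h a) c (map h b) \<longleftrightarrow> val M \<sigma> F a c b"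
proof -
  have D: "definable L M A (\<sigma> @ \<sigma>) {x @ y | x y. x \<in> tuples M \<sigma> \<and> y \<in> tuples M \<sigma> \<and> val M \<sigma> F x c y}"
    (is "definable _ _ _ _ ?X")
    by (intro definable_Collect2 Dp_val[OF F] tm_intros tm_const c subset_refl)
  have iff: "x @ y \<in> ?X \<longleftrightarrow> val M \<sigma> F x c y" if "x \<in> tuples M \<sigma>" "y \<in> tuples M \<sigma>" for x y
  proof
    assume "x @ y \<in> ?X"
    then obtain x' y' where *: "x @ y = x' @ y'" "x' \<in> tuples M \<sigma>" "val M \<sigma> F x' c y'" by blast
    then have "length x = length x'" using that length_tuples by metis
    then show "val M \<sigma> F x c y" using * by simp
  qed (use that in blast)
  have "map h (a @ b) \<in> ?X \<longleftrightarrow> a @ b \<in> ?X"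
    using automorphism_definable[OF S h D] ab by (intro automorphism_definable[OF S h D] append_in_tuples)
  then show ?thesis using iff[of a b] iff[of "map h a" "map h b"] ab automorphism_tuples[OF h] by simp
qed

section \<open>The binding group and the bitorsor\<close>

theorem theorem2p12:
  fixes L :: "('f, 'r, 's) lang"
    and T :: "('f, 'r, 's) fm set"
    and M :: "('f, 'r, 's, 'm) struct"
    and \<kappa> :: "'k rel"
    and B :: "'m set"
    and C :: "'m list set"
    and \<gamma> \<sigma> :: "'s list"
    and p :: "('f, 'r, 's, 'm) pfm set"
  assumes "complete_theory L T"
    and "model_of L T M"
    and "sufficiently_saturated L M \<kappa>"
    and "totally_transcendental L M"
    and "quantifier_elimination L M"
    and "elimination_of_imaginaries L M"
    and "B \<subseteq> elements M" and "|B| <o \<kappa>"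
    and "definable L M B \<gamma> C"
    and "p \<in> types L M B \<sigma>"
    and "fundamental_internal L M B C \<sigma> p"
    and "weakly_orthogonal L M B C \<sigma> p"
  shows "\<exists>\<rho> G l \<eta> H r.
     definable_bitorsor L M B \<rho> G l \<sigma> (realizations M \<sigma> p) \<eta> H r \<and>
     binding_group L M B C \<sigma> p \<rho> G l \<and>
     coords (carrier H) \<subseteq> dcl L M (B \<union> coords C)"
proof -
  note ss = assms(3) and tt = assms(4) and EI = assms(6) and B = assms(7,8) and C = assms(9) and p = assms(10)
    and wo = assms(12)
  have S: "lang_structure L M" using assms(2) by (simp add: model_of_def)
  have dis: "disjoint_family (univ M)" using S by (simp add: lang_structure_def)
  define P where "P = realizations M \<sigma> p"
  let ?A = "B \<union> coords C"

  \<comment> \<open>Uniform internality and definability of \<open>P\<close>\<close>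
  obtain a0 where a0: "a0 \<in> P" "coords P \<subseteq> dcl L M (B \<union> set a0 \<union> coords C)"
    using assms(11) by (auto simp: fundamental_internal_def P_def)
  obtain p0 \<F> where p0: "finite p0" "p0 \<subseteq> p" and \<F>: "finite \<F>"
    "\<And>i. i \<in> \<F> \<Longrightarrow> definable L M B (\<sigma> @ \<sigma> @ power_sort \<gamma> (fst i)) (snd i)"
    and reach0: "\<And>x. x \<in> realizations M \<sigma> p0 \<Longrightarrow> reach M \<sigma> C \<F> a0 x"
    using uniform_internality[OF S ss B C p a0[unfolded P_def]] by blast
  let ?reach = "reach M \<sigma> C \<F>" and ?Q = "transport M \<sigma> C \<F>"
  have Pp0: "P \<subseteq> realizations M \<sigma> p0" unfolding P_def by (rule realizations_mono[OF p0(2)])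
  have PT: "P \<subseteq> tuples M \<sigma>" by (auto simp: P_def realizations_def)
  \<comment> \<open>\<open>a0\<close> reaches every realization of \<open>p0\<close>. This is a
    \<open>B\<close>-definable property, so all of \<open>P\<close> shares it, and the choice of
    \<open>a0\<close> no longer matters.\<close>
  define \<Theta> where "\<Theta> = {b \<in> tuples M \<sigma>. \<forall>x\<in>realizations M \<sigma> p0. ?reach b x}"
  have p0def: "definable L M B \<sigma> (realizations M \<sigma> p0)"
    using p0 p by (intro definable_realizations) (auto simp: types_def)
  have \<Theta>def: "definable L M B \<sigma> \<Theta>" unfolding \<Theta>_def
    by (intro definable_Collect Dp_allX[OF p0def] Dp_reach[OF \<F> C] tm_intros) auto
  have a0\<Theta>: "a0 \<in> \<Theta>" using a0(1) PT reach0 by (auto simp: \<Theta>_def)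
  have P\<Theta>: "P \<subseteq> \<Theta>" using type_complete[OF p \<Theta>def] a0(1) a0\<Theta> by (simp add: P_def)
  have reach: "?reach a b" if "a \<in> P" "b \<in> P" for a b using P\<Theta> Pp0 that by (auto simp: \<Theta>_def)
  have Pdef: "definable L M B \<sigma> P" unfolding P_def
    by (rule isolated_type[OF S tt B(1) C p a0(1)[unfolded P_def] wo \<F> \<Theta>def a0\<Theta>])
      (use a0(1) Pp0 in \<open>auto simp: \<Theta>_def\<close>)

  \<comment> \<open>Transitivity on \<open>P\<close> of the automorphisms over \<open>B\<close> and
    \<open>C\<close>\<close>
  have autP: "map h a \<in> P" if "h \<in> automorphisms L M ?A" "a \<in> P" for h a
    using automorphism_definable[OF S that(1), of \<sigma> P] definable_mono[OF Pdef, of ?A] that(2) PT by auto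
  have homog: "\<exists>h\<in>automorphisms L M ?A. map h a = b" if ab: "a \<in> P" "b \<in> P" for a b
  proof -
    have "a \<in> X \<longleftrightarrow> b \<in> X" if X: "definable L M ?A \<sigma> X" for X
    proof -
      \<comment> \<open>By weak orthogonality, a set definable over \<open>B\<close> and
        \<open>C\<close> that meets \<open>P\<close> contains it.\<close>
      have "y \<in> X" if xy: "x \<in> P" "y \<in> P" "x \<in> X" for x y
      proof -
        obtain p1 where "p1 \<subseteq> p" "realizations M \<sigma> p1 \<subseteq> X"
          using weakly_orthogonal_decides[OF wo X, of x] xy(1,3) unfolding P_def by metis
        then show ?thesis using xy(2) realizations_mono[of p1 p M \<sigma>] unfolding P_def by (meson subsetD)
      qed
      then show ?thesis using ab by blast
    qed
    then show ?thesis using homogeneity[OF S ss tt C B, of a \<sigma> b] ab PT by blast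
  qed

  \<comment> \<open>The transport relation on \<open>P\<close>\<close>
  have power: "c \<in> tuples M (power_sort \<gamma> n)" "set c \<subseteq> ?A" if "c \<in> power_set C n" for c n
    using that definable_sub[OF definable_power_set[OF C]] coords_power_set by blast+
  have val_aut: "val M \<sigma> (snd i) (map h a) c (map h b) \<longleftrightarrow> val M \<sigma> (snd i) a c b"
    if "h \<in> automorphisms L M ?A" "i \<in> \<F>" "c \<in> power_set C (fst i)" "a \<in> P" "b \<in> P" for h i c a b
    by (rule val_automorphism[OF S that(1) definable_mono[OF \<F>(2)[OF that(2)]] power[OF that(3)]])
      (use that PT in auto)
  \<comment> \<open>Uniqueness of values gives one direction, \<open>reach\<close> the other. It
    follows that \<open>h\<close> is determined on \<open>P\<close> by its value at one point, so
    the action is free.\<close>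
  have Q_aut: "?Q a (map h a) a' b' \<longleftrightarrow> b' = map h a'"
    if h: "h \<in> automorphisms L M ?A" and P: "a \<in> P" "a' \<in> P" "b' \<in> P" for h a a' b'
  proof
    assume "?Q a (map h a) a' b'"
    then obtain i c where i: "i \<in> \<F>" "c \<in> power_set C (fst i)" "val M \<sigma> (snd i) a c a'" "val M \<sigma> (snd i) (map h a) c b'"
      unfolding transport_def by blast
    then have "val M \<sigma> (snd i) (map h a) c (map h a')" using val_aut h P by blast
    then show "b' = map h a'" using val_unique[OF i(4)] P(3) PT by blast
  next
    assume b': "b' = map h a'"
    obtain i c where i: "i \<in> \<F>" "c \<in> power_set C (fst i)" "val M \<sigma> (snd i) a c a'"
      using reach[OF P(1,2)] unfolding reach_def by blast
    then show "?Q a (map h a) a' b'" using val_aut h P b' unfolding transport_def by blast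
  qed
  have Q_refl: "?Q a b a b" if "a \<in> P" "b \<in> P" for a b using homog[OF that] Q_aut that by blast
  have Q_ex: "\<exists>b'\<in>P. ?Q a b a' b'" if "a \<in> P" "b \<in> P" "a' \<in> P" for a b a'
    using homog[OF that(1,2)] Q_aut autP that by blast
  have Q_unique: "b' = b''" if "a \<in> P" "b \<in> P" "a' \<in> P" "b' \<in> P" "b'' \<in> P" "?Q a b a' b'" "?Q a b a' b''" for a b a' b' b''
    using homog[OF that(1,2)] Q_aut that by blast
  have Q_swap: "?Q a b a' b' \<Longrightarrow> ?Q b a b' a'" for a b a' b' unfolding transport_def by blast
  have Q_sym: "?Q a' b' a b" if "a \<in> P" "b \<in> P" "a' \<in> P" "b' \<in> P" "?Q a b a' b'" for a b a' b'
    using homog[OF that(1,2)] Q_aut that by metis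
  have Q_trans: "?Q a b a'' b''"
    if "a \<in> P" "b \<in> P" "a' \<in> P" "b' \<in> P" "a'' \<in> P" "b'' \<in> P" "?Q a b a' b'" "?Q a' b' a'' b''" for a b a' b' a'' b''
    using homog[OF that(1,2)] Q_aut that by metis
  have Q_id: "?Q a a b b" if "a \<in> P" "b \<in> P" for a b
    using reach[OF that] unfolding reach_def transport_def by blast
  have Q_comp: "?Q a c a' c'"
    if P: "a \<in> P" "b \<in> P" "c \<in> P" "a' \<in> P" "b' \<in> P" "c' \<in> P" and Q: "?Q a b a' b'" "?Q b c b' c'" for a b c a' b' c'
  proof -
    \<comment> \<open>The automorphism \<open>k\<close> also takes \<open>b'\<close> to
      \<open>c'\<close>. Applied to the equation that leads from \<open>b\<close> to
      \<open>b'\<close> with parameter \<open>d\<close>, it gives the one from \<open>c\<close> to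
      \<open>c'\<close> with the same \<open>d\<close>.\<close>
    obtain k where k: "k \<in> automorphisms L M ?A" "map k b = c" using homog P by blast
    then have c': "c' = map k b'" using Q_aut P Q(2) by blast
    obtain i d where i: "i \<in> \<F>" "d \<in> power_set C (fst i)" "val M \<sigma> (snd i) a d a'" "val M \<sigma> (snd i) b d b'"
      using Q(1) unfolding transport_def by blast
    then have "val M \<sigma> (snd i) c d c'" using val_aut[OF k(1)] P k(2) c' by blast
    then show ?thesis using i unfolding transport_def by blast
  qed
  have Q_Dp: "Dp L M B \<Gamma> (\<lambda>e. ?Q (x e) (y e) (z e) (w e))"
    if "tm M B \<Gamma> x \<sigma>" "tm M B \<Gamma> y \<sigma>" "tm M B \<Gamma> z \<sigma>" "tm M B \<Gamma> w \<sigma>" for \<Gamma> x y z w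
    by (rule Dp_transport[OF \<F> C subset_refl that])

  \<comment> \<open>Codes for the two quotients of \<open>P \<times> P\<close>\<close>
  obtain \<rho> f where f: "f \<in> tuples M (\<sigma> @ \<sigma>) \<rightarrow> tuples M \<rho>"
    "definable L M B ((\<sigma> @ \<sigma>) @ \<rho>) {u @ f u | u. u \<in> tuples M (\<sigma> @ \<sigma>)}"
    "\<And>a b a' b'. \<lbrakk>a \<in> P; b \<in> P; a' \<in> P; b' \<in> P\<rbrakk> \<Longrightarrow> f (a @ b) = f (a' @ b') \<longleftrightarrow> ?Q b a b' a'"
  \<comment> \<open>Under this relation \<open>f (b @ a)\<close> codes the automorphism that takes
    \<open>a\<close> to \<open>b\<close>; the target comes first to match composition of
    maps.\<close>
  proof (rule elimination_pairs[OF EI Pdef, of "\<lambda>a b a' b'. ?Q b a b' a'"])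
    show "Dp L M B \<Gamma> (\<lambda>e. ?Q (y e) (x e) (w e) (z e))"
      if "tm M B \<Gamma> x \<sigma>" "tm M B \<Gamma> y \<sigma>" "tm M B \<Gamma> z \<sigma>" "tm M B \<Gamma> w \<sigma>" for \<Gamma> x y z w
      using Q_Dp[OF that(2,1,4,3)] .
    show "?Q b a b a" if "a \<in> P" "b \<in> P" for a b using Q_refl[OF that(2,1)] .
    show "?Q b' a' b a" if "a \<in> P" "b \<in> P" "a' \<in> P" "b' \<in> P" "?Q b a b' a'" for a b a' b'
      using Q_sym[OF that(2,1,4,3,5)] .
    show "?Q b a b'' a''" if "a \<in> P" "b \<in> P" "a' \<in> P" "b' \<in> P" "a'' \<in> P" "b'' \<in> P"
      "?Q b a b' a'" "?Q b' a' b'' a''" for a b a' b' a'' b''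
      using Q_trans[OF that(2,1,4,3,6,5,7,8)] .
  qed (rule that)
  obtain \<eta> g where g: "g \<in> tuples M (\<sigma> @ \<sigma>) \<rightarrow> tuples M \<eta>"
    "definable L M B ((\<sigma> @ \<sigma>) @ \<eta>) {u @ g u | u. u \<in> tuples M (\<sigma> @ \<sigma>)}"
    "\<And>a b a' b'. \<lbrakk>a \<in> P; b \<in> P; a' \<in> P; b' \<in> P\<rbrakk> \<Longrightarrow> g (a @ b) = g (a' @ b') \<longleftrightarrow> ?Q a a' b b'"
  \<comment> \<open>Here two pairs are identified when an automorphism over \<open>B\<close> and
    \<open>C\<close> takes one to the other, so that \<open>g (a @ b)\<close> codes the orbit of the
    pair.\<close>
  proof (rule elimination_pairs[OF EI Pdef, of "\<lambda>a b a' b'. ?Q a a' b b'"])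
    show "Dp L M B \<Gamma> (\<lambda>e. ?Q (x e) (z e) (y e) (w e))"
      if "tm M B \<Gamma> x \<sigma>" "tm M B \<Gamma> y \<sigma>" "tm M B \<Gamma> z \<sigma>" "tm M B \<Gamma> w \<sigma>" for \<Gamma> x y z w
      using Q_Dp[OF that(1,3,2,4)] .
    show "?Q a a b b" if "a \<in> P" "b \<in> P" for a b using Q_id[OF that] .
    show "?Q a' a b' b" if "?Q a a' b b'" for a b a' b' using Q_swap[OF that] .
    show "?Q a a'' b b''" if "a \<in> P" "b \<in> P" "a' \<in> P" "b' \<in> P" "a'' \<in> P" "b'' \<in> P"
      "?Q a a' b b'" "?Q a' a'' b' b''" for a b a' b' a'' b''
      using Q_comp[OF that(1,3,5,2,4,6,7,8)] .
  qed (rule that)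
  interpret G: arrows P "\<lambda>a b. f (a @ b)"
  proof
    show "P \<noteq> {}" using a0(1) by blast
    show "\<exists>b'\<in>P. f (a' @ b') = f (a @ b)" if ab: "a \<in> P" "b \<in> P" "a' \<in> P" for a b a'
    proof -
      obtain b' where b': "b' \<in> P" "?Q a b a' b'" using Q_ex[OF ab] by blast
      then have "f (a @ b) = f (a' @ b')" using f(3)[OF ab b'(1)] Q_swap by blast
      then show ?thesis using b'(1) by metis
    qed
    show "b = b'" if "a \<in> P" "b \<in> P" "b' \<in> P" "f (a @ b) = f (a @ b')" for a b b'
    proof -
      have "?Q a b a b'" using f(3) that Q_swap by blast
      then show ?thesis using Q_unique Q_refl that by blast
    qed
    show "f (a @ c) = f (a' @ c')" if "a \<in> P" "b \<in> P" "c \<in> P" "a' \<in> P" "b' \<in> P" "c' \<in> P"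
      "f (a @ b) = f (a' @ b')" "f (b @ c) = f (b' @ c')" for a b c a' b' c'
    proof -
      have "?Q b a b' a'" "?Q c b c' b'" using f(3) that by blast+
      then have "?Q c a c' a'" using Q_comp that by blast
      then show ?thesis using f(3) that by blast
    qed
    show "f (b @ a) = f (b' @ a')" if "a \<in> P" "b \<in> P" "a' \<in> P" "b' \<in> P" "f (a @ b) = f (a' @ b')" for a b a' b'
      using f(3) Q_swap that by blast
    show "f (a @ a) = f (b @ b)" if "a \<in> P" "b \<in> P" for a b using f(3) Q_id that by blast
  qed
  \<comment> \<open>The properties of \<open>?Q\<close> change places: identity, swap and
    composition make the relation of \<open>g\<close> an equivalence and give the arrow laws for
    \<open>f\<close>; reflexivity, symmetry and transitivity do the reverse.\<close>
  interpret H: arrows P "\<lambda>a b. g (a @ b)"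
  proof
    show "P \<noteq> {}" using a0(1) by blast
    show "\<exists>b'\<in>P. g (a' @ b') = g (a @ b)" if ab: "a \<in> P" "b \<in> P" "a' \<in> P" for a b a'
    proof -
      obtain b' where b': "b' \<in> P" "?Q a a' b b'" using Q_ex[OF ab(1,3,2)] by blast
      then have "g (a @ b) = g (a' @ b')" using g(3)[OF ab b'(1)] by blast
      then show ?thesis using b'(1) by metis
    qed
    show "b = b'" if "a \<in> P" "b \<in> P" "b' \<in> P" "g (a @ b) = g (a @ b')" for a b b'
    proof -
      have "?Q a a b b'" using g(3) that by blast
      then show ?thesis using Q_unique Q_id that by blast
    qed
    show "g (a @ c) = g (a' @ c')" if "a \<in> P" "b \<in> P" "c \<in> P" "a' \<in> P" "b' \<in> P" "c' \<in> P"
      "g (a @ b) = g (a' @ b')" "g (b @ c) = g (b' @ c')" for a b c a' b' c'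
    proof -
      have "?Q a a' b b'" "?Q b b' c c'" using g(3) that by blast+
      then have "?Q a a' c c'" using Q_trans that by blast
      then show ?thesis using g(3) that by blast
    qed
    show "g (b @ a) = g (b' @ a')" if "a \<in> P" "b \<in> P" "a' \<in> P" "b' \<in> P" "g (a @ b) = g (a' @ b')" for a b a' b'
      using Q_sym[OF that(1,3,2,4)] that(5) unfolding g(3)[OF that(1-4)] g(3)[OF that(2,1,4,3)] by blast
    show "g (a @ a) = g (b @ b)" if "a \<in> P" "b \<in> P" for a b using g(3) Q_refl that by blast
  qed

  \<comment> \<open>The bitorsor\<close>
  note Gdef = definable_arrows[OF G.arrows_axioms Pdef f(1,2)]
  note Hdef = definable_arrows[OF H.arrows_axioms Pdef g(1,2)]
  have compat: "H.right_act (G.left_act x a) y = G.left_act x (H.right_act a y)"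
    if x: "x \<in> G.arrow_set" and a: "a \<in> P" and y: "y \<in> H.arrow_set" for x a y
  proof -
    obtain b where b: "b \<in> P" "x = f (b @ a)" using G.arrow_to[OF x a] by metis
    obtain c where c: "c \<in> P" "y = g (a @ c)" using H.arrow_from[OF y a] by metis
    \<comment> \<open>The automorphism taking \<open>a\<close> to \<open>b\<close> takes
      \<open>c\<close> to \<open>d\<close>. So \<open>x\<close> also takes \<open>c\<close> to
      \<open>d\<close>, and the pair \<open>(b, d)\<close> has the code \<open>y\<close> of
      \<open>(a, c)\<close>: both sides are equal to \<open>d\<close>.\<close>
    obtain d where d: "d \<in> P" "?Q a b c d" using Q_ex a b(1) c(1) by blast
    have "y = g (b @ d)" using g(3) d a b c by blast
    moreover have "x = f (d @ c)" using f(3) d a b c by blast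
    ultimately show ?thesis using a b c d
      by (metis G.left_act_arr H.right_act_arr)
  qed
  have ga: "group_action G.arrow_group P G.left_act"
    using G.left_faithful_action by (simp add: faithful_action_def)
  have "bitorsor G.arrow_group G.left_act P H.arrow_group H.right_act"
    unfolding bitorsor_def G.carrier_arrows H.carrier_arrows
    using ga H.right_action_arrows compat G.left_act_unique H.right_act_unique by blast
  then have tors: "definable_bitorsor L M B \<rho> G.arrow_group G.left_act \<sigma> P \<eta> H.arrow_group H.right_act"
    unfolding definable_bitorsor_def using Gdef(1,2) Hdef(1,3) Pdef by blast

  \<comment> \<open>Identification of the left group with the automorphisms over \<open>B\<close>
    and \<open>C\<close>\<close>
  have aut_left: "restrict (map h) P = G.left_act (f (map h a @ a))"
    if h: "h \<in> automorphisms L M ?A" and a: "a \<in> P" for h a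
  proof
    fix x
    show "restrict (map h) P x = G.left_act (f (map h a @ a)) x"
    proof (cases "x \<in> P")
      case True
      then have "?Q a (map h a) x (map h x)" using Q_aut[OF h a True autP[OF h True]] by simp
      \<comment> \<open>The code of \<open>h\<close> can be computed at any point of
        \<open>P\<close>, in particular at \<open>x\<close>.\<close>
      then have "f (map h a @ a) = f (map h x @ x)" using f(3) a True autP[OF h] by blast
      then show ?thesis using True G.left_act_arr autP[OF h True] by simp
    qed (simp add: G.left_act_def)
  qed
  have image: "G.left_act ` G.arrow_set = carrier (Aut_over L M B C \<sigma> p)"
  proof (intro equalityI subsetI)
    fix u assume "u \<in> G.left_act ` G.arrow_set"
    then obtain b a where ba: "b \<in> P" "a \<in> P" "u = G.left_act (f (b @ a))" by (auto simp: G.arrow_set_def)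
    obtain h where h: "h \<in> automorphisms L M ?A" "map h a = b" using homog ba(1,2) by blast
    have "u = restrict (map h) P" using aut_left[OF h(1) ba(2)] h(2) ba(3) by simp
    with h(1) show "u \<in> carrier (Aut_over L M B C \<sigma> p)" by (simp add: Aut_over_def P_def)
  next
    fix u assume "u \<in> carrier (Aut_over L M B C \<sigma> p)"
    then obtain h where h: "h \<in> automorphisms L M ?A" "u = restrict (map h) P" by (auto simp: Aut_over_def P_def)
    have "f (map h a0 @ a0) \<in> G.arrow_set" using G.arr_in autP[OF h(1)] a0(1) by blast
    then show "u \<in> G.left_act ` G.arrow_set" using aut_left[OF h(1) a0(1)] h(2) by blast
  qed
  have "G.left_act \<in> iso G.arrow_group (Aut_over L M B C \<sigma> p)"
  proof -
    have inj: "inj_on G.left_act G.arrow_set"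
      using G.left_faithful_action by (simp add: faithful_action_def faithful_action_axioms_def G.carrier_arrows)
    have "G.left_act (x \<otimes>\<^bsub>G.arrow_group\<^esub> y) = G.left_act x \<otimes>\<^bsub>Aut_over L M B C \<sigma> p\<^esub> G.left_act y"
      if "x \<in> G.arrow_set" "y \<in> G.arrow_set" for x y
    proof -
      have "mult (Aut_over L M B C \<sigma> p) = mult (BijGroup P)" by (simp add: Aut_over_def P_def)
      then show ?thesis using hom_mult[OF G.left_act_hom, of x y] that by (simp add: G.carrier_arrows)
    qed
    then have "G.left_act \<in> hom G.arrow_group (Aut_over L M B C \<sigma> p)"
      using image by (intro homI) (auto simp: G.carrier_arrows)
    then show ?thesis using inj image by (simp add: iso_def bij_betw_def G.carrier_arrows)
  qed
  \<comment> \<open>The action is definable outright. Its graph can serve as the set cutting it out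
    relatively, once it is known to lie in the product.\<close>
  moreover have "graph2 (carrier G.arrow_group) P G.left_act \<subseteq>
      {u @ a @ b | u a b. u \<in> carrier G.arrow_group \<and> a \<in> P \<and> b \<in> P}"
  proof
    fix w assume "w \<in> graph2 (carrier G.arrow_group) P G.left_act"
    then obtain u a where w: "w = u @ a @ G.left_act u a" "u \<in> G.arrow_set" "a \<in> P"
      unfolding graph2_def G.carrier_arrows by blast
    moreover have "G.left_act u a \<in> P" using G.left_act_iff[OF w(2,3), of "G.left_act u a"] by simp
    ultimately show "w \<in> {u @ a @ b | u a b. u \<in> carrier G.arrow_group \<and> a \<in> P \<and> b \<in> P}"
      unfolding G.carrier_arrows by blast
  qed
  ultimately have bind: "binding_group L M B C \<sigma> p \<rho> G.arrow_group G.left_act"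
    unfolding binding_group_def P_def[symmetric]
    using Gdef(1,2) G.left_faithful_action by blast

  \<comment> \<open>Definability of the right group's elements over \<open>B\<close> and
    \<open>C\<close>\<close>
  have "coords (carrier H.arrow_group) \<subseteq> dcl L M ?A"
  proof -
    have "set x \<subseteq> dcl L M ?A" if "x \<in> H.arrow_set" for x
    proof -
      obtain a b where ab: "a \<in> P" "b \<in> P" "x = g (a @ b)" using \<open>x \<in> H.arrow_set\<close> by (auto simp: H.arrow_set_def)
      obtain i c where i: "i \<in> \<F>" "c \<in> power_set C (fst i)" "val M \<sigma> (snd i) a c b"
        using reach[OF ab(1,2)] unfolding reach_def by blast
      have tm: "tm M B \<Gamma> y \<tau> \<Longrightarrow> tm M ?A \<Gamma> y \<tau>" for \<Gamma> y \<tau> by (rule tm_mono) auto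
      have Dg: "Dp L M ?A \<Gamma> (\<lambda>e. g (y e @ z e) = w e)"
        if "tm M ?A \<Gamma> y \<sigma>" "tm M ?A \<Gamma> z \<sigma>" "tm M ?A \<Gamma> w \<eta>" for \<Gamma> y z w
        using definable_arrows(4)[OF H.arrows_axioms definable_mono[OF Pdef] g(1) definable_mono[OF g(2)]] that by blast
      have xT: "x \<in> tuples M \<eta>" using Hdef(5) that by (auto simp: H.carrier_arrows)
      \<comment> \<open>The points of \<open>P\<close> are quantified away, leaving only
        \<open>B\<close> and \<open>c\<close> as parameters; pairs linked by the same
        \<open>i\<close> and \<open>c\<close> are conjugate.\<close>
      have "definable L M ?A \<eta> {z \<in> tuples M \<eta>. \<exists>a\<in>P. \<exists>b\<in>P. val M \<sigma> (snd i) a c b \<and> g (a @ b) = z}"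
        by (intro definable_Collect Dp_exX[OF Pdef] Dp_conj Dp_val[OF \<F>(2)[OF i(1)]] Dg tm_intros tm_const power[OF i(2)]) auto
      moreover have "{z \<in> tuples M \<eta>. \<exists>a\<in>P. \<exists>b\<in>P. val M \<sigma> (snd i) a c b \<and> g (a @ b) = z} = {x}"
      proof -
        have "g (a' @ b') = x" if ab': "a' \<in> P" "b' \<in> P" "val M \<sigma> (snd i) a' c b'" for a' b'
        proof -
          have "?Q a' a b' b" using i ab'(3) unfolding transport_def by blast
          then show ?thesis using g(3) ab ab' by blast
        qed
        then show ?thesis using ab i(3) xT by blast
      qed
      ultimately show ?thesis using dcl_tupleI by metis
    qed
    then show ?thesis by (auto simp: coords_def H.carrier_arrows)
  qed
  then show ?thesis using tors bind unfolding P_def by blast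
qed

end
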